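(* Let $U$ be a complete length $\mathrm{CAT}(\kappa)$ space and let $\{f_t\}$ be a family of functions defined on an open set $\Omega=\{(x,t)\in U\times\mathbb{R}: x\in\mathrm{Dom}f_t\}$. Suppose the family is Lipschitz and locally semiconcave. Then for every time $a$ and every initial point $p\in\mathrm{Dom}f_a$ there is a unique $f_t$-gradient curve $\alpha$ with $\alpha(a)=p$ defined on a maximal semi-open interval $[a,b)$, $b\in(a,\infty]$. Moreover, if $b<\infty$, then $(\alpha(t),t)$ escapes from every closed set $K\subset\Omega$, i.e. for every closed $K\subset\Omega$ there is $t_0<b$ with $(\alpha(t),t)\notin K$ for all $t\in(t_0,b)$.
   Context: A family $f_t$ is Lipschitz if $(x,t)\mapsto f_t(x)$ is $L$-Lipschitz on $\Omega$ for some $L$. It is locally semiconcave if every $(p_0,t_0)\in\Omega$ has a neighborhood $\Omega'$ and $\lambda\in\mathbb{R}$ such that each $f_t$ restricted to $\Omega'$ is $\lambda$-concave, where $\lambda$-concave means $s\mapsto f(\sigma(s))-\tfrac\lambda2 s^2$ is concave along every unit-speed geodesic $\sigma$ in the domain. $T_q$ denotes the tangent cone at $q$, $\uparrow_q^p\in T_q$ the unit direction of a geodesic $[qp]$, and $d_qf(\uparrow_q^p)$ the right derivative at $0$ of $f$ along the unit-speed geodesic from $q$ to $p$. A Lipschitz curve $\alpha$ is an $f_t$-gradient curve if for every point $p$ and time $t$ for which a geodesic $[\alpha(t)\,p]$ exists, $|p-\alpha(t+\epsilon)|\le|p-\alpha(t)|-\epsilon\cdot d_{\alpha(t)}f_t(\uparrow_{\alpha(t)}^p)+o(\epsilon)$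 as $\epsilon\to0^+$. *)

theory Defs
  imports "HOL-Analysis.Analysis"
begin

definition geodesic_seg :: "(real \<Rightarrow> 'a::metric_space) \<Rightarrow> 'a \<Rightarrow> 'a \<Rightarrow> bool" where
  "geodesic_seg \<gamma> x y \<longleftrightarrow> \<gamma> 0 = x \<and> \<gamma> (dist x y) = y \<and>
     (\<forall>s\<in>{0..dist x y}. \<forall>s'\<in>{0..dist x y}. dist (\<gamma> s) (\<gamma> s') = \<bar>s - s'\<bar>)"

definition curve_length :: "(real \<Rightarrow> 'a::metric_space) \<Rightarrow> real \<Rightarrow> real \<Rightarrow> ereal" where
  "curve_length \<gamma> a b = Sup {ereal (\<Sum>i<n. dist (\<gamma> (ts i)) (\<gamma> (ts (Suc i)))) | n ts.
       ts 0 = a \<and> ts n = b \<and> (\<forall>i<n. ts i \<le> ts (Suc i))}"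

definition length_space :: "'a::metric_space set \<Rightarrow> bool" where
  "length_space S \<longleftrightarrow> (\<forall>x\<in>S. \<forall>y\<in>S. \<forall>e>0. \<exists>\<gamma>. continuous_on {0..1} \<gamma> \<and> \<gamma> ` {0..1} \<subseteq> S \<and>
      \<gamma> 0 = x \<and> \<gamma> 1 = y \<and> curve_length \<gamma> 0 1 \<le> ereal (dist x y + e))"

definition D_kappa :: "real \<Rightarrow> ereal" where
  "D_kappa \<kappa> = (if \<kappa> \<le> 0 then \<infinity> else ereal (pi / sqrt \<kappa>))"

text \<open>Model plane M_\<kappa> realised in R^3: Euclidean plane, sphere of radius 1/sqrt \<kappa>,
  or the upper sheet of the hyperboloid in Minkowski space.\<close>
definition model_space :: "real \<Rightarrow> (real \<times> real \<times> real) set" where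
  "model_space \<kappa> =
     (if \<kappa> = 0 then {(x, y, z). z = 0}
      else if \<kappa> > 0 then {(x, y, z). x\<^sup>2 + y\<^sup>2 + z\<^sup>2 = 1 / \<kappa>}
      else {(x, y, z). z > 0 \<and> x\<^sup>2 + y\<^sup>2 - z\<^sup>2 = 1 / \<kappa>})"

definition model_dist :: "real \<Rightarrow> real \<times> real \<times> real \<Rightarrow> real \<times> real \<times> real \<Rightarrow> real" where
  "model_dist \<kappa> u v =
     (case u of (x, y, z) \<Rightarrow> case v of (x', y', z') \<Rightarrow>
      if \<kappa> = 0 then sqrt ((x - x')\<^sup>2 + (y - y')\<^sup>2 + (z - z')\<^sup>2)
      else if \<kappa> > 0 then arccos (\<kappa> * (x * x' + y * y' + z * z')) / sqrt \<kappa>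
      else arcosh (\<kappa> * (x * x' + y * y' - z * z')) / sqrt (- \<kappa>))"

text \<open>x' is the comparison point on the model side [a' b'] (of length l) at distance s from a'.\<close>
definition cmp_point :: "real \<Rightarrow> real \<times> real \<times> real \<Rightarrow> real \<times> real \<times> real \<Rightarrow> real \<Rightarrow> real
    \<Rightarrow> real \<times> real \<times> real \<Rightarrow> bool" where
  "cmp_point \<kappa> a' b' l s x' \<longleftrightarrow> x' \<in> model_space \<kappa> \<and> model_dist \<kappa> a' x' = s \<and> model_dist \<kappa> x' b' = l - s"

text \<open>Sides of a geodesic triangle: (start, end, geodesic, comparison start, comparison end).\<close>
definition CAT :: "real \<Rightarrow> 'a::metric_space set \<Rightarrow> bool" where
  "CAT \<kappa> S \<longleftrightarrow>
     (\<forall>x\<in>S. \<forall>y\<in>S. ereal (dist x y) < D_kappa \<kappa> \<longrightarrow>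
        (\<exists>\<gamma>. geodesic_seg \<gamma> x y \<and> \<gamma> ` {0..dist x y} \<subseteq> S)) \<and>
     (\<forall>p\<in>S. \<forall>q\<in>S. \<forall>r\<in>S. \<forall>\<gamma>1 \<gamma>2 \<gamma>3.
        geodesic_seg \<gamma>1 p q \<and> \<gamma>1 ` {0..dist p q} \<subseteq> S \<and>
        geodesic_seg \<gamma>2 q r \<and> \<gamma>2 ` {0..dist q r} \<subseteq> S \<and>
        geodesic_seg \<gamma>3 r p \<and> \<gamma>3 ` {0..dist r p} \<subseteq> S \<and>
        ereal (dist p q + dist q r + dist r p) < 2 * D_kappa \<kappa> \<longrightarrow>
        (\<exists>p' q' r'. p' \<in> model_space \<kappa> \<and> q' \<in> model_space \<kappa> \<and> r' \<in> model_space \<kappa> \<and>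
           model_dist \<kappa> p' q' = dist p q \<and> model_dist \<kappa> q' r' = dist q r \<and>
           model_dist \<kappa> r' p' = dist r p \<and>
           (\<forall>S1\<in>set [(p, q, \<gamma>1, p', q'), (q, r, \<gamma>2, q', r'), (r, p, \<gamma>3, r', p')].
            \<forall>S2\<in>set [(p, q, \<gamma>1, p', q'), (q, r, \<gamma>2, q', r'), (r, p, \<gamma>3, r', p')].
              case S1 of (a1, b1, g1, a1', b1') \<Rightarrow> case S2 of (a2, b2, g2, a2', b2') \<Rightarrow>
              (\<forall>s1\<in>{0..dist a1 b1}. \<forall>s2\<in>{0..dist a2 b2}. \<forall>x' y'.
                 cmp_point \<kappa> a1' b1' (dist a1 b1) s1 x' \<and> cmp_point \<kappa> a2' b2' (dist a2 b2) s2 y' \<longrightarrow>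
                 dist (g1 s1) (g2 s2) \<le> model_dist \<kappa> x' y'))))"

text \<open>f t is defined on Dom f_t = {x. (x,t) \<in> \<Omega>}.\<close>
definition lipschitz_family :: "(real \<Rightarrow> 'a::metric_space \<Rightarrow> real) \<Rightarrow> ('a \<times> real) set \<Rightarrow> bool" where
  "lipschitz_family f \<Omega> \<longleftrightarrow> (\<exists>L. L-lipschitz_on \<Omega> (\<lambda>(x, t). f t x))"

definition lambda_concave_on :: "real \<Rightarrow> 'a::metric_space set \<Rightarrow> ('a \<Rightarrow> real) \<Rightarrow> bool" where
  "lambda_concave_on c A g \<longleftrightarrow> (\<forall>x y \<sigma>. geodesic_seg \<sigma> x y \<and> \<sigma> ` {0..dist x y} \<subseteq> A \<longrightarrow>
      concave_on {0..dist x y} (\<lambda>s. g (\<sigma> s) - c / 2 * s\<^sup>2))"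

definition locally_semiconcave_family :: "(real \<Rightarrow> 'a::metric_space \<Rightarrow> real) \<Rightarrow> ('a \<times> real) set \<Rightarrow> bool" where
  "locally_semiconcave_family f \<Omega> \<longleftrightarrow>
     (\<forall>z\<in>\<Omega>. \<exists>W c. open W \<and> z \<in> W \<and> W \<subseteq> \<Omega> \<and>
        (\<forall>t. lambda_concave_on c {x. (x, t) \<in> W} (f t)))"

text \<open>Right derivative at 0 of g along the unit-speed geodesic \<gamma> from q to p (q \<noteq> p).\<close>
definition has_dir_deriv :: "('a::metric_space \<Rightarrow> real) \<Rightarrow> (real \<Rightarrow> 'a) \<Rightarrow> 'a \<Rightarrow> 'a \<Rightarrow> real \<Rightarrow> bool" where
  "has_dir_deriv g \<gamma> q p D \<longleftrightarrow>
     ((\<lambda>s. (g (\<gamma> s) - g q) / s) \<longlongrightarrow> D) (at 0 within {0<..dist q p})"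

definition gradient_curve :: "(real \<Rightarrow> 'a::metric_space \<Rightarrow> real) \<Rightarrow> ('a \<times> real) set \<Rightarrow> (real \<Rightarrow> 'a)
    \<Rightarrow> real set \<Rightarrow> bool" where
  "gradient_curve f \<Omega> \<alpha> I \<longleftrightarrow>
     (\<exists>L. L-lipschitz_on I \<alpha>) \<and> (\<forall>t\<in>I. (\<alpha> t, t) \<in> \<Omega>) \<and>
     (\<forall>t\<in>I. \<forall>p \<gamma> D. p \<noteq> \<alpha> t \<and> geodesic_seg \<gamma> (\<alpha> t) p \<and> has_dir_deriv (f t) \<gamma> (\<alpha> t) p D \<longrightarrow>
        (\<forall>e>0. eventually (\<lambda>\<epsilon>. dist p (\<alpha> (t + \<epsilon>)) \<le> dist p (\<alpha> t) - \<epsilon> * D + e * \<epsilon>) (at_right 0)))"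

end

theory Submission
  imports Defs
begin

text \<open>
  Existence is local. For a small step \<open>h\<close>, the functional \<open>f\<^sub>t - \<phi> (dist x \<sqdot>) / h\<close>, with \<open>\<phi>\<close> the modified square
  distance of the model plane, is strongly concave near \<open>x\<close> and has a maximum \<open>y\<close> by completeness. The first
  variation at \<open>y\<close> gives a discrete evolution variational inequality
  \<open>\<phi> (dist y p) \<le> \<phi> (dist x p) + h (f\<^sub>t x - f\<^sub>t p + \<Lambda> \<phi> (dist x p)) + C h\<^sup>2\<close> for all \<open>p\<close> near \<open>x\<close>. Two discrete curves
  satisfying it stay close, so they converge as \<open>h \<rightarrow> 0\<close>, and the limit satisfies the inequality without the
  discretisation error; on a short geodesic this is exactly the defining property of a gradient curve.
  Two gradient curves starting at the same point agree: by semiconcavity their distance to the midpoint between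
  them shows that their mutual distance grows at most exponentially. The maximal curve is the union of all
  gradient curves; if it accumulated in a closed subset of \<open>\<Omega>\<close> at a finite time, the Lipschitz bound and
  completeness would give a limit point in \<open>\<Omega>\<close> from which it could be continued.
\<close>

section \<open>Geodesics and comparison in the model planes\<close>

text \<open>The condition defining a gradient curve is infinitesimal and does not survive pointwise
  limits of discrete curves. The evolution variational inequality is integrated in time and closed
  under such limits, so the construction is carried out at that level and derivatives return only at
  the end. The space need not be locally compact: maximisers and limits of the scheme come from
  Cauchy estimates, based on strong convexity of the penalty and on stability of the inequality.
  Hypotheses on the family are local, so the constants are chosen to keep all test points in one
  ball \<open>ball p0 r\<close>, in which mutual distances are at most \<open>R\<close> and
  comparison is available. A geodesic in the definition of a gradient curve may be long, but only a
  short initial piece of it is compared. One constant must be uniform: the speed bound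
  \<open>8 * L\<close> depends on the Lipschitz constant of the family alone and not on the starting
  point.\<close>

lemma geodesic_seg_dist_start:
  assumes "geodesic_seg \<gamma> x y" "0 \<le> s" "s \<le> dist x y"
  shows "dist x (\<gamma> s) = s"
proof -
  have "\<gamma> 0 = x" and "\<forall>s\<in>{0..dist x y}. \<forall>s'\<in>{0..dist x y}. dist (\<gamma> s) (\<gamma> s') = \<bar>s - s'\<bar>"
    using assms(1) by (auto simp: geodesic_seg_def)
  then have "dist (\<gamma> 0) (\<gamma> s) = \<bar>0 - s\<bar>" using assms by (auto simp del: diff_0)
  then show ?thesis using \<open>\<gamma> 0 = x\<close> assms(2) by simp
qed

lemma geodesic_seg_dist:
  assumes "geodesic_seg \<gamma> x y" "s \<in> {0..dist x y}" "s' \<in> {0..dist x y}"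
  shows "dist (\<gamma> s) (\<gamma> s') = \<bar>s - s'\<bar>"
  using assms unfolding geodesic_seg_def by blast

lemma geodesic_seg_dist_end:
  assumes "geodesic_seg \<gamma> x y" "0 \<le> s" "s \<le> dist x y"
  shows "dist y (\<gamma> s) = dist x y - s"
proof -
  have "\<gamma> (dist x y) = y" using assms by (simp add: geodesic_seg_def)
  then show ?thesis using geodesic_seg_dist[OF assms(1), of "dist x y" s] assms(2,3) by simp
qed

lemma geodesic_seg_initial:
  assumes "geodesic_seg \<gamma> x y" "0 \<le> s" "s \<le> dist x y"
  shows "geodesic_seg \<gamma> x (\<gamma> s)"
proof -
  have "\<gamma> 0 = x" using assms(1) by (simp add: geodesic_seg_def)
  moreover have "dist (\<gamma> u) (\<gamma> u') = \<bar>u - u'\<bar>" if "u \<in> {0..s}" "u' \<in> {0..s}" for u u'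
    using that assms by (intro geodesic_seg_dist[OF assms(1)]) auto
  ultimately show ?thesis
    unfolding geodesic_seg_def geodesic_seg_dist_start[OF assms] by blast
qed

lemma geodesic_seg_reverse:
  assumes "geodesic_seg \<gamma> x y"
  shows "geodesic_seg (\<lambda>s. \<gamma> (dist x y - s)) y x"
proof -
  have "\<gamma> 0 = x" "\<gamma> (dist x y) = y" using assms by (simp_all add: geodesic_seg_def)
  moreover have "dist (\<gamma> (dist x y - u)) (\<gamma> (dist x y - u')) = \<bar>u - u'\<bar>"
    if "u \<in> {0..dist x y}" "u' \<in> {0..dist x y}" for u u'
    using geodesic_seg_dist[OF assms, of "dist x y - u" "dist x y - u'"] that by auto
  ultimately show ?thesis unfolding geodesic_seg_def by (simp add: dist_commute)
qed

text \<open>Comparing a point on one side with the opposite vertex is all that is needed. The vertex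
  \<open>x\<close> enters as the far end of the side from \<open>p\<close> to \<open>x\<close>, and
  \<open>x'\<close> is its comparison point as soon as model distances from a point to itself
  vanish; hence the hypothesis \<open>refl\<close>, checked separately in each model.\<close>

lemma CAT_comparison_triangle:
  fixes \<gamma> :: "real \<Rightarrow> 'a::metric_space"
  assumes cat: "CAT \<kappa> (UNIV :: 'a set)"
    and \<gamma>: "geodesic_seg \<gamma> y p"
    and D: "ereal (dist p x) < D_kappa \<kappa>" "ereal (dist x y) < D_kappa \<kappa>"
    and per: "ereal (dist y p + dist p x + dist x y) < 2 * D_kappa \<kappa>"
    and refl: "\<And>u. u \<in> model_space \<kappa> \<Longrightarrow> model_dist \<kappa> u u = 0"
  obtains y' p' x' where "y' \<in> model_space \<kappa>" "p' \<in> model_space \<kappa>" "x' \<in> model_space \<kappa>"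
    "model_dist \<kappa> y' p' = dist y p" "model_dist \<kappa> p' x' = dist p x" "model_dist \<kappa> x' y' = dist x y"
    "\<And>s z'. s \<in> {0..dist y p} \<Longrightarrow> cmp_point \<kappa> y' p' (dist y p) s z' \<Longrightarrow> dist (\<gamma> s) x \<le> model_dist \<kappa> z' x'"
proof -
  obtain \<gamma>2 where g2: "geodesic_seg \<gamma>2 p x"
    using cat[unfolded CAT_def, THEN conjunct1] D(1) by blast
  obtain \<gamma>3 where g3: "geodesic_seg \<gamma>3 x y"
    using cat[unfolded CAT_def, THEN conjunct1] D(2) by blast
  have sides: "geodesic_seg \<gamma> y p \<and> \<gamma> ` {0..dist y p} \<subseteq> UNIV \<and>
      geodesic_seg \<gamma>2 p x \<and> \<gamma>2 ` {0..dist p x} \<subseteq> UNIV \<and>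
      geodesic_seg \<gamma>3 x y \<and> \<gamma>3 ` {0..dist x y} \<subseteq> UNIV \<and>
      ereal (dist y p + dist p x + dist x y) < 2 * D_kappa \<kappa>"
    using \<gamma> g2 g3 per by simp
  obtain y' p' x' where m: "y' \<in> model_space \<kappa>" "p' \<in> model_space \<kappa>" "x' \<in> model_space \<kappa>"
    "model_dist \<kappa> y' p' = dist y p" "model_dist \<kappa> p' x' = dist p x" "model_dist \<kappa> x' y' = dist x y"
    and c: "\<forall>s1\<in>{0..dist y p}. \<forall>s2\<in>{0..dist p x}. \<forall>u v.
                 cmp_point \<kappa> y' p' (dist y p) s1 u \<and> cmp_point \<kappa> p' x' (dist p x) s2 v \<longrightarrow>
                 dist (\<gamma> s1) (\<gamma>2 s2) \<le> model_dist \<kappa> u v"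
    using cat[unfolded CAT_def, THEN conjunct2, rule_format, OF UNIV_I UNIV_I UNIV_I sides]
    by (simp only: list.set insert_iff ball_simps prod.case simp_thms) (elim exE conjE, rule that, assumption+)
  have "cmp_point \<kappa> p' x' (dist p x) (dist p x) x'"
    using m refl by (simp add: cmp_point_def)
  moreover have "\<gamma>2 (dist p x) = x" using g2 by (simp add: geodesic_seg_def)
  ultimately have "dist (\<gamma> s) x \<le> model_dist \<kappa> z' x'"
    if "s \<in> {0..dist y p}" "cmp_point \<kappa> y' p' (dist y p) s z'" for s z'
    using c that by (metis atLeastAtMost_iff order_refl zero_le_dist)
  with m that show ?thesis by blast
qed

section \<open>Spherical comparison\<close>

lemma model_space_pos: "\<kappa> > 0 \<Longrightarrow> u \<in> model_space \<kappa> \<longleftrightarrow> u \<bullet> u = 1 / \<kappa>"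
  by (cases u) (auto simp: model_space_def power2_eq_square)

lemma model_dist_pos: "\<kappa> > 0 \<Longrightarrow> model_dist \<kappa> u v = arccos (\<kappa> * (u \<bullet> v)) / sqrt \<kappa>"
  by (cases u; cases v) (simp add: model_dist_def add.assoc)

text \<open>Along a geodesic of the sphere of radius \<open>1 / k\<close>,
  \<open>cos (k * d)\<close> of the distance to a fixed point solves g'' = - k^2 g, so it is the
  sine interpolation of its end values; the CAT condition shortens distances and enlarges cosines.
  Sides of length at most \<open>1 / k\<close> stay below pi / k, with perimeter below 2 pi /
  k.\<close>

lemma CAT_pos_comparison:
  fixes \<gamma> :: "real \<Rightarrow> 'a::metric_space"
  assumes cat: "CAT \<kappa> (UNIV :: 'a set)" and \<kappa>: "\<kappa> > 0" and k: "k = sqrt \<kappa>"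
    and \<gamma>: "geodesic_seg \<gamma> y p"
    and small: "k * dist y p \<le> 1" "k * dist p x \<le> 1" "k * dist x y \<le> 1" and "y \<noteq> p"
    and s: "0 \<le> s" "s \<le> dist y p"
  shows "sin (k * dist y p) * cos (k * dist x (\<gamma> s)) \<ge>
    sin (k * (dist y p - s)) * cos (k * dist x y) + sin (k * s) * cos (k * dist x p)"
proof -
  define l where "l = dist y p"
  have k0: "k > 0" using \<kappa> k by auto
  have pi3: "pi > 3" using pi_gt3 .
  have refl: "model_dist \<kappa> u u = 0" if "u \<in> model_space \<kappa>" for u
    using that \<kappa> by (simp add: model_space_pos model_dist_pos)
  have D: "D_kappa \<kappa> = ereal (pi / k)" using \<kappa> k by (simp add: D_kappa_def)
  have lt: "d < pi / k" if "k * d \<le> 1" for d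
    using that k0 pi3 by (simp add: field_simps)
  have "dist y p + dist p x + dist x y < 2 * (pi / k)"
    using small k0 pi3 by (simp add: field_simps)
  then have per: "ereal (dist y p + dist p x + dist x y) < 2 * D_kappa \<kappa>"
    by (simp add: D)
  obtain y' p' x' where m: "y' \<in> model_space \<kappa>" "p' \<in> model_space \<kappa>" "x' \<in> model_space \<kappa>"
    "model_dist \<kappa> y' p' = dist y p" "model_dist \<kappa> p' x' = dist p x" "model_dist \<kappa> x' y' = dist x y"
    and cmp: "\<And>s z'. s \<in> {0..dist y p} \<Longrightarrow> cmp_point \<kappa> y' p' (dist y p) s z' \<Longrightarrow> dist (\<gamma> s) x \<le> model_dist \<kappa> z' x'"
    by (rule CAT_comparison_triangle[OF cat \<gamma> _ _ per refl]) (use lt small D in auto)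
  have CS: "\<bar>\<kappa> * (u \<bullet> v)\<bar> \<le> 1" if "u \<in> model_space \<kappa>" "v \<in> model_space \<kappa>" for u v
  proof -
    have "norm u * norm v = 1 / \<kappa>"
      using that \<kappa> by (simp add: model_space_pos norm_eq_sqrt_inner)
    then have "\<bar>u \<bullet> v\<bar> \<le> 1 / \<kappa>" using Cauchy_Schwarz_ineq2[of u v] by simp
    then show ?thesis using \<kappa> by (simp add: abs_mult field_simps)
  qed
  have cosd: "\<kappa> * (u \<bullet> v) = cos (k * model_dist \<kappa> u v)" if "u \<in> model_space \<kappa>" "v \<in> model_space \<kappa>" for u v
    using CS[OF that] \<kappa> k by (simp add: model_dist_pos cos_arccos_abs)
  have yp: "\<kappa> * (y' \<bullet> p') = cos (k * l)" using cosd[of y' p'] m by (simp add: l_def)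
  have px: "\<kappa> * (p' \<bullet> x') = cos (k * dist x p)" using cosd[of p' x'] m by (simp add: dist_commute)
  have yx: "\<kappa> * (y' \<bullet> x') = cos (k * dist x y)" using cosd[of x' y'] m by (simp add: inner_commute)
  have yy: "\<kappa> * (y' \<bullet> y') = 1" "\<kappa> * (p' \<bullet> p') = 1" using m \<kappa> by (auto simp: model_space_pos)
  define A B where "A = k * (l - s)" and "B = k * s"
  have AB: "A + B = k * l" by (simp add: A_def B_def algebra_simps)
  have l0: "l > 0" using \<open>y \<noteq> p\<close> by (simp add: l_def)
  have kl: "0 < k * l" "k * l \<le> 1" using l0 k0 small by (auto simp: l_def)
  have A01: "0 \<le> A" "0 \<le> B" using s k0 by (auto simp: A_def B_def l_def)
  define S where "S = sin (A + B)"
  have S0: "S > 0" unfolding S_def AB using kl pi3 by (intro sin_gt_zero) auto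
  \<comment> \<open>Spherical interpolation between \<open>y'\<close> and \<open>p'\<close>: the
    explicit comparison point at distance \<open>s\<close> from \<open>y'\<close>.\<close>
  define z' where "z' = (sin A / S) *\<^sub>R y' + (sin B / S) *\<^sub>R p'"
  have yz: "\<kappa> * (y' \<bullet> z') = (sin A + sin B * cos (A+B)) / S"
  proof -
    have "\<kappa> * (y' \<bullet> z') = sin A / S * (\<kappa> * (y' \<bullet> y')) + sin B / S * (\<kappa> * (y' \<bullet> p'))"
      by (simp add: z'_def inner_right_distrib algebra_simps)
    then show ?thesis unfolding yy yp AB by (simp add: add_divide_distrib)
  qed
  have zp: "\<kappa> * (z' \<bullet> p') = (sin B + sin A * cos (A+B)) / S"
  proof -
    have "\<kappa> * (z' \<bullet> p') = sin A / S * (\<kappa> * (y' \<bullet> p')) + sin B / S * (\<kappa> * (p' \<bullet> p'))"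
      by (simp add: z'_def inner_left_distrib algebra_simps)
    then show ?thesis unfolding yy yp AB by (simp add: add_divide_distrib)
  qed
  have trig: "sin A + sin B * cos (A+B) = cos B * sin (A+B)" for A B :: real
  proof -
    have "sin A = sin ((A+B) - B)" by simp
    also have "\<dots> = sin (A+B) * cos B - cos (A+B) * sin B" by (rule sin_diff)
    finally show ?thesis by simp
  qed
  have yz': "\<kappa> * (y' \<bullet> z') = cos B" using yz trig[of A B] S0 by (simp add: S_def)
  have zp': "\<kappa> * (z' \<bullet> p') = cos A" using zp trig[of B A] S0 by (simp add: S_def add.commute)
  have "\<kappa> * (z' \<bullet> z') = sin A / S * (\<kappa> * (y' \<bullet> z')) + sin B / S * (\<kappa> * (z' \<bullet> p'))"
    by (subst z'_def) (simp add: inner_left_distrib inner_commute algebra_simps)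
  also have "\<dots> = (sin A * cos B + sin B * cos A) / S" unfolding yz' zp' by (simp add: add_divide_distrib)
  also have "\<dots> = 1" using S0 by (simp add: S_def sin_add mult.commute)
  finally have z: "z' \<in> model_space \<kappa>" using \<kappa> by (simp add: model_space_pos field_simps)
  have A1: "A \<le> pi" "B \<le> pi" using AB A01 kl pi3 by linarith+
  have "cmp_point \<kappa> y' p' l s z'"
    using z \<kappa> A01 A1 k0 unfolding cmp_point_def model_dist_pos[OF \<kappa>] yz' zp' k[symmetric]
    by (simp add: arccos_cos) (simp add: A_def B_def)
  then have le: "dist x (\<gamma> s) \<le> model_dist \<kappa> z' x'"
    using cmp[of s z'] s by (simp add: l_def dist_commute)
  have zx: "\<kappa> * (z' \<bullet> x') = (sin A * cos (k * dist x y) + sin B * cos (k * dist x p)) / S"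
  proof -
    have "\<kappa> * (z' \<bullet> x') = sin A / S * (\<kappa> * (y' \<bullet> x')) + sin B / S * (\<kappa> * (p' \<bullet> x'))"
      by (simp add: z'_def inner_left_distrib algebra_simps)
    then show ?thesis unfolding yx px by (simp add: add_divide_distrib)
  qed
  have "k * dist x (\<gamma> s) \<le> arccos (\<kappa> * (z' \<bullet> x'))"
    using le k0 by (simp add: model_dist_pos[OF \<kappa>] k[symmetric] field_simps)
  then have "cos (k * dist x (\<gamma> s)) \<ge> cos (arccos (\<kappa> * (z' \<bullet> x')))"
    using k0 CS[OF z m(3)] by (intro cos_monotone_0_pi_le arccos_ubound) (auto simp: abs_le_iff)
  then have "cos (k * dist x (\<gamma> s)) \<ge> \<kappa> * (z' \<bullet> x')"
    using CS[OF z m(3)] by (simp add: cos_arccos_abs)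
  then show ?thesis unfolding zx S_def AB using S0[unfolded S_def AB]
    by (simp add: field_simps A_def B_def l_def)
qed

text \<open>Stewart's theorem in the Euclidean plane, combined with the comparison inequality for
  the cevian.\<close>

lemma CAT_zero_comparison:
  fixes \<gamma> :: "real \<Rightarrow> 'a::metric_space"
  assumes cat: "CAT 0 (UNIV :: 'a set)"
    and \<gamma>: "geodesic_seg \<gamma> y p" and "y \<noteq> p"
    and s: "0 \<le> s" "s \<le> dist y p"
  shows "dist y p * (dist x (\<gamma> s))\<^sup>2 \<le>
    (dist y p - s) * (dist x y)\<^sup>2 + s * (dist x p)\<^sup>2 - s * (dist y p - s) * dist y p"
proof -
  define l where "l = dist y p"
  have l0: "l > 0" using \<open>y \<noteq> p\<close> by (simp add: l_def)
  have md: "model_dist 0 u v = dist u v" for u v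
    by (cases u; cases v) (simp add: model_dist_def dist_prod_def dist_real_def)
  have D: "D_kappa 0 = \<infinity>" by (simp add: D_kappa_def)
  have D2: "2 * D_kappa 0 = \<infinity>" unfolding D by simp
  obtain y' p' x' where m: "y' \<in> model_space 0" "p' \<in> model_space 0" "x' \<in> model_space 0"
    "dist y' p' = l" "dist p' x' = dist p x" "dist x' y' = dist x y"
    and cmp: "\<And>s z'. s \<in> {0..dist y p} \<Longrightarrow> cmp_point 0 y' p' (dist y p) s z' \<Longrightarrow> dist (\<gamma> s) x \<le> dist z' x'"
    by (rule CAT_comparison_triangle[OF cat \<gamma>, of x]) (simp_all add: D2 md l_def, simp_all add: D)
  define u where "u = s / l"
  have u: "0 \<le> u" "u \<le> 1" using s l0 by (auto simp: u_def l_def)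
  have ul: "u * l = s" using l0 by (simp add: u_def)
  define z' where "z' = (1 - u) *\<^sub>R y' + u *\<^sub>R p'"
  have "z' \<in> model_space 0" using m(1,2) by (auto simp: z'_def model_space_def)
  moreover have "dist y' z' = s"
  proof -
    have "y' - z' = u *\<^sub>R (y' - p')" by (simp add: z'_def algebra_simps)
    then show ?thesis using u m(4) ul by (simp add: dist_norm)
  qed
  moreover have "dist z' p' = l - s"
  proof -
    have "z' - p' = (1 - u) *\<^sub>R (y' - p')" by (simp add: z'_def algebra_simps)
    then have "dist z' p' = (1 - u) * l" using u m(4) by (simp add: dist_norm)
    then show ?thesis using ul by (simp add: algebra_simps)
  qed
  ultimately have "cmp_point 0 y' p' l s z'" by (simp add: cmp_point_def md)
  then have "dist x (\<gamma> s) \<le> dist z' x'" using cmp[of s z'] s by (simp add: l_def dist_commute)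
  then have "(dist x (\<gamma> s))\<^sup>2 \<le> (dist z' x')\<^sup>2" by (simp add: power_mono)
  also have "(dist z' x')\<^sup>2 = (1-u) * (dist y' x')\<^sup>2 + u * (dist p' x')\<^sup>2 - u * (1-u) * (dist y' p')\<^sup>2"
    unfolding dist_norm power2_norm_eq_inner z'_def
    by (simp add: inner_diff_left inner_diff_right inner_add_left inner_add_right inner_commute algebra_simps)
  finally have *: "(dist x (\<gamma> s))\<^sup>2 \<le> (1-u) * (dist x y)\<^sup>2 + u * (dist x p)\<^sup>2 - u * (1-u) * l\<^sup>2"
    using m by (simp add: dist_commute)
  have "l * (dist x (\<gamma> s))\<^sup>2 \<le> l * ((1-u) * (dist x y)\<^sup>2 + u * (dist x p)\<^sup>2 - u * (1-u) * l\<^sup>2)"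
    using * l0 by (intro mult_left_mono) auto
  also have "\<dots> = (l - u*l) * (dist x y)\<^sup>2 + (u*l) * (dist x p)\<^sup>2 - (u*l) * (l - u*l) * l"
    by (simp add: algebra_simps power2_eq_square)
  finally show ?thesis unfolding ul unfolding l_def .
qed

section \<open>Hyperbolic comparison in the hyperboloid model\<close>

definition mink :: "real \<times> real \<times> real \<Rightarrow> real \<times> real \<times> real \<Rightarrow> real" where
  "mink u v = fst u * fst v + fst (snd u) * fst (snd v) - snd (snd u) * snd (snd v)"

lemma mink_linear: "mink (a *\<^sub>R u + b *\<^sub>R v) w = a * mink u w + b * mink v w"
  "mink w (a *\<^sub>R u + b *\<^sub>R v) = a * mink w u + b * mink w v"
  and mink_commute: "mink u w = mink w u"
  by (simp_all add: mink_def algebra_simps)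

lemma model_space_neg: "\<kappa> < 0 \<Longrightarrow> u \<in> model_space \<kappa> \<longleftrightarrow> snd (snd u) > 0 \<and> mink u u = 1 / \<kappa>"
  by (cases u) (auto simp: model_space_def mink_def power2_eq_square)

lemma model_dist_neg: "\<kappa> < 0 \<Longrightarrow> model_dist \<kappa> u v = arcosh (\<kappa> * mink u v) / sqrt (- \<kappa>)"
  by (cases u; cases v) (simp add: model_dist_def mink_def add_ac)

text \<open>Reversed Cauchy-Schwarz inequality for vectors on the same sheet. It puts
  \<open>\<kappa> * mink u v\<close> into the range where \<open>cosh\<close> inverts
  \<open>arcosh\<close>.\<close>

lemma mink_ge_1:
  assumes "\<kappa> < 0" "u \<in> model_space \<kappa>" "v \<in> model_space \<kappa>"
  shows "\<kappa> * mink u v \<ge> 1"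
proof -
  obtain x y z x' y' z' where uv: "u = (x,y,z)" "v = (x',y',z')" by (cases u; cases v) auto
  define c where "c = - 1 / \<kappa>"
  have c: "c > 0" "c * \<kappa> = -1" using assms by (auto simp: c_def)
  have z: "z > 0" "z' > 0" "z\<^sup>2 = c + x\<^sup>2 + y\<^sup>2" "z'\<^sup>2 = c + x'\<^sup>2 + y'\<^sup>2"
    using assms by (auto simp: model_space_neg mink_def uv c_def power2_eq_square)
  \<comment> \<open>Lagrange-type identity, after \<open>z\<close> and \<open>z'\<close> have been
    eliminated by the equation of the hyperboloid.\<close>
  have "(z * z')\<^sup>2 - (c + x*x' + y*y')\<^sup>2 = c * ((x-x')\<^sup>2 + (y-y')\<^sup>2) + (x*y' - y*x')\<^sup>2"
    unfolding power_mult_distrib z by (simp add: power2_eq_square algebra_simps)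
  also have "\<dots> \<ge> 0" using c by simp
  finally have "(c + x*x' + y*y')\<^sup>2 \<le> (z * z')\<^sup>2" by simp
  then have "c + x*x' + y*y' \<le> z * z'" using z by (meson mult_nonneg_nonneg less_imp_le power2_le_imp_le)
  then have "c \<le> - mink u v" by (simp add: mink_def uv)
  then have "\<kappa> * (- mink u v) \<le> \<kappa> * c" using assms(1) by (intro mult_left_mono_neg) auto
  then show ?thesis using c by (simp add: mult.commute)
qed

text \<open>The hyperbolic form of the same interpolation: \<open>cosh (k * d)\<close> solves g'' =
  k^2 g along a geodesic. As \<open>cosh\<close> increases with distance, the inequality is
  reversed; \<open>D_kappa \<kappa>\<close> is infinite, so no smallness is assumed.\<close>

lemma CAT_neg_comparison:
  fixes \<gamma> :: "real \<Rightarrow> 'a::metric_space"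
  assumes cat: "CAT \<kappa> (UNIV :: 'a set)" and \<kappa>: "\<kappa> < 0" and k: "k = sqrt (- \<kappa>)"
    and \<gamma>: "geodesic_seg \<gamma> y p" and "y \<noteq> p"
    and s: "0 \<le> s" "s \<le> dist y p"
  shows "sinh (k * dist y p) * cosh (k * dist x (\<gamma> s)) \<le>
    sinh (k * (dist y p - s)) * cosh (k * dist x y) + sinh (k * s) * cosh (k * dist x p)"
proof -
  define l where "l = dist y p"
  have k0: "k > 0" using \<kappa> k by auto
  have l0: "l > 0" using \<open>y \<noteq> p\<close> by (simp add: l_def)
  have refl: "model_dist \<kappa> u u = 0" if "u \<in> model_space \<kappa>" for u
    using that \<kappa> by (simp add: model_space_neg model_dist_neg)
  have D: "D_kappa \<kappa> = \<infinity>" using \<kappa> by (simp add: D_kappa_def)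
  have D2: "2 * D_kappa \<kappa> = \<infinity>" unfolding D by simp
  obtain y' p' x' where m: "y' \<in> model_space \<kappa>" "p' \<in> model_space \<kappa>" "x' \<in> model_space \<kappa>"
    "model_dist \<kappa> y' p' = dist y p" "model_dist \<kappa> p' x' = dist p x" "model_dist \<kappa> x' y' = dist x y"
    and cmp: "\<And>s z'. s \<in> {0..dist y p} \<Longrightarrow> cmp_point \<kappa> y' p' (dist y p) s z' \<Longrightarrow> dist (\<gamma> s) x \<le> model_dist \<kappa> z' x'"
    by (rule CAT_comparison_triangle[OF cat \<gamma> _ _ _ refl, of x]) (simp_all add: D2, simp_all add: D)
  have cosd: "\<kappa> * mink u v = cosh (k * model_dist \<kappa> u v)" if "u \<in> model_space \<kappa>" "v \<in> model_space \<kappa>" for u v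
    using mink_ge_1[OF \<kappa> that] \<kappa> k by (simp add: model_dist_neg)
  have yp: "\<kappa> * mink y' p' = cosh (k * l)" using cosd[of y' p'] m by (simp add: l_def)
  have px: "\<kappa> * mink p' x' = cosh (k * dist x p)" using cosd[of p' x'] m by (simp add: dist_commute)
  have yx: "\<kappa> * mink y' x' = cosh (k * dist x y)" using cosd[of x' y'] m by (simp add: mink_commute)
  have yy: "\<kappa> * mink y' y' = 1" "\<kappa> * mink p' p' = 1" using m \<kappa> by (auto simp: model_space_neg)
  define A B where "A = k * (l - s)" and "B = k * s"
  have AB: "A + B = k * l" by (simp add: A_def B_def algebra_simps)
  have A01: "0 \<le> A" "0 \<le> B" using s k0 by (auto simp: A_def B_def l_def)
  define S where "S = sinh (A + B)"
  have S0: "S > 0" unfolding S_def AB using l0 k0 by simp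
  define z' where "z' = (sinh A / S) *\<^sub>R y' + (sinh B / S) *\<^sub>R p'"
  have trig: "sinh A + sinh B * cosh (A+B) = cosh B * sinh (A+B)" for A B :: real
  proof -
    have "sinh A = sinh ((A+B) - B)" by simp
    also have "\<dots> = sinh (A+B) * cosh B - cosh (A+B) * sinh B" by (rule sinh_diff)
    finally show ?thesis by simp
  qed
  have yz: "\<kappa> * mink y' z' = cosh B"
  proof -
    have "\<kappa> * mink y' z' = sinh A / S * (\<kappa> * mink y' y') + sinh B / S * (\<kappa> * mink y' p')"
      by (simp add: z'_def mink_linear algebra_simps)
    also have "\<dots> = (sinh A + sinh B * cosh (A+B)) / S" unfolding yy yp AB by (simp add: add_divide_distrib)
    finally show ?thesis using trig[of A B] S0 by (simp add: S_def)
  qed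
  have zp: "\<kappa> * mink z' p' = cosh A"
  proof -
    have "\<kappa> * mink z' p' = sinh A / S * (\<kappa> * mink y' p') + sinh B / S * (\<kappa> * mink p' p')"
      by (simp add: z'_def mink_linear algebra_simps)
    also have "\<dots> = (sinh B + sinh A * cosh (A+B)) / S" unfolding yy yp AB by (simp add: add_divide_distrib)
    finally show ?thesis using trig[of B A] S0 by (simp add: S_def add.commute)
  qed
  have "\<kappa> * mink z' z' = sinh A / S * (\<kappa> * mink y' z') + sinh B / S * (\<kappa> * mink z' p')"
    by (subst z'_def) (simp add: mink_linear mink_commute algebra_simps)
  also have "\<dots> = (sinh A * cosh B + sinh B * cosh A) / S" unfolding yz zp by (simp add: add_divide_distrib)
  also have "\<dots> = 1" using S0 by (simp add: S_def sinh_add mult.commute)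
  finally have "mink z' z' = 1 / \<kappa>" using \<kappa> by (simp add: field_simps)
  \<comment> \<open>Membership in the model also requires the upper sheet: both coefficients are
    nonnegative, and \<open>A + B = k * l > 0\<close> forces one of them to be positive.\<close>
  moreover have "snd (snd z') > 0"
  proof -
    have pos: "snd (snd y') > 0" "snd (snd p') > 0" using m \<kappa> by (auto simp: model_space_neg)
    have "A > 0 \<or> B > 0" using AB A01 l0 k0 by (smt (verit) mult_pos_pos)
    then have "sinh A / S * snd (snd y') + sinh B / S * snd (snd p') > 0"
    proof
      assume "A > 0" then show ?thesis using A01 S0 pos by (intro add_pos_nonneg) auto
    next
      assume "B > 0" then show ?thesis using A01 S0 pos by (intro add_nonneg_pos) auto
    qed
    then show ?thesis by (simp add: z'_def)
  qed
  ultimately have z: "z' \<in> model_space \<kappa>" using \<kappa> by (simp add: model_space_neg)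
  have "cmp_point \<kappa> y' p' l s z'"
    using z A01 k0 unfolding cmp_point_def model_dist_neg[OF \<kappa>] yz zp k[symmetric]
    by (simp add: arcosh_cosh_real) (simp add: A_def B_def)
  then have le: "dist x (\<gamma> s) \<le> model_dist \<kappa> z' x'"
    using cmp[of s z'] s by (simp add: l_def dist_commute)
  have zx: "\<kappa> * mink z' x' = (sinh A * cosh (k * dist x y) + sinh B * cosh (k * dist x p)) / S"
  proof -
    have "\<kappa> * mink z' x' = sinh A / S * (\<kappa> * mink y' x') + sinh B / S * (\<kappa> * mink p' x')"
      by (simp add: z'_def mink_linear algebra_simps)
    then show ?thesis unfolding yx px by (simp add: add_divide_distrib)
  qed
  have "cosh (k * dist x (\<gamma> s)) \<le> cosh (k * model_dist \<kappa> z' x')"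
    using le k0 order_trans[OF zero_le_dist le] by (subst cosh_real_nonneg_le_iff) auto
  then have "cosh (k * dist x (\<gamma> s)) \<le> \<kappa> * mink z' x'"
    using cosd[OF z m(3)] by simp
  then show ?thesis unfolding zx S_def AB using S0[unfolded S_def AB]
    by (simp add: field_simps A_def B_def l_def)
qed

section \<open>The comparison function\<close>

text \<open>In the cases \<open>\<kappa> > 0\<close>, \<open>\<kappa> = 0\<close>, \<open>\<kappa> < 0\<close> the function \<open>\<phi>\<close> below is \<open>(1 - cos (k d)) / k\<^sup>2\<close>,
  \<open>d\<^sup>2 / 2\<close>, \<open>(cosh (k d) - 1) / k\<^sup>2\<close> with \<open>k\<^sup>2 = \<bar>\<kappa>\<bar>\<close>, and \<open>\<sigma>\<close> is its derivative. For this choice the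
  first variation inequality in the last clause carries no error term, unlike for \<open>d\<^sup>2 / 2\<close> when \<open>\<kappa> > 0\<close>;
  this is what makes the estimate of one step of the scheme accurate to second order in the step size.\<close>
definition comparison_function ::
    "'a::metric_space itself \<Rightarrow> (real \<Rightarrow> real) \<Rightarrow> (real \<Rightarrow> real) \<Rightarrow> real \<Rightarrow> real \<Rightarrow> bool" where
  "comparison_function (_ :: 'a itself) \<phi> \<sigma> R B \<longleftrightarrow>
     0 < R \<and> R \<le> 1 \<and> 0 \<le> B \<and> B * R \<le> 1 / 2 \<and> \<phi> 0 = 0 \<and> (\<forall>d. isCont \<phi> d) \<and>
     (\<forall>d\<in>{0..R}. \<forall>d'\<in>{0..R}. \<phi> d + \<sigma> d * (d' - d) \<le> \<phi> d') \<and>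
     (\<forall>d\<in>{0..R}. \<bar>\<sigma> d - d\<bar> \<le> B * d\<^sup>2) \<and>
     (\<forall>x y :: 'a. dist x y \<le> R \<longrightarrow> (\<exists>\<gamma>. geodesic_seg \<gamma> x y)) \<and>
     (\<forall>(x :: 'a) y z \<gamma>. geodesic_seg \<gamma> y z \<and> dist x y \<le> R \<and> dist x z \<le> R \<and> dist y z \<le> R \<longrightarrow>
        \<phi> (dist x (\<gamma> (dist y z / 2))) \<le> (\<phi> (dist x y) + \<phi> (dist x z)) / 2 - (dist y z)\<^sup>2 / 32) \<and>
     (\<forall>(x :: 'a) y z \<gamma>. geodesic_seg \<gamma> y z \<and> dist x y \<le> R \<and> dist x z \<le> R \<and> dist y z \<le> R \<and> y \<noteq> z \<longrightarrow>
        (\<forall>e>0. eventually (\<lambda>s. \<phi> (dist x (\<gamma> s)) \<le>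
           \<phi> (dist x y) + s * ((\<phi> (dist x z) - \<phi> (dist y z)) / \<sigma> (dist y z) + e)) (at_right 0)))"

section \<open>Calculus bounds behind the three comparison functions\<close>

lemma eventually_le_of_deriv:
  fixes g :: "real \<Rightarrow> real"
  assumes g: "(g has_real_derivative m) (at 0)" and "m < M"
  shows "eventually (\<lambda>s. g s \<le> g 0 + s * M) (at_right 0)"
proof -
  have "((\<lambda>s. (g s - g 0) / (s - 0)) \<longlongrightarrow> m) (at_right 0)"
    using g unfolding has_field_derivative_iff by (rule tendsto_mono[rotated]) (simp add: at_le)
  then have "eventually (\<lambda>s. (g s - g 0) / (s - 0) < M) (at_right 0)"
    using \<open>m < M\<close> by (rule order_tendstoD)
  then show ?thesis
    by (rule eventually_mono[OF eventually_conj[OF _ eventually_at_right_less]])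
      (auto simp: field_simps)
qed

lemma convex_above_tangent_of_mono_deriv:
  fixes \<phi> \<sigma> :: "real \<Rightarrow> real"
  assumes der: "\<And>d. (\<phi> has_real_derivative \<sigma> d) (at d)"
    and mono: "\<And>d d'. 0 \<le> d \<Longrightarrow> d \<le> d' \<Longrightarrow> d' \<le> R \<Longrightarrow> \<sigma> d \<le> \<sigma> d'"
    and d: "d \<in> {0..R}" "d' \<in> {0..R}"
  shows "\<phi> d + \<sigma> d * (d' - d) \<le> \<phi> d'"
proof (cases d d' rule: linorder_cases)
  case less
  obtain z where z: "d < z" "z < d'" "\<phi> d' - \<phi> d = (d' - d) * \<sigma> z"
    using MVT2[OF less, of \<phi> \<sigma>] der by auto
  have "(d' - d) * \<sigma> d \<le> (d' - d) * \<sigma> z" using z d by (intro mult_left_mono mono) auto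
  then show ?thesis using z by (simp add: algebra_simps)
next
  case greater
  obtain z where z: "d' < z" "z < d" "\<phi> d - \<phi> d' = (d - d') * \<sigma> z"
    using MVT2[OF greater, of \<phi> \<sigma>] der by auto
  have "(d - d') * \<sigma> z \<le> (d - d') * \<sigma> d" using z d by (intro mult_left_mono mono) auto
  then show ?thesis using z by (simp add: algebra_simps)
qed simp

lemma abs_sin_diff_le: "\<bar>sin x - x\<bar> \<le> x\<^sup>2 / 2" for x :: real
  using Maclaurin_sin_bound[of x 2] by (simp add: sin_coeff_def numeral_2_eq_2)

text \<open>The coefficient 1/4 is not optimal, but it is what yields the gain 1/32 in the midpoint
  clause.\<close>

lemma cos_le_quadratic:
  fixes x :: real assumes "0 \<le> x" "x \<le> 1" shows "cos x \<le> 1 - x\<^sup>2 / 4"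
proof -
  have "x * (x / 8) \<le> x * (1/8)" using assms by (intro mult_left_mono) auto
  then have "sin (x/2) \<ge> 3/8 * x"
    using abs_sin_diff_le[of "x/2"] by (simp add: power2_eq_square field_simps) (smt (verit))
  then have "(sin (x/2))\<^sup>2 \<ge> (3/8 * x)\<^sup>2" using assms by (intro power_mono) auto
  then have "2 * (sin (x/2))\<^sup>2 \<ge> 9/32 * x\<^sup>2" by (simp add: power2_eq_square)
  moreover have "cos x = 1 - 2 * (sin (x/2))\<^sup>2" using cos_double_sin[of "x/2"] by simp
  moreover have "x\<^sup>2 \<ge> 0" by simp
  ultimately show ?thesis by linarith
qed

lemma cos_ge_half:
  fixes x :: real assumes "0 \<le> x" "x \<le> 1" shows "cos x \<ge> 1 / 2"
proof -
  have "sin (x/2) \<le> x/2" using sin_x_le_x[of "x/2"] assms by simp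
  moreover have "0 \<le> sin (x/2)" using assms pi_gt3 by (intro sin_ge_zero) auto
  ultimately have "(sin (x/2))\<^sup>2 \<le> (x/2)\<^sup>2" by (intro power_mono) auto
  also have "(x/2)\<^sup>2 \<le> (1/2)\<^sup>2" using assms by (intro power_mono) auto
  finally show ?thesis using cos_double_sin[of "x/2"] by (simp add: power2_eq_square)
qed

lemma sinh_ge_self:
  fixes x :: real assumes "x \<ge> 0" shows "sinh x \<ge> x"
proof -
  have "\<exists>m. ((\<lambda>y. sinh y - y) has_real_derivative m) (at x) \<and> m \<ge> 0" for x :: real
    using cosh_real_ge_1[of x] by (intro exI[of _ "cosh x - 1"]) (auto intro!: derivative_eq_intros)
  from DERIV_nonneg_imp_nondecreasing[OF assms this] show ?thesis by simp
qed

lemma cosh_ge_quadratic: "cosh x \<ge> 1 + x\<^sup>2 / 2" for x :: real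
proof -
  have "(x/2)\<^sup>2 \<le> (sinh (x/2))\<^sup>2"
  proof (cases "x \<ge> 0")
    case True
    then show ?thesis using sinh_ge_self[of "x/2"] by (intro power_mono) auto
  next
    case False
    then have "(- x/2)\<^sup>2 \<le> (sinh (- x/2))\<^sup>2" using sinh_ge_self[of "- x/2"] by (intro power_mono) auto
    then show ?thesis by (simp del: power_divide)
  qed
  then have "(sinh (x/2))\<^sup>2 \<ge> x\<^sup>2 / 4" by (simp add: power_divide)
  moreover have "cosh x = 1 + 2 * (sinh (x/2))\<^sup>2"
    using cosh_double[of "x/2"] by (simp add: cosh_square_eq)
  ultimately show ?thesis by simp
qed

lemma comparison_function_pos:
  assumes cat: "CAT \<kappa> (UNIV :: 'a::metric_space set)" and "\<kappa> > 0" and k: "k = sqrt \<kappa>"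
  shows "comparison_function TYPE('a) (\<lambda>d. (1 - cos (k * d)) / k\<^sup>2) (\<lambda>d. sin (k * d) / k) (1 / (1 + k)\<^sup>2) (k / 2)"
proof -
  have k0: "k > 0" using assms by simp
  \<comment> \<open>One radius serves both requirements: (1 + k)^2 is at least 1 and at least k, so
    \<open>R \<le> 1\<close> and \<open>k * R \<le> 1\<close>; the latter also gives
    \<open>B * R \<le> 1 / 2\<close>.\<close>
  define R where "R = 1 / (1 + k)\<^sup>2"
  have R0: "R > 0" using k0 by (simp add: R_def)
  have "(1 + k)\<^sup>2 = 1 + 2 * k + k\<^sup>2" by (simp add: power2_sum)
  then have sq: "(1 + k)\<^sup>2 \<ge> 1" "(1 + k)\<^sup>2 \<ge> k" using k0 by auto
  have R1: "R \<le> 1" and kR: "k * R \<le> 1" using sq k0 by (auto simp: R_def field_simps)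
  have small: "k * d \<le> 1" if "d \<le> R" for d
    using mult_left_mono[OF that, of k] k0 kR by linarith
  have le_D: "d < pi / k" if "d \<le> R" for d
    using small[OF that] k0 pi_gt3 by (simp add: field_simps)
  have P2: "(1 - cos (k * d)) / k\<^sup>2 + sin (k * d) / k * (d' - d) \<le> (1 - cos (k * d')) / k\<^sup>2"
    if "d \<in> {0..R}" "d' \<in> {0..R}" for d d'
  proof (rule convex_above_tangent_of_mono_deriv[OF _ _ that])
    show "((\<lambda>a. (1 - cos (k * a)) / k\<^sup>2) has_real_derivative sin (k * d) / k) (at d)" for d
      using k0 by (auto intro!: derivative_eq_intros simp: power2_eq_square)
    show "sin (k * d) / k \<le> sin (k * d') / k" if "0 \<le> d" "d \<le> d'" "d' \<le> R" for d d'
    proof -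
      have "k * d' \<le> pi / 2" using small[of d'] that pi_gt3 by linarith
      moreover have "k * d \<le> k * d'" "0 \<le> k * d" using that k0 by auto
      ultimately have "sin (k * d) \<le> sin (k * d')" using pi_gt3 by (intro sin_monotone_2pi_le) linarith+
      then show ?thesis using k0 by (simp add: divide_right_mono)
    qed
  qed
  have P3: "\<bar>sin (k * d) / k - d\<bar> \<le> k / 2 * d\<^sup>2" for d
  proof -
    have "\<bar>sin (k * d) / k - d\<bar> = \<bar>sin (k * d) - k * d\<bar> / k"
      using k0 by (simp add: field_simps abs_if)
    also have "\<dots> \<le> (k * d)\<^sup>2 / 2 / k" using k0 abs_sin_diff_le[of "k*d"] by (intro divide_right_mono) auto
    finally show ?thesis using k0 by (simp add: power2_eq_square mult_ac)
  qed
  have geo: "\<exists>\<gamma>. geodesic_seg \<gamma> x y" if "dist x y \<le> R" for x y :: 'a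
    using cat[unfolded CAT_def, THEN conjunct1] le_D[OF that] \<open>\<kappa> > 0\<close> k by (simp add: D_kappa_def)
  have raw: "sin (k * dist y z) * cos (k * dist x (\<gamma> s)) \<ge>
      sin (k * (dist y z - s)) * cos (k * dist x y) + sin (k * s) * cos (k * dist x z)"
    if "geodesic_seg \<gamma> y z" "dist x y \<le> R" "dist x z \<le> R" "dist y z \<le> R" "y \<noteq> z" "0 \<le> s" "s \<le> dist y z"
    for x y z :: 'a and \<gamma> s
    using that small by (intro CAT_pos_comparison[OF cat \<open>\<kappa> > 0\<close> k]) (auto simp: dist_commute)
  \<comment> \<open>Divided by \<open>sin (k * l / 2)\<close>, the comparison at the midpoint is
    multiplicative: \<open>S \<le> cos (k * l / 2) * X\<close>. It becomes an additive gain
    \<open>(k * l)\<^sup>2 / 32\<close> once \<open>X \<ge> 1/2\<close>, which follows from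
    \<open>S \<ge> 1/2\<close>, valid for distances up to \<open>R\<close>.\<close>
  have C1: "(1 - cos (k * dist x (\<gamma> (dist y z / 2)))) / k\<^sup>2
       \<le> ((1 - cos (k * dist x y)) / k\<^sup>2 + (1 - cos (k * dist x z)) / k\<^sup>2) / 2 - (dist y z)\<^sup>2 / 32"
    if h: "geodesic_seg \<gamma> y z" "dist x y \<le> R" "dist x z \<le> R" "dist y z \<le> R" for x y z :: 'a and \<gamma>
  proof (cases "y = z")
    case True
    then show ?thesis using h k0 by (simp add: geodesic_seg_def field_simps)
  next
    case False
    define l where "l = dist y z"
    define X where "X = cos (k * dist x (\<gamma> (l / 2)))"
    define S where "S = (cos (k * dist x y) + cos (k * dist x z)) / 2"
    have l: "0 < l" "k * l \<le> 1" using False h small by (auto simp: l_def)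
    have kl: "0 < k * l" using l k0 by simp
    have s0: "sin (k * l / 2) > 0" using l k0 pi_gt3 by (intro sin_gt_zero) auto
    have "sin (k * (l / 2)) * (2 * S) \<le> sin (k * l) * X"
      using raw[OF h False, of "l/2"] l by (simp add: X_def S_def l_def algebra_simps)
    also have "sin (k * l) = 2 * sin (k * (l/2)) * cos (k * (l/2))" using sin_double[of "k * (l/2)"] by simp
    finally have "sin (k * l / 2) * S \<le> sin (k * l / 2) * (cos (k * l / 2) * X)" by (simp add: mult_ac)
    then have SX: "S \<le> cos (k * l / 2) * X" using s0 by (simp add: mult_le_cancel_left)
    have "cos (k * dist x y) \<ge> 1/2" "cos (k * dist x z) \<ge> 1/2"
      using h(2,3) small k0 cos_ge_half[of "k * dist x y"] cos_ge_half[of "k * dist x z"] by auto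
    then have S: "S \<ge> 1/2" by (simp add: S_def)
    have c: "cos (k * l / 2) \<le> 1 - (k * l / 2)\<^sup>2 / 4" "cos (k*l/2) \<ge> 1/2"
      using l kl by (intro cos_le_quadratic cos_ge_half; simp)+
    have "X > 0"
    proof (rule ccontr)
      assume "\<not> X > 0"
      then have "cos (k * l / 2) * X \<le> 0" using c by (intro mult_nonneg_nonpos) auto
      then show False using SX S by simp
    qed
    have "cos (k * l / 2) * X \<le> (1 - (k * l / 2)\<^sup>2 / 4) * X" using c \<open>X > 0\<close> by (intro mult_right_mono) auto
    then have SX': "S \<le> X - X * ((k * l)\<^sup>2 / 16)" using SX by (simp add: algebra_simps power2_eq_square)
    moreover have "X * ((k * l)\<^sup>2 / 16) \<ge> 0" using \<open>X > 0\<close> by simp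
    ultimately have "X \<ge> 1/2" using S by linarith
    then have "X * ((k * l)\<^sup>2 / 16) \<ge> 1/2 * ((k * l)\<^sup>2 / 16)" by (intro mult_right_mono) auto
    then have "S + (k * l)\<^sup>2 / 32 \<le> X" using SX' by linarith
    then have "1 - X \<le> 1 - S - (k*l)\<^sup>2 / 32" by simp
    then have "(1 - X) / k\<^sup>2 \<le> (1 - S - (k*l)\<^sup>2 / 32) / k\<^sup>2" using k0 by (intro divide_right_mono) auto
    also have "\<dots> = (1 - S) / k\<^sup>2 - l\<^sup>2 / 32" using k0 by (simp add: field_simps power2_eq_square)
    also have "(1 - S) / k\<^sup>2 = ((1 - cos (k * dist x y)) / k\<^sup>2 + (1 - cos (k * dist x z)) / k\<^sup>2) / 2"
      using k0 by (simp add: S_def field_simps)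
    finally show ?thesis by (simp add: X_def l_def)
  qed
  have C2: "eventually (\<lambda>s. (1 - cos (k * dist x (\<gamma> s))) / k\<^sup>2 \<le> (1 - cos (k * dist x y)) / k\<^sup>2 +
        s * (((1 - cos (k * dist x z)) / k\<^sup>2 - (1 - cos (k * dist y z)) / k\<^sup>2) / (sin (k * dist y z) / k) + e)) (at_right 0)"
    if h: "geodesic_seg \<gamma> y z" "dist x y \<le> R" "dist x z \<le> R" "dist y z \<le> R" "y \<noteq> z" and "e > 0"
    for x y z :: 'a and \<gamma> e
  proof -
    define l where "l = dist y z"
    have l: "0 < l" "k * l \<le> 1" using h small by (auto simp: l_def)
    define S where "S = sin (k * l)"
    have S0: "S > 0" unfolding S_def using l k0 pi_gt3 by (intro sin_gt_zero) auto
    define g where "g s = (1 - (sin (k * (l - s)) * cos (k * dist x y) + sin (k * s) * cos (k * dist x z)) / S) / k\<^sup>2" for s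
    define m where "m = (cos (k * l) * cos (k * dist x y) - cos (k * dist x z)) / (S * k)"
    have der: "(g has_real_derivative m) (at 0)"
      unfolding g_def m_def using k0 S0
      by (auto intro!: derivative_eq_intros simp: field_simps power2_eq_square)
    \<comment> \<open>Discarding the factor \<open>cos (k * dist x y) \<le> 1\<close>, allowed since
      \<open>cos (k * l) \<ge> 0\<close>, leaves a difference of cosines. This is k^2 times a
      difference of values of the comparison function, so no error term arises.\<close>
    have m_le: "m \<le> ((1 - cos (k * dist x z)) / k\<^sup>2 - (1 - cos (k * l)) / k\<^sup>2) / (S / k)"
    proof -
      have "cos (k * l) * cos (k * dist x y) \<le> cos (k * l) * 1"
        using cos_ge_half[of "k * l"] l k0 by (intro mult_left_mono) auto
      then have "m \<le> (cos (k * l) - cos (k * dist x z)) / (S * k)"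
        unfolding m_def using S0 k0 by (intro divide_right_mono) auto
      also have "\<dots> = ((1 - cos (k * dist x z)) / k\<^sup>2 - (1 - cos (k * l)) / k\<^sup>2) / (S / k)"
        using S0 k0 by (simp add: field_simps power2_eq_square)
      finally show ?thesis .
    qed
    have g0: "g 0 = (1 - cos (k * dist x y)) / k\<^sup>2" using S0 by (simp add: g_def S_def)
    have "eventually (\<lambda>s. g s \<le> g 0 + s * (((1 - cos (k * dist x z)) / k\<^sup>2 - (1 - cos (k * l)) / k\<^sup>2) / (S / k) + e)) (at_right 0)"
      using m_le \<open>e > 0\<close> by (intro eventually_le_of_deriv[OF der]) auto
    moreover have "eventually (\<lambda>s. s \<in> {0<..<l}) (at_right 0)"
      using l by (intro eventually_at_right_real) auto
    ultimately show ?thesis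
    proof eventually_elim
      case (elim s)
      have "sin (k * (l - s)) * cos (k * dist x y) + sin (k * s) * cos (k * dist x z) \<le> S * cos (k * dist x (\<gamma> s))"
        using raw[OF h, of s] elim by (simp add: S_def l_def)
      then have "(sin (k * (l - s)) * cos (k * dist x y) + sin (k * s) * cos (k * dist x z)) / S \<le> cos (k * dist x (\<gamma> s))"
        using S0 by (simp add: field_simps)
      then have "(1 - cos (k * dist x (\<gamma> s))) / k\<^sup>2 \<le> g s"
        unfolding g_def by (intro divide_right_mono) auto
      then show ?case using elim by (simp add: g0 S_def l_def)
    qed
  qed
  have BR: "k / 2 * R \<le> 1/2" using kR by simp
  have cont: "\<forall>d. isCont (\<lambda>d. (1 - cos (k * d)) / k\<^sup>2) d" using k0 by (auto intro!: continuous_intros)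
  show ?thesis unfolding comparison_function_def R_def[symmetric]
    using R0 R1 BR k0 cont P2 P3 geo C1 C2 by (intro conjI) (simp_all del: times_divide_eq_right)
qed

text \<open>The derivative is exactly \<open>d\<close>, hence \<open>B = 0\<close>, and the radius
  is limited only by \<open>R \<le> 1\<close>. The midpoint gain is really l^2/8, weakened to the
  common constant 1/32.\<close>

lemma comparison_function_zero:
  assumes cat: "CAT 0 (UNIV :: 'a::metric_space set)"
  shows "comparison_function TYPE('a) (\<lambda>d. d\<^sup>2 / 2) (\<lambda>d. d) 1 0"
proof -
  have P2: "d\<^sup>2 / 2 + d * (d' - d) \<le> d'\<^sup>2 / 2" for d d' :: real
    using zero_le_power2[of "d' - d"] by (simp add: power2_eq_square algebra_simps)
  have geo: "\<exists>\<gamma>. geodesic_seg \<gamma> x y" for x y :: 'a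
    using cat[unfolded CAT_def, THEN conjunct1] by (simp add: D_kappa_def)
  note raw = CAT_zero_comparison[OF cat]
  have C1: "(dist x (\<gamma> (dist y z / 2)))\<^sup>2 / 2 \<le> ((dist x y)\<^sup>2 / 2 + (dist x z)\<^sup>2 / 2) / 2 - (dist y z)\<^sup>2 / 32"
    if h: "geodesic_seg \<gamma> y z" for x y z :: 'a and \<gamma>
  proof (cases "y = z")
    case True
    then show ?thesis using h by (simp add: geodesic_seg_def)
  next
    case False
    define l where "l = dist y z"
    have l: "l > 0" using False by (simp add: l_def)
    have "l * (dist x (\<gamma> (l/2)))\<^sup>2 \<le> (l - l/2) * (dist x y)\<^sup>2 + l/2 * (dist x z)\<^sup>2 - l/2 * (l - l/2) * l"
      using raw[OF h False, of "l/2" x] l by (simp add: l_def)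
    also have "\<dots> = l * ((dist x y)\<^sup>2 / 2 + (dist x z)\<^sup>2 / 2 - l\<^sup>2 / 4)"
      by (simp add: field_simps power2_eq_square)
    finally have "(dist x (\<gamma> (l/2)))\<^sup>2 \<le> (dist x y)\<^sup>2 / 2 + (dist x z)\<^sup>2 / 2 - l\<^sup>2 / 4"
      using l by (simp add: mult_le_cancel_left)
    then have "(dist x (\<gamma> (l/2)))\<^sup>2 / 2 \<le> ((dist x y)\<^sup>2 / 2 + (dist x z)\<^sup>2 / 2 - l\<^sup>2 / 4) / 2"
      by (rule divide_right_mono) simp
    also have "\<dots> \<le> ((dist x y)\<^sup>2 / 2 + (dist x z)\<^sup>2 / 2) / 2 - l\<^sup>2 / 32"
      by (simp add: diff_divide_distrib)
    finally have "(dist x (\<gamma> (l/2)))\<^sup>2 / 2 \<le> ((dist x y)\<^sup>2 / 2 + (dist x z)\<^sup>2 / 2) / 2 - l\<^sup>2 / 32" .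
    then show ?thesis by (simp add: l_def)
  qed
  have C2: "eventually (\<lambda>s. (dist x (\<gamma> s))\<^sup>2 / 2 \<le> (dist x y)\<^sup>2 / 2 +
        s * (((dist x z)\<^sup>2 / 2 - (dist y z)\<^sup>2 / 2) / dist y z + e)) (at_right 0)"
    if h: "geodesic_seg \<gamma> y z" "y \<noteq> z" and "e > 0" for x y z :: 'a and \<gamma> e
  proof -
    define l where "l = dist y z"
    have l: "0 < l" using h by (auto simp: l_def)
    define g where "g s = ((l - s) * (dist x y)\<^sup>2 + s * (dist x z)\<^sup>2 - s * (l - s) * l) / (2 * l)" for s
    define m where "m = ((dist x z)\<^sup>2 - (dist x y)\<^sup>2 - l\<^sup>2) / (2 * l)"
    have der: "(g has_real_derivative m) (at 0)"
      unfolding g_def m_def using l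
      by (auto intro!: derivative_eq_intros simp: field_simps power2_eq_square)
    have m_le: "m \<le> ((dist x z)\<^sup>2 / 2 - l\<^sup>2 / 2) / l"
      using l by (simp add: m_def field_simps)
    have g0: "g 0 = (dist x y)\<^sup>2 / 2" using l by (simp add: g_def)
    have "eventually (\<lambda>s. g s \<le> g 0 + s * (((dist x z)\<^sup>2 / 2 - l\<^sup>2 / 2) / l + e)) (at_right 0)"
      using m_le \<open>e > 0\<close> by (intro eventually_le_of_deriv[OF der]) auto
    moreover have "eventually (\<lambda>s. s \<in> {0<..<l}) (at_right 0)"
      using l by (intro eventually_at_right_real) auto
    ultimately show ?thesis
    proof eventually_elim
      case (elim s)
      have "l * (dist x (\<gamma> s))\<^sup>2 \<le> (l - s) * (dist x y)\<^sup>2 + s * (dist x z)\<^sup>2 - s * (l - s) * l"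
        using raw[OF h, of s] elim by (simp add: l_def)
      then have "(dist x (\<gamma> s))\<^sup>2 / 2 \<le> g s"
        unfolding g_def using l by (simp add: field_simps)
      then show ?case using elim by (simp add: g0 l_def)
    qed
  qed
  show ?thesis unfolding comparison_function_def
    using P2 geo C1 C2 by (intro conjI) (simp_all del: times_divide_eq_right)
qed

text \<open>Geodesics and comparison are available at every scale here; the bound
  \<open>k * d \<le> 1\<close> serves only the estimates involving \<open>B\<close>.\<close>

lemma comparison_function_neg:
  assumes cat: "CAT \<kappa> (UNIV :: 'a::metric_space set)" and "\<kappa> < 0" and k: "k = sqrt (- \<kappa>)"
  shows "comparison_function TYPE('a) (\<lambda>d. (cosh (k * d) - 1) / k\<^sup>2) (\<lambda>d. sinh (k * d) / k) (1 / (1 + k)\<^sup>2) (k / 2)"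
proof -
  have k0: "k > 0" using assms by simp
  define R where "R = 1 / (1 + k)\<^sup>2"
  have R0: "R > 0" using k0 by (simp add: R_def)
  have "(1 + k)\<^sup>2 = 1 + 2 * k + k\<^sup>2" by (simp add: power2_sum)
  then have sq: "(1 + k)\<^sup>2 \<ge> 1" "(1 + k)\<^sup>2 \<ge> k" using k0 by auto
  have R1: "R \<le> 1" and kR: "k * R \<le> 1" using sq k0 by (auto simp: R_def field_simps)
  have small: "k * d \<le> 1" if "d \<le> R" for d
    using mult_left_mono[OF that, of k] k0 kR by linarith
  have P2: "(cosh (k * d) - 1) / k\<^sup>2 + sinh (k * d) / k * (d' - d) \<le> (cosh (k * d') - 1) / k\<^sup>2"
    if "d \<in> {0..R}" "d' \<in> {0..R}" for d d'
  proof (rule convex_above_tangent_of_mono_deriv[OF _ _ that])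
    show "((\<lambda>a. (cosh (k * a) - 1) / k\<^sup>2) has_real_derivative sinh (k * d) / k) (at d)" for d
      using k0 by (auto intro!: derivative_eq_intros simp: power2_eq_square)
    show "sinh (k * d) / k \<le> sinh (k * d') / k" if "0 \<le> d" "d \<le> d'" "d' \<le> R" for d d'
      using that k0 by (simp add: divide_right_mono)
  qed
  have P3: "\<bar>sinh (k * d) / k - d\<bar> \<le> k / 2 * d\<^sup>2" if "d \<in> {0..R}" for d
  proof -
    define x where "x = k * d"
    have x: "0 \<le> x" "x \<le> 1" using that small k0 by (auto simp: x_def)
    have "exp x \<le> 1 + x + x\<^sup>2" "exp (-x) \<ge> 1 - x" using exp_bound[OF x] exp_ge_add_one_self[of "-x"] by auto
    then have "sinh x - x \<le> x\<^sup>2 / 2" by (simp add: sinh_field_def field_simps)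
    moreover have "sinh x \<ge> x" using sinh_ge_self[OF x(1)] .
    ultimately have "\<bar>sinh x - x\<bar> \<le> x\<^sup>2 / 2" by simp
    then have "\<bar>sinh x - x\<bar> / k \<le> x\<^sup>2 / 2 / k" using k0 by (intro divide_right_mono) auto
    moreover have "\<bar>sinh (k * d) / k - d\<bar> = \<bar>sinh x - x\<bar> / k"
      using k0 by (simp add: field_simps abs_if x_def)
    ultimately show ?thesis using k0 by (simp add: power2_eq_square x_def mult_ac)
  qed
  have geo: "\<exists>\<gamma>. geodesic_seg \<gamma> x y" for x y :: 'a
    using cat[unfolded CAT_def, THEN conjunct1] \<open>\<kappa> < 0\<close> by (simp add: D_kappa_def)
  note raw = CAT_neg_comparison[OF cat \<open>\<kappa> < 0\<close> k]
  have C1: "(cosh (k * dist x (\<gamma> (dist y z / 2))) - 1) / k\<^sup>2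
       \<le> ((cosh (k * dist x y) - 1) / k\<^sup>2 + (cosh (k * dist x z) - 1) / k\<^sup>2) / 2 - (dist y z)\<^sup>2 / 32"
    if h: "geodesic_seg \<gamma> y z" for x y z :: 'a and \<gamma>
  proof (cases "y = z")
    case True
    then show ?thesis using h k0 by (simp add: geodesic_seg_def field_simps)
  next
    case False
    define l where "l = dist y z"
    define X where "X = cosh (k * dist x (\<gamma> (l / 2)))"
    define S where "S = (cosh (k * dist x y) + cosh (k * dist x z)) / 2"
    have l: "0 < l" using False by (auto simp: l_def)
    have s0: "sinh (k * l / 2) > 0" using l k0 by simp
    have "sinh (k * l) * X \<le> sinh (k * (l / 2)) * (2 * S)"
      using raw[OF h False, of "l/2" x] l by (simp add: X_def S_def l_def algebra_simps)
    also have "sinh (k * l) = 2 * sinh (k * (l/2)) * cosh (k * (l/2))" using sinh_double[of "k * (l/2)"] by simp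
    finally have "sinh (k * l / 2) * (cosh (k * l / 2) * X) \<le> sinh (k * l / 2) * S" by (simp add: mult_ac)
    then have SX: "cosh (k * l / 2) * X \<le> S" using s0 by (simp add: mult_le_cancel_left)
    \<comment> \<open>Unlike in the spherical case, the lower bound that turns the multiplicative
      gain into an additive one is automatic.\<close>
    have X1: "X \<ge> 1" by (simp add: X_def cosh_real_ge_1)
    have "(1 + (k * l / 2)\<^sup>2 / 2) * X \<le> cosh (k * l / 2) * X"
      using X1 by (intro mult_right_mono cosh_ge_quadratic) auto
    then have "X + X * ((k * l)\<^sup>2 / 8) \<le> S" using SX by (simp add: algebra_simps power2_eq_square)
    moreover have "X * ((k * l)\<^sup>2 / 8) \<ge> 1 * ((k * l)\<^sup>2 / 8)" using X1 by (intro mult_right_mono) auto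
    moreover have "(k * l)\<^sup>2 \<ge> 0" by simp
    ultimately have "X - 1 \<le> S - 1 - (k*l)\<^sup>2 / 32" by linarith
    then have "(X - 1) / k\<^sup>2 \<le> (S - 1 - (k*l)\<^sup>2 / 32) / k\<^sup>2" using k0 by (intro divide_right_mono) auto
    also have "\<dots> = (S - 1) / k\<^sup>2 - l\<^sup>2 / 32" using k0 by (simp add: field_simps power2_eq_square)
    also have "(S - 1) / k\<^sup>2 = ((cosh (k * dist x y) - 1) / k\<^sup>2 + (cosh (k * dist x z) - 1) / k\<^sup>2) / 2"
      using k0 by (simp add: S_def field_simps)
    finally show ?thesis by (simp add: X_def l_def)
  qed
  have C2: "eventually (\<lambda>s. (cosh (k * dist x (\<gamma> s)) - 1) / k\<^sup>2 \<le> (cosh (k * dist x y) - 1) / k\<^sup>2 +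
        s * (((cosh (k * dist x z) - 1) / k\<^sup>2 - (cosh (k * dist y z) - 1) / k\<^sup>2) / (sinh (k * dist y z) / k) + e)) (at_right 0)"
    if h: "geodesic_seg \<gamma> y z" "y \<noteq> z" and "e > 0" for x y z :: 'a and \<gamma> e
  proof -
    define l where "l = dist y z"
    have l: "0 < l" using h by (auto simp: l_def)
    define S where "S = sinh (k * l)"
    have S0: "S > 0" unfolding S_def using l k0 by simp
    define g where "g s = ((sinh (k * (l - s)) * cosh (k * dist x y) + sinh (k * s) * cosh (k * dist x z)) / S - 1) / k\<^sup>2" for s
    define m where "m = (cosh (k * dist x z) - cosh (k * l) * cosh (k * dist x y)) / (S * k)"
    have kl: "k \<noteq> 0" "l \<noteq> 0" "k * l > 0" using k0 l by auto
    have der: "(g has_real_derivative m) (at 0)"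
      unfolding g_def m_def using k0 S0
      by (auto intro!: derivative_eq_intros simp: field_simps power2_eq_square)
    have m_le: "m \<le> ((cosh (k * dist x z) - 1) / k\<^sup>2 - (cosh (k * l) - 1) / k\<^sup>2) / (S / k)"
    proof -
      have "cosh (k * l) * cosh (k * dist x y) \<ge> cosh (k * l) * 1"
        by (intro mult_left_mono cosh_real_ge_1) auto
      then have "m \<le> (cosh (k * dist x z) - cosh (k * l)) / (S * k)"
        unfolding m_def using S0 k0 by (intro divide_right_mono) auto
      also have "\<dots> = ((cosh (k * dist x z) - 1) / k\<^sup>2 - (cosh (k * l) - 1) / k\<^sup>2) / (S / k)"
        using S0 k0 by (simp add: field_simps power2_eq_square)
      finally show ?thesis .
    qed
    have g0: "g 0 = (cosh (k * dist x y) - 1) / k\<^sup>2" using kl by (simp add: g_def S_def)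
    have "eventually (\<lambda>s. g s \<le> g 0 + s * (((cosh (k * dist x z) - 1) / k\<^sup>2 - (cosh (k * l) - 1) / k\<^sup>2) / (S / k) + e)) (at_right 0)"
      using m_le \<open>e > 0\<close> by (intro eventually_le_of_deriv[OF der]) auto
    moreover have "eventually (\<lambda>s. s \<in> {0<..<l}) (at_right 0)"
      using l by (intro eventually_at_right_real) auto
    ultimately show ?thesis
    proof eventually_elim
      case (elim s)
      have "S * cosh (k * dist x (\<gamma> s)) \<le> sinh (k * (l - s)) * cosh (k * dist x y) + sinh (k * s) * cosh (k * dist x z)"
        using raw[OF h, of s] elim by (simp add: S_def l_def)
      then have "cosh (k * dist x (\<gamma> s)) \<le> (sinh (k * (l - s)) * cosh (k * dist x y) + sinh (k * s) * cosh (k * dist x z)) / S"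
        using S0 by (simp add: field_simps)
      then have "(cosh (k * dist x (\<gamma> s)) - 1) / k\<^sup>2 \<le> g s"
        unfolding g_def by (intro divide_right_mono) auto
      then show ?case using elim by (simp add: g0 S_def l_def)
    qed
  qed
  have BR: "k / 2 * R \<le> 1/2" using kR by simp
  have cont: "\<forall>d. isCont (\<lambda>d. (cosh (k * d) - 1) / k\<^sup>2) d" using k0 by (auto intro!: continuous_intros)
  show ?thesis unfolding comparison_function_def R_def[symmetric]
    using R0 R1 BR k0 cont P2 P3 geo C1 C2 by (intro conjI) (simp_all del: times_divide_eq_right)
qed

lemma CAT_imp_comparison_function:
  assumes "CAT \<kappa> (UNIV :: 'a::metric_space set)"
  shows "\<exists>\<phi> \<sigma> R B. comparison_function TYPE('a) \<phi> \<sigma> R B"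
proof (cases \<kappa> "0 :: real" rule: linorder_cases)
  case less
  then show ?thesis using comparison_function_neg[OF assms _ refl] by blast
next
  case equal
  then show ?thesis using comparison_function_zero assms by blast
next
  case greater
  then show ?thesis using comparison_function_pos[OF assms _ refl] by blast
qed

section \<open>The proximal step\<close>

text \<open>Strong concavity replaces compactness: near-maximal points are close to each other, so a
  maximising sequence is Cauchy. The inequality with \<open>k\<close> is what remains of concavity
  after the value at a midpoint has been bounded by \<open>S\<close>; the midpoint itself need not
  lie in \<open>Z\<close>.\<close>

lemma exists_maximizer_of_midpoint:
  fixes F :: "'a::complete_space \<Rightarrow> real"
  assumes Z: "closed Z" and cont: "continuous_on Z F"
    and le: "\<And>z. z \<in> Z \<Longrightarrow> F z \<le> S"
    and sup: "\<And>e. e > 0 \<Longrightarrow> \<exists>z\<in>Z. S - e < F z"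
    and k: "k > 0" "\<And>z1 z2. z1 \<in> Z \<Longrightarrow> z2 \<in> Z \<Longrightarrow> k * (dist z1 z2)\<^sup>2 \<le> 2 * S - F z1 - F z2"
  shows "\<exists>y\<in>Z. F y = S"
proof -
  have "\<forall>n. \<exists>z\<in>Z. S - inverse (real (Suc n)) < F z" by (auto intro!: sup)
  then obtain z where z: "\<And>n. z n \<in> Z" "\<And>n. S - inverse (real (Suc n)) < F (z n)" by metis
  have "Cauchy z"
  proof (rule metric_CauchyI)
    fix e :: real assume "e > 0"
    then have "k * e\<^sup>2 / 2 > 0" using k by simp
    then obtain N where N: "inverse (real (Suc N)) < k * e\<^sup>2 / 2" using reals_Archimedean by blast
    show "\<exists>M. \<forall>m\<ge>M. \<forall>n\<ge>M. dist (z m) (z n) < e"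
    proof (intro exI allI impI)
      fix m n assume mn: "m \<ge> N" "n \<ge> N"
      then have "inverse (real (Suc m)) \<le> inverse (real (Suc N))" "inverse (real (Suc n)) \<le> inverse (real (Suc N))"
        by (auto intro!: le_imp_inverse_le)
      then have "k * (dist (z m) (z n))\<^sup>2 < k * e\<^sup>2"
        using k(2)[OF z(1) z(1), of m n] z(2)[of m] z(2)[of n] N by linarith
      then have "(dist (z m) (z n))\<^sup>2 < e\<^sup>2" using k by simp
      then show "dist (z m) (z n) < e" using \<open>e > 0\<close> by (simp add: power_less_imp_less_base)
    qed
  qed
  then obtain y where y: "z \<longlonglongrightarrow> y" using Cauchy_convergent convergent_def by blast
  have yZ: "y \<in> Z" using closed_sequentially[OF Z _ y] z by blast
  have "(\<lambda>n. F (z n)) \<longlonglongrightarrow> F y"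
    using continuous_on_tendsto_compose[OF cont y yZ] z by simp
  moreover have "(\<lambda>n. F (z n)) \<longlonglongrightarrow> S"
  proof (rule tendsto_sandwich)
    show "(\<lambda>n. S - inverse (real (Suc n))) \<longlonglongrightarrow> S"
      using tendsto_diff[OF tendsto_const LIMSEQ_inverse_real_of_nat, of S] by simp
    show "\<forall>\<^sub>F n in sequentially. S - inverse (real (Suc n)) \<le> F (z n)" by (intro always_eventually allI less_imp_le z(2))
    show "\<forall>\<^sub>F n in sequentially. F (z n) \<le> S" using z(1) le by simp
  qed auto
  ultimately show ?thesis using yZ LIMSEQ_unique by blast
qed

text \<open>The condition \<open>2 * r \<le> R\<close> puts any two points of the ball within the
  range of comparison. Concavity is multiplied by the length of the geodesic to avoid division; the
  endpoints are in the ball, while the geodesic itself may leave it.\<close>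

locale local_flow =
  fixes \<phi> \<sigma> :: "real \<Rightarrow> real" and R B :: real
    and f :: "real \<Rightarrow> 'a::complete_space \<Rightarrow> real" and p0 :: 'a and a r \<tau> L c :: real
  assumes cf: "comparison_function TYPE('a) \<phi> \<sigma> R B"
    and r0: "0 < r" and rR: "2 * r \<le> R" and tau0: "0 < \<tau>" and L1: "1 \<le> L" and c0: "0 \<le> c"
    and lip: "\<And>x y s t. x \<in> ball p0 r \<Longrightarrow> y \<in> ball p0 r \<Longrightarrow> s \<in> {a..<a+\<tau>} \<Longrightarrow> t \<in> {a..<a+\<tau>} \<Longrightarrow>
      \<bar>f s x - f t y\<bar> \<le> L * (dist x y + \<bar>s - t\<bar>)"
    and conc: "\<And>x y t \<gamma> s. x \<in> ball p0 r \<Longrightarrow> y \<in> ball p0 r \<Longrightarrow> t \<in> {a..<a+\<tau>} \<Longrightarrow> geodesic_seg \<gamma> x y \<Longrightarrow>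
      s \<in> {0..dist x y} \<Longrightarrow>
      (dist x y - s) * f t x + s * f t y - c / 2 * s * (dist x y - s) * dist x y \<le> dist x y * f t (\<gamma> s)"
begin

section \<open>Consequences of the clauses on \<open>\<phi>\<close> and
  \<open>\<sigma>\<close>\<close>

lemma R0: "0 < R" and R1: "R \<le> 1" and B0: "0 \<le> B" and BR: "B * R \<le> 1 / 2" and phi_0: "\<phi> 0 = 0"
  using cf unfolding comparison_function_def by - (elim conjE, assumption)+

lemma isCont_phi: "isCont \<phi> d"
  using cf unfolding comparison_function_def by - (elim conjE, erule spec)

lemma phi_tangent: "d \<in> {0..R} \<Longrightarrow> d' \<in> {0..R} \<Longrightarrow> \<phi> d + \<sigma> d * (d' - d) \<le> \<phi> d'"
  using cf unfolding comparison_function_def by simp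

lemma sigma_diff: "d \<in> {0..R} \<Longrightarrow> \<bar>\<sigma> d - d\<bar> \<le> B * d\<^sup>2"
  using cf unfolding comparison_function_def by simp

lemma geodesic_exists:
  fixes x y :: 'a
  assumes "dist x y \<le> R"
  obtains \<gamma> where "geodesic_seg \<gamma> x y"
proof -
  have "\<forall>x y :: 'a. dist x y \<le> R \<longrightarrow> (\<exists>\<gamma>. geodesic_seg \<gamma> x y)"
    using cf unfolding comparison_function_def by (elim conjE)
  then show ?thesis using assms that by blast
qed

lemma phi_midpoint:
  fixes x y z :: 'a
  assumes "geodesic_seg \<gamma> y z" "dist x y \<le> R" "dist x z \<le> R" "dist y z \<le> R"
  shows "\<phi> (dist x (\<gamma> (dist y z / 2))) \<le> (\<phi> (dist x y) + \<phi> (dist x z)) / 2 - (dist y z)\<^sup>2 / 32"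
proof -
  have "\<forall>(x :: 'a) y z \<gamma>. geodesic_seg \<gamma> y z \<and> dist x y \<le> R \<and> dist x z \<le> R \<and> dist y z \<le> R \<longrightarrow>
      \<phi> (dist x (\<gamma> (dist y z / 2))) \<le> (\<phi> (dist x y) + \<phi> (dist x z)) / 2 - (dist y z)\<^sup>2 / 32"
    using cf unfolding comparison_function_def by (elim conjE)
  from this[rule_format, of \<gamma> y z x] show ?thesis using assms by simp
qed

lemma phi_first_variation:
  fixes x y z :: 'a
  assumes "geodesic_seg \<gamma> y z" "dist x y \<le> R" "dist x z \<le> R" "dist y z \<le> R" "y \<noteq> z" "e > 0"
  shows "eventually (\<lambda>s. \<phi> (dist x (\<gamma> s)) \<le>
           \<phi> (dist x y) + s * ((\<phi> (dist x z) - \<phi> (dist y z)) / \<sigma> (dist y z) + e)) (at_right 0)"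
proof -
  have "\<forall>(x :: 'a) y z \<gamma>. geodesic_seg \<gamma> y z \<and> dist x y \<le> R \<and> dist x z \<le> R \<and> dist y z \<le> R \<and> y \<noteq> z \<longrightarrow>
      (\<forall>e>0. eventually (\<lambda>s. \<phi> (dist x (\<gamma> s)) \<le>
         \<phi> (dist x y) + s * ((\<phi> (dist x z) - \<phi> (dist y z)) / \<sigma> (dist y z) + e)) (at_right 0))"
    using cf unfolding comparison_function_def by (elim conjE)
  from this[rule_format, of \<gamma> y z x e] show ?thesis using assms by simp
qed

lemma sigma_bounds:
  assumes "d \<in> {0..R}"
  shows "d / 2 \<le> \<sigma> d" "\<sigma> d \<le> 3 / 2 * d" "\<bar>\<sigma> d - d\<bar> \<le> B * d * d" "B * d \<le> 1 / 2"
proof -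
  show *: "\<bar>\<sigma> d - d\<bar> \<le> B * d * d" using sigma_diff[OF assms] by (simp add: power2_eq_square mult.assoc)
  show **: "B * d \<le> 1 / 2" using mult_left_mono[of d R B] assms B0 BR by auto
  have "B * d * d \<le> 1/2 * d" using ** assms by (intro mult_right_mono) auto
  then show "d / 2 \<le> \<sigma> d" "\<sigma> d \<le> 3 / 2 * d" using * by (auto simp: abs_le_iff)
qed

lemma phi_mono: assumes "0 \<le> d" "d \<le> d'" "d' \<le> R" shows "\<phi> d \<le> \<phi> d'"
proof -
  have "0 \<le> \<sigma> d" using sigma_bounds(1)[of d] assms by auto
  then have "0 \<le> \<sigma> d * (d' - d)" using assms by simp
  then show ?thesis using phi_tangent[of d d'] assms by auto
qed

lemma phi_nonneg: "0 \<le> d \<Longrightarrow> d \<le> R \<Longrightarrow> 0 \<le> \<phi> d"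
  using phi_mono[of 0 d] phi_0 by simp

text \<open>The tangent at 0 has slope 0 and says too little; the tangent at \<open>d / 2\<close>,
  of slope at least \<open>d / 4\<close>, gives the quadratic growth.\<close>

lemma phi_ge: assumes "d \<in> {0..R}" shows "d\<^sup>2 / 8 \<le> \<phi> d"
proof -
  have h: "d / 2 \<in> {0..R}" using assms by auto
  have "d / 2 / 2 * (d / 2) \<le> \<sigma> (d / 2) * (d / 2)"
    using sigma_bounds(1)[OF h] assms by (intro mult_right_mono) auto
  also have "\<dots> \<le> \<phi> d" using phi_tangent[OF h assms] phi_nonneg[of "d/2"] h by auto
  finally show ?thesis by (simp add: power2_eq_square)
qed

lemma phi_diff_le: assumes "d \<in> {0..R}" "d' \<in> {0..R}" shows "\<phi> d - \<phi> d' \<le> 2 * \<bar>d - d'\<bar>"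
proof (cases "d \<le> d'")
  case True
  then show ?thesis using phi_mono[of d d'] assms by auto
next
  case False
  have "\<sigma> d \<le> 3 / 2 * d" using sigma_bounds(2) assms by blast
  also have "\<dots> \<le> 2" using assms R1 by auto
  finally have "\<sigma> d * (d - d') \<le> 2 * (d - d')" using False by (intro mult_right_mono) auto
  then show ?thesis using phi_tangent[OF assms] False by (simp add: algebra_simps)
qed

text \<open>The factor 8 converts l^2 into \<open>8 * \<phi> l\<close>. \<open>B * L\<close> pays
  for replacing \<open>\<sigma> l\<close> by \<open>l\<close> against the Lipschitz bound of the
  family, and \<open>c\<close> for the defect of concavity.\<close>

definition Lam :: real where "Lam = 8 * (B * L + c)"
text \<open>The cost of evaluating the one-step inequality at \<open>x\<close> instead of
  \<open>y\<close> when \<open>dist x y \<le> 8 * L * h\<close>.\<close>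

definition Cst :: real where "Cst = 8 * L\<^sup>2 + 16 * L * Lam"

lemma Lam0: "0 \<le> Lam" and Cst0: "0 \<le> Cst"
proof -
  show *: "0 \<le> Lam" using B0 L1 c0 by (simp add: Lam_def)
  show "0 \<le> Cst" using * L1 by (simp add: Cst_def)
qed

lemma lip_space: "x \<in> ball p0 r \<Longrightarrow> y \<in> ball p0 r \<Longrightarrow> t \<in> {a..<a+\<tau>} \<Longrightarrow> \<bar>f t x - f t y\<bar> \<le> L * dist x y"
  using lip[of x y t t] by simp

lemma dist_in_ball_R: "x \<in> ball p0 r \<Longrightarrow> y \<in> ball p0 r \<Longrightarrow> dist x y \<le> R"
  using dist_triangle_less_add[of x p0 r y r] rR by (auto simp: dist_commute)

text \<open>Beyond distance \<open>8 * L * h\<close> the penalty, at least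
  \<open>d\<^sup>2 / (8 * h)\<close>, outweighs any gain of an \<open>L\<close>-Lipschitz function,
  so the search is confined to a small ball. \<open>40 * L * h \<le> r\<close> leaves room for
  midpoints, and \<open>8 * c * h \<le> 1\<close> lets half of the convexity of the penalty absorb
  the defect of concavity.\<close>

lemma prox_exists:
  assumes x: "x \<in> ball p0 (r/2)" and t: "t \<in> {a..<a+\<tau>}" and h: "0 < h" "40 * L * h \<le> r" "8 * c * h \<le> 1"
  obtains y where "dist x y \<le> 8 * L * h"
    "\<And>z. z \<in> ball x (r/2) \<Longrightarrow> f t z - \<phi> (dist x z) / h \<le> f t y - \<phi> (dist x y) / h"
proof -
  define F where "F z = f t z - \<phi> (dist x z) / h" for z
  define \<rho> where "\<rho> = 8 * L * h"
  have rho: "0 < \<rho>" "5 * \<rho> \<le> r" using h L1 by (auto simp: \<rho>_def)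
  define Z where "Z = cball x \<rho>"
  have sub: "z \<in> ball p0 r" if "z \<in> ball x (r/2)" for z
    using x that dist_triangle[of p0 z x] by auto
  have Zb: "z \<in> ball x (r/2)" "dist x z \<le> \<rho>" if "z \<in> Z" for z using that rho r0 by (auto simp: Z_def)
  have xb: "x \<in> ball p0 r" "x \<in> Z" using x r0 rho by (auto simp: Z_def)
  have dR: "dist x z \<in> {0..R}" if "z \<in> ball x (r/2)" for z using that rR r0 by auto
  have far: "F z \<le> F x" if z: "z \<in> ball x (r/2)" "\<rho> < dist x z" for z
  proof -
    define d where "d = dist x z"
    have "L * d = \<rho> * d / (8 * h)" using h by (simp add: \<rho>_def)
    also have "\<dots> \<le> d * d / (8 * h)" using z h by (intro divide_right_mono mult_right_mono) (auto simp: d_def)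
    also have "\<dots> = d\<^sup>2 / 8 / h" by (simp add: power2_eq_square)
    also have "\<dots> \<le> \<phi> d / h" using phi_ge[OF dR[OF z(1)]] h by (intro divide_right_mono) (auto simp: d_def)
    finally have "L * d \<le> \<phi> d / h" .
    moreover have "f t z - f t x \<le> L * d" using lip_space[OF xb(1) sub[OF z(1)] t] by (simp add: d_def abs_le_iff)
    ultimately show ?thesis by (simp add: F_def d_def phi_0)
  qed
  have bdd: "F z \<le> f t x + L * \<rho>" if "z \<in> Z" for z
  proof -
    have "f t z - f t x \<le> L * dist x z" using lip_space[OF xb(1) sub[OF Zb(1)[OF that]] t] by (simp add: abs_le_iff)
    also have "\<dots> \<le> L * \<rho>" using Zb[OF that] L1 by (intro mult_left_mono) auto
    finally have "f t z \<le> f t x + L * \<rho>" by simp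
    moreover have "0 \<le> \<phi> (dist x z) / h" using phi_nonneg dR[OF Zb(1)[OF that]] h by auto
    ultimately show ?thesis by (simp add: F_def)
  qed
  define S where "S = (SUP z\<in>Z. F z)"
  have ba: "bdd_above (F ` Z)" using bdd by (auto intro!: bdd_aboveI)
  have le: "F z \<le> S" if "z \<in> Z" for z unfolding S_def using that ba by (rule cSUP_upper)
  \<comment> \<open>The midpoint of two points of \<open>Z\<close> may lie outside \<open>Z\<close>,
    so the supremum over \<open>Z\<close> has to bound \<open>F\<close> on the larger ball as
    well.\<close>
  have le': "F z \<le> S" if "z \<in> ball x (r/2)" for z
    using le[of z] far[OF that] le[OF xb(2)] by (cases "z \<in> Z") (auto simp: Z_def)
  have sup: "\<exists>z\<in>Z. S - e < F z" if "e > 0" for e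
    using less_cSUP_iff[of Z F "S - e"] ba xb that by (auto simp: S_def)
  have mid: "1 / (32 * h) * (dist z1 z2)\<^sup>2 \<le> 2 * S - F z1 - F z2" if z: "z1 \<in> Z" "z2 \<in> Z" for z1 z2
  proof -
    define l where "l = dist z1 z2"
    have zb: "z1 \<in> ball p0 r" "z2 \<in> ball p0 r" using z Zb sub by auto
    have lR: "l \<le> R" unfolding l_def by (rule dist_in_ball_R[OF zb])
    have l\<rho>: "l \<le> 2 * \<rho>" using z dist_triangle3[of z1 z2 x] by (auto simp: Z_def l_def)
    obtain \<gamma> where \<gamma>: "geodesic_seg \<gamma> z1 z2" using geodesic_exists lR l_def by blast
    define m where "m = \<gamma> (l / 2)"
    have dm: "dist z1 m = l / 2" using geodesic_seg_dist_start[OF \<gamma>, of "l/2"] by (simp add: m_def l_def)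
    have mb: "m \<in> ball x (r/2)"
      using dist_triangle[of x m z1] dm l\<rho> Zb[OF z(1)] rho by auto
    have "l * ((f t z1 + f t z2) / 2 - c / 8 * l\<^sup>2) \<le> l * f t m"
      using conc[OF zb t \<gamma>, of "l/2"] by (simp add: l_def m_def field_simps power2_eq_square)
    then have fm: "(f t z1 + f t z2) / 2 - c / 8 * l\<^sup>2 \<le> f t m"
    proof (cases "l = 0")
      case True
      then have "m = z1" "z2 = z1" using dm by (auto simp: l_def)
      then show ?thesis using True by simp
    next
      case False
      then have "l > 0" by (simp add: l_def)
      then show ?thesis using \<open>l * _ \<le> l * f t m\<close> by (simp add: mult_le_cancel_left)
    qed
    have "\<phi> (dist x m) \<le> (\<phi> (dist x z1) + \<phi> (dist x z2)) / 2 - l\<^sup>2 / 32"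
      using phi_midpoint[OF \<gamma>, of x] dR[OF Zb(1)[OF z(1)]] dR[OF Zb(1)[OF z(2)]] lR by (simp add: l_def m_def)
    then have "\<phi> (dist x m) / h \<le> ((\<phi> (dist x z1) + \<phi> (dist x z2)) / 2 - l\<^sup>2 / 32) / h"
      using h by (intro divide_right_mono) auto
    also have "\<dots> = (\<phi> (dist x z1) / h + \<phi> (dist x z2) / h) / 2 - l\<^sup>2 / (32 * h)"
      using h by (simp add: field_simps)
    finally have pm: "\<phi> (dist x m) / h \<le> (\<phi> (dist x z1) / h + \<phi> (dist x z2) / h) / 2 - l\<^sup>2 / (32 * h)" .
    have "c / 8 \<le> 1 / (64 * h)" using h by (simp add: field_simps)
    then have "c / 8 * l\<^sup>2 \<le> 1 / (64 * h) * l\<^sup>2" by (intro mult_right_mono) auto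
    moreover define E where "E = l\<^sup>2 / (64 * h)"
    ultimately have "c / 8 * l\<^sup>2 \<le> E" by simp
    moreover have E2: "l\<^sup>2 / (32 * h) = 2 * E" by (simp add: E_def)
    ultimately have "(F z1 + F z2) / 2 + E \<le> F m"
      using fm pm unfolding E2 F_def add_divide_distrib diff_divide_distrib by linarith
    then have "l\<^sup>2 / (32 * h) \<le> 2 * S - F z1 - F z2"
      unfolding E2 using le'[OF mb] by (simp add: field_simps)
    then show ?thesis by (simp add: l_def)
  qed
  have cont: "continuous_on Z F"
  proof -
    have "continuous_on Z (f t)"
    proof (rule lipschitz_on_continuous_on[of L])
      show "L-lipschitz_on Z (f t)"
        using lip_space[OF sub sub t] Zb L1 by (intro lipschitz_onI) (auto simp: dist_real_def)
    qed
    moreover have "continuous_on Z (\<lambda>z. \<phi> (dist x z))"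
    proof (rule continuous_on_compose2[of UNIV \<phi>])
      show "continuous_on UNIV \<phi>" by (simp add: continuous_at_imp_continuous_on isCont_phi)
      show "continuous_on Z (dist x)" by (intro continuous_intros)
    qed simp
    ultimately show ?thesis unfolding F_def using h by (intro continuous_intros) auto
  qed
  have "\<exists>y\<in>Z. F y = S"
    by (rule exists_maximizer_of_midpoint[OF _ cont le sup _ mid]) (use h in \<open>auto simp: Z_def\<close>)
  then obtain y where y: "y \<in> Z" "F y = S" by blast
  show ?thesis
  proof (rule that)
    show "dist x y \<le> 8 * L * h" using Zb(2)[OF y(1)] by (simp add: \<rho>_def)
    show "f t z - \<phi> (dist x z) / h \<le> f t y - \<phi> (dist x y) / h" if "z \<in> ball x (r/2)" for z
      using le'[OF that] y(2) by (simp add: F_def)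
  qed
qed

text \<open>Optimality of \<open>y\<close> is tested by moving from \<open>y\<close> a little
  towards \<open>p\<close>: concavity bounds the gain in \<open>f\<close> from below, the first
  variation bounds the growth of the penalty from above. This gives an implicit inequality, with
  \<open>y\<close> on the right; the second half makes it explicit at the cost
  \<open>Cst * h\<^sup>2\<close>.\<close>

lemma prox_step:
  assumes x: "x \<in> ball p0 (r/2)" and t: "t \<in> {a..<a+\<tau>}" and h: "0 < h" "40 * L * h \<le> r" "8 * c * h \<le> 1"
  obtains y where "dist x y \<le> 8 * L * h"
    "\<And>p. p \<in> ball p0 r \<Longrightarrow>
       \<phi> (dist y p) \<le> \<phi> (dist x p) + h * (f t x - f t p + Lam * \<phi> (dist x p)) + Cst * h\<^sup>2"
proof -
  obtain y where xy: "dist x y \<le> 8 * L * h"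
    and max: "\<And>z. z \<in> ball x (r/2) \<Longrightarrow> f t z - \<phi> (dist x z) / h \<le> f t y - \<phi> (dist x y) / h"
    by (rule prox_exists[OF assms]) (rule that)
  have Lh: "8 * L * h \<le> r / 5" using h by simp
  have xb: "x \<in> ball p0 r" using x r0 by auto
  have yb: "y \<in> ball p0 r" using x xy Lh dist_triangle[of p0 y x] r0 by auto
  have xyR: "dist x y \<le> R" using xy Lh rR r0 by linarith
  have main: "\<phi> (dist y p) \<le> \<phi> (dist x p) + h * (f t y - f t p + Lam * \<phi> (dist y p))" if p: "p \<in> ball p0 r" for p
  proof (cases "y = p")
    case True
    then show ?thesis using phi_nonneg[of "dist x p"] xyR by (simp add: phi_0)
  next
    case False
    define l where "l = dist y p"
    have l0: "l > 0" using False by (simp add: l_def)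
    have lR: "l \<le> R" "dist x p \<le> R" using dist_in_ball_R xb yb p by (auto simp: l_def)
    have l: "l \<in> {0..R}" using l0 lR by simp
    obtain \<gamma> where \<gamma>: "geodesic_seg \<gamma> y p" using geodesic_exists lR l_def by blast
    define Q where "Q = (\<phi> (dist x p) - \<phi> l) / \<sigma> l"
    define G where "G = f t y - f t p"
    \<comment> \<open>The slack \<open>e\<close> comes from the first variation. The displacement
      \<open>s\<close> cancels from both sides, so a single small \<open>s\<close> suffices for each
      \<open>e\<close>.\<close>
    have "h * (- G - c / 2 * l\<^sup>2) \<le> l * Q + e" if "e > 0" for e
    proof -
      have ev: "eventually (\<lambda>s. \<phi> (dist x (\<gamma> s)) \<le> \<phi> (dist x y) + s * (Q + e / l)) (at_right 0)"
        using phi_first_variation[OF \<gamma> xyR lR(2) _ False, of "e / l"] lR l0 that by (simp add: l_def Q_def)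
      have "eventually (\<lambda>s. s \<in> {0<..<min l (r/4)}) (at_right 0)"
        using l0 r0 by (intro eventually_at_right_real) auto
      then have "eventually (\<lambda>s. 0 < s \<and> s < l \<and> s < r/4 \<and> \<phi> (dist x (\<gamma> s)) \<le> \<phi> (dist x y) + s * (Q + e / l)) (at_right 0)"
        using ev by eventually_elim auto
      then have "\<exists>s. 0 < s \<and> s < l \<and> s < r/4 \<and> \<phi> (dist x (\<gamma> s)) \<le> \<phi> (dist x y) + s * (Q + e / l)"
        by (rule eventually_happens'[rotated]) simp
      then obtain s where s: "0 < s" "s < l" "s < r/4" and ps: "\<phi> (dist x (\<gamma> s)) \<le> \<phi> (dist x y) + s * (Q + e / l)"
        by blast
      have "dist y (\<gamma> s) = s" using geodesic_seg_dist_start[OF \<gamma>, of s] s by (simp add: l_def)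
      then have "\<gamma> s \<in> ball x (r/2)" using dist_triangle[of x "\<gamma> s" y] xy Lh s r0 by auto
      from max[OF this] have "f t (\<gamma> s) - f t y \<le> (\<phi> (dist x (\<gamma> s)) - \<phi> (dist x y)) / h"
        by (simp add: diff_divide_distrib)
      also have "\<dots> \<le> s * (Q + e / l) / h" using ps h by (intro divide_right_mono) auto
      finally have "l * (f t (\<gamma> s) - f t y) \<le> l * (s * (Q + e / l) / h)" using l0 by (intro mult_left_mono) auto
      also have "\<dots> = s * ((l * Q + e) / h)" using l0 h by (simp add: field_simps)
      finally have up: "l * (f t (\<gamma> s) - f t y) \<le> s * ((l * Q + e) / h)" .
      have "(l - s) * f t y + s * f t p - c / 2 * s * (l - s) * l \<le> l * f t (\<gamma> s)"
        using conc[OF yb p t \<gamma>, of s] s by (simp add: l_def)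
      then have "s * (- G) - c / 2 * s * (l - s) * l \<le> l * (f t (\<gamma> s) - f t y)"
        by (simp add: G_def algebra_simps)
      moreover have "c / 2 * s * (l - s) * l \<le> c / 2 * s * l * l"
        using c0 s l0 by (intro mult_left_mono mult_right_mono) auto
      moreover have "s * (- G - c / 2 * l\<^sup>2) = s * (- G) - c / 2 * s * l * l"
        by (simp add: algebra_simps power2_eq_square)
      ultimately have "s * (- G - c / 2 * l\<^sup>2) \<le> l * (f t (\<gamma> s) - f t y)" by linarith
      with up have "s * (- G - c / 2 * l\<^sup>2) \<le> s * ((l * Q + e) / h)" by linarith
      then have "- G - c / 2 * l\<^sup>2 \<le> (l * Q + e) / h" using mult_le_cancel_left_pos[OF s(1)] by blast
      then show ?thesis using h by (simp only: pos_le_divide_eq mult.commute)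
    qed
    then have "h * (- G - c / 2 * l\<^sup>2) \<le> l * Q" by (rule field_le_epsilon)
    moreover have \<sigma>0: "\<sigma> l > 0" using sigma_bounds(1)[OF l] l0 by linarith
    \<comment> \<open>Multiplying by \<open>w\<close> turns \<open>l * Q\<close> into a difference
      of values of \<open>\<phi>\<close>; since \<open>w\<close> is within \<open>B * l\<close> of
      1, its effect on \<open>G\<close> is quadratic in \<open>l\<close> and goes into
      \<open>Lam\<close>.\<close>
    define w where "w = \<sigma> l / l"
    have w0: "w > 0" using \<sigma>0 l0 by (simp add: w_def)
    have wl: "w * (l * Q) = \<phi> (dist x p) - \<phi> l" using \<sigma>0 l0 by (simp add: w_def Q_def)
    ultimately have "w * (h * (- G - c / 2 * l\<^sup>2)) \<le> \<phi> (dist x p) - \<phi> l"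
      using w0 wl by (metis mult_left_mono less_imp_le)
    then have phi1: "\<phi> l \<le> \<phi> (dist x p) + h * (w * G + w * (c / 2 * l\<^sup>2))" by (simp add: algebra_simps)
    have "w - 1 = (\<sigma> l - l) / l" using l0 by (simp add: w_def field_simps)
    then have "\<bar>w - 1\<bar> = \<bar>\<sigma> l - l\<bar> / l" using l0 by simp
    also have "\<dots> \<le> B * l * l / l" using sigma_bounds(3)[OF l] l0 by (intro divide_right_mono) auto
    finally have w1: "\<bar>w - 1\<bar> \<le> B * l" using l0 by simp
    have G: "\<bar>G\<bar> \<le> L * l" using lip_space[OF yb p t] by (simp add: G_def l_def)
    have "(w - 1) * G \<le> \<bar>w - 1\<bar> * \<bar>G\<bar>" by (metis abs_ge_self abs_mult)
    also have "\<dots> \<le> B * l * (L * l)" using w1 G by (intro mult_mono) (auto simp: B0 l0 less_imp_le)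
    finally have "w * G \<le> G + B * L * l\<^sup>2" by (simp add: algebra_simps power2_eq_square)
    moreover have "w * (c / 2 * l\<^sup>2) \<le> 2 * (c / 2 * l\<^sup>2)"
      using w1 sigma_bounds(4)[OF l] c0 by (intro mult_right_mono) (auto simp: abs_le_iff)
    ultimately have "w * G + w * (c / 2 * l\<^sup>2) \<le> G + (B * L + c) * l\<^sup>2" by (simp add: algebra_simps)
    also have "(B * L + c) * l\<^sup>2 \<le> (B * L + c) * (8 * \<phi> l)"
      using phi_ge[OF l] B0 L1 c0 by (intro mult_left_mono) auto
    finally have "w * G + w * (c / 2 * l\<^sup>2) \<le> G + Lam * \<phi> l" by (simp add: Lam_def algebra_simps)
    then have "h * (w * G + w * (c / 2 * l\<^sup>2)) \<le> h * (G + Lam * \<phi> l)" using h by (intro mult_left_mono) auto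
    then show ?thesis using phi1 by (simp add: l_def G_def)
  qed
  have "\<phi> (dist y p) \<le> \<phi> (dist x p) + h * (f t x - f t p + Lam * \<phi> (dist x p)) + Cst * h\<^sup>2" if p: "p \<in> ball p0 r" for p
  proof -
    have "\<phi> (dist y p) - \<phi> (dist x p) \<le> 2 * \<bar>dist y p - dist x p\<bar>"
      using dist_in_ball_R[OF yb p] dist_in_ball_R[OF xb p] by (intro phi_diff_le) auto
    also have "\<dots> \<le> 2 * (8 * L * h)" using abs_dist_diff_le[of y p x] xy by (simp add: dist_commute)
    finally have "Lam * \<phi> (dist y p) \<le> Lam * (\<phi> (dist x p) + 16 * L * h)"
      using Lam0 by (intro mult_left_mono) auto
    moreover have "f t y - f t x \<le> L * (8 * L * h)"
    proof -
      have "f t y - f t x \<le> L * dist x y" using lip_space[OF yb xb t] by (simp add: abs_le_iff dist_commute)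
      also have "\<dots> \<le> L * (8 * L * h)" using xy L1 by (intro mult_left_mono) auto
      finally show ?thesis .
    qed
    ultimately have "f t y - f t p + Lam * \<phi> (dist y p) \<le> f t x - f t p + Lam * \<phi> (dist x p) + Cst * h"
      by (simp add: Cst_def algebra_simps power2_eq_square)
    then have "h * (f t y - f t p + Lam * \<phi> (dist y p)) \<le> h * (f t x - f t p + Lam * \<phi> (dist x p) + Cst * h)"
      using h by (intro mult_left_mono) auto
    also have "\<dots> = h * (f t x - f t p + Lam * \<phi> (dist x p)) + Cst * h\<^sup>2" by (simp add: algebra_simps power2_eq_square)
    finally show ?thesis using main[OF p] by linarith
  qed
  with xy show ?thesis by (rule that)
qed

end

section \<open>The discrete scheme and its limit\<close>

text \<open>At speed at most \<open>8 * L\<close>, the bound on \<open>T\<close> keeps every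
  discrete curve within \<open>r / 4\<close> of \<open>p0\<close>; \<open>T \<le> 1\<close>
  simplifies error terms.\<close>

locale local_flow_time = local_flow \<phi> \<sigma> R B f p0 a r \<tau> L c
  for \<phi> \<sigma> R B and f :: "real \<Rightarrow> 'a::complete_space \<Rightarrow> real" and p0 a r \<tau> L c +
  fixes T :: real
  assumes T0: "0 < T" and T1: "T \<le> 1" and Ttau: "T < \<tau>" and LT: "32 * L * T \<le> r"
begin

definition prox :: "real \<Rightarrow> real \<Rightarrow> 'a \<Rightarrow> 'a" where
  "prox h t x = (SOME y. dist x y \<le> 8 * L * h \<and> (\<forall>p\<in>ball p0 r.
     \<phi> (dist y p) \<le> \<phi> (dist x p) + h * (f t x - f t p + Lam * \<phi> (dist x p)) + Cst * h\<^sup>2))"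

lemma prox_props:
  assumes "x \<in> ball p0 (r/2)" "t \<in> {a..<a+\<tau>}" "0 < h" "40 * L * h \<le> r" "8 * c * h \<le> 1"
  shows "dist x (prox h t x) \<le> 8 * L * h"
    and "p \<in> ball p0 r \<Longrightarrow> \<phi> (dist (prox h t x) p) \<le>
      \<phi> (dist x p) + h * (f t x - f t p + Lam * \<phi> (dist x p)) + Cst * h\<^sup>2"
proof -
  have "\<exists>y. dist x y \<le> 8 * L * h \<and> (\<forall>p\<in>ball p0 r.
     \<phi> (dist y p) \<le> \<phi> (dist x p) + h * (f t x - f t p + Lam * \<phi> (dist x p)) + Cst * h\<^sup>2)"
    by (rule prox_step[OF assms]) blast
  from someI_ex[OF this] show "dist x (prox h t x) \<le> 8 * L * h"
    and "p \<in> ball p0 r \<Longrightarrow> \<phi> (dist (prox h t x) p) \<le>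
      \<phi> (dist x p) + h * (f t x - f t p + Lam * \<phi> (dist x p)) + Cst * h\<^sup>2"
    unfolding prox_def by auto
qed

primrec grid :: "real \<Rightarrow> nat \<Rightarrow> 'a" where
  "grid h 0 = p0"
| "grid h (Suc k) = prox h (a + real k * h) (grid h k)"

text \<open>Evolution variational inequality: a curve \<open>\<alpha>\<close> is a gradient curve when the upper right derivative of
  \<open>\<phi> (dist (\<alpha> t) p)\<close> is at most \<open>evi_rhs t (\<alpha> t) p\<close> for all \<open>p\<close> near \<open>\<alpha> t\<close>.\<close>
definition evi_rhs :: "real \<Rightarrow> 'a \<Rightarrow> 'a \<Rightarrow> real" where
  "evi_rhs t x p = f t x - f t p + Lam * \<phi> (dist x p)"

text \<open>A bound for the drift of \<open>evi_rhs\<close> per unit time along a curve of speed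
  \<open>8 * L\<close>: \<open>(L + 2 * Lam) * (8 * L)\<close> from the motion and
  \<open>2 * L\<close> from the time dependence.\<close>

definition E_c :: real where "E_c = 8 * L\<^sup>2 + 2 * L + 16 * L * Lam"
definition M_c :: real where "M_c = L + 2 * Lam"

lemma E_c0: "0 \<le> E_c" and M_c0: "0 \<le> M_c"
  using L1 Lam0 by (auto simp: E_c_def M_c_def)

lemma phi_le_two: "d \<in> {0..R} \<Longrightarrow> \<phi> d \<le> 2"
  using phi_diff_le[of d 0] R0 R1 phi_0 by auto

lemma evi_rhs_diff:
  assumes "x \<in> ball p0 r" "y \<in> ball p0 r" "p \<in> ball p0 r" "s \<in> {a..<a+\<tau>}" "t \<in> {a..<a+\<tau>}"
  shows "evi_rhs t y p - evi_rhs s x p \<le> (L + 2 * Lam) * dist x y + 2 * L * \<bar>t - s\<bar>"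
proof -
  have "f t y - f s x \<le> L * (dist x y + \<bar>t - s\<bar>)"
    using lip[of y x t s] assms by (simp add: abs_le_iff dist_commute)
  moreover have "f s p - f t p \<le> L * \<bar>t - s\<bar>"
    using lip[of p p s t] assms by (simp add: abs_le_iff abs_minus_commute)
  moreover have "Lam * (\<phi> (dist y p) - \<phi> (dist x p)) \<le> Lam * (2 * dist x y)"
  proof (rule mult_left_mono[OF _ Lam0])
    have "\<phi> (dist y p) - \<phi> (dist x p) \<le> 2 * \<bar>dist y p - dist x p\<bar>"
      using dist_in_ball_R assms by (intro phi_diff_le) auto
    also have "\<dots> \<le> 2 * dist x y" using abs_dist_diff_le[of y p x] by (simp add: dist_commute)
    finally show "\<phi> (dist y p) - \<phi> (dist x p) \<le> 2 * dist x y" .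
  qed
  ultimately show ?thesis by (simp add: evi_rhs_def algebra_simps)
qed

lemma abs_evi_rhs_le:
  assumes "x \<in> ball p0 r" "p \<in> ball p0 r" "t \<in> {a..<a+\<tau>}"
  shows "\<bar>evi_rhs t x p\<bar> \<le> M_c"
proof -
  have d: "dist x p \<in> {0..R}" using dist_in_ball_R assms by auto
  have "\<bar>f t x - f t p\<bar> \<le> L * dist x p" using lip_space assms by blast
  also have "\<dots> \<le> L * 1" using d R1 L1 by (intro mult_left_mono) auto
  finally have "\<bar>f t x - f t p\<bar> \<le> L" by simp
  moreover have "0 \<le> Lam * \<phi> (dist x p)" using Lam0 phi_nonneg d by auto
  moreover have "Lam * \<phi> (dist x p) \<le> Lam * 2" using phi_le_two[OF d] Lam0 by (intro mult_left_mono)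
  ultimately show ?thesis unfolding evi_rhs_def M_c_def by linarith
qed

section \<open>Error accumulation along the discrete curve\<close>

context
  fixes h :: real
  assumes h: "0 < h" "40 * L * h \<le> r" "8 * c * h \<le> 1"
begin

lemma grid_dist_p0: "real k * h \<le> T \<Longrightarrow> dist p0 (grid h k) \<le> 8 * L * (real k * h)"
proof (induction k)
  case (Suc k)
  have kT: "real k * h \<le> T" "real k * h \<ge> 0" using Suc.prems h by (auto simp: algebra_simps)
  have IH: "dist p0 (grid h k) \<le> 8 * L * (real k * h)" by (rule Suc.IH[OF kT(1)])
  also have "\<dots> \<le> 8 * L * T" using kT L1 by (intro mult_left_mono) auto
  finally have "grid h k \<in> ball p0 (r/2)" using LT r0 by simp
  then have "dist (grid h k) (grid h (Suc k)) \<le> 8 * L * h"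
    using prox_props(1)[of "grid h k" "a + real k * h" h] kT Ttau h by simp
  then show ?case using IH dist_triangle[of p0 "grid h (Suc k)" "grid h k"] by (simp add: algebra_simps)
qed simp

lemma grid_in_ball:
  assumes "real k * h \<le> T" shows "dist p0 (grid h k) \<le> r / 4" "grid h k \<in> ball p0 (r/2)" "grid h k \<in> ball p0 r"
proof -
  have "dist p0 (grid h k) \<le> 8 * L * (real k * h)" by (rule grid_dist_p0[OF assms])
  also have "\<dots> \<le> 8 * L * T" using assms L1 by (intro mult_left_mono) auto
  finally show "dist p0 (grid h k) \<le> r / 4" using LT by simp
  then show "grid h k \<in> ball p0 (r/2)" "grid h k \<in> ball p0 r" using r0 by auto
qed

lemma grid_time: assumes "real k * h \<le> T" shows "a + real k * h \<in> {a..<a+\<tau>}"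
  using assms Ttau h by auto

lemma grid_lip: "real (j + n) * h \<le> T \<Longrightarrow> dist (grid h j) (grid h (j + n)) \<le> 8 * L * (real n * h)"
proof (induction n)
  case (Suc n)
  have kT: "real (j + n) * h \<le> T" using Suc.prems h by (auto simp: algebra_simps)
  have "dist (grid h (j+n)) (grid h (Suc (j+n))) \<le> 8 * L * h"
    using prox_props(1)[of "grid h (j+n)" "a + real (j+n) * h" h] grid_in_ball(2)[OF kT] grid_time[OF kT] h by simp
  then show ?case using Suc.IH[OF kT] dist_triangle[of "grid h j" "grid h (Suc (j+n))" "grid h (j+n)"]
    by (simp add: algebra_simps)
qed simp

text \<open>Freezing the right-hand side at the start of a block of \<open>n\<close> steps costs at
  most \<open>h * (E_c * m)\<close> in a later step, where \<open>m\<close> is the time elapsed in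
  the block. Together with \<open>Cst * h\<^sup>2\<close> per step the total is quadratic in the
  length of the block, uniformly in \<open>h\<close>.\<close>

lemma grid_evi:
  assumes p: "p \<in> ball p0 r"
  shows "real (j + n) * h \<le> T \<Longrightarrow> \<phi> (dist (grid h (j + n)) p) \<le> \<phi> (dist (grid h j) p) +
    real n * h * evi_rhs (a + real j * h) (grid h j) p + (E_c + Cst) * (real n * h)\<^sup>2"
proof (induction n)
  case (Suc n)
  let ?x = "grid h j" and ?y = "grid h (j + n)"
  define m where "m = real n * h"
  have m0: "m \<ge> 0" using h by (simp add: m_def)
  have kT: "real (j + n) * h \<le> T" using Suc.prems h by (auto simp: algebra_simps)
  have jT: "real j * h \<le> T" using kT m0 by (simp add: m_def algebra_simps)
  define G where "G = evi_rhs (a + real j * h) ?x p"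
  define G' where "G' = evi_rhs (a + real (j+n) * h) ?y p"
  have "G' - G \<le> (L + 2 * Lam) * dist ?x ?y + 2 * L * \<bar>a + real (j+n) * h - (a + real j * h)\<bar>"
    unfolding G_def G'_def by (intro evi_rhs_diff grid_in_ball grid_time kT jT p)
  also have "a + real (j+n) * h - (a + real j * h) = m" by (simp add: m_def algebra_simps)
  also have "(L + 2 * Lam) * dist ?x ?y \<le> (L + 2 * Lam) * (8 * L * m)"
    unfolding m_def using grid_lip[OF kT] L1 Lam0 by (intro mult_left_mono) auto
  finally have "G' - G \<le> E_c * m" using m0 by (simp add: E_c_def algebra_simps power2_eq_square)
  then have hG: "h * G' \<le> h * G + h * (E_c * m)" using h mult_left_mono[of G' "G + E_c * m" h] by (simp add: algebra_simps)
  have IH: "\<phi> (dist ?y p) \<le> \<phi> (dist ?x p) + m * G + (E_c + Cst) * m\<^sup>2"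
    using Suc.IH[OF kT] by (simp add: m_def G_def)
  have "\<phi> (dist (grid h (Suc (j+n))) p) \<le> \<phi> (dist ?y p) + h * G' + Cst * h\<^sup>2"
    using prox_props(2)[of ?y "a + real (j+n) * h" h p] grid_in_ball(2)[OF kT] grid_time[OF kT] h p
    by (simp add: G'_def evi_rhs_def)
  also have "\<dots> \<le> \<phi> (dist ?x p) + (m + h) * G + ((E_c + Cst) * m\<^sup>2 + h * (E_c * m) + Cst * h\<^sup>2)"
    using IH hG by (simp add: algebra_simps)
  \<comment> \<open>The increment (m + h)^2 - m^2 = 2 m h + h^2 leaves room for both new
    errors.\<close>
  also have "(E_c + Cst) * m\<^sup>2 + h * (E_c * m) + Cst * h\<^sup>2 \<le> (E_c + Cst) * (m + h)\<^sup>2"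
  proof -
    have "(E_c + Cst) * (m + h)\<^sup>2 - ((E_c + Cst) * m\<^sup>2 + h * (E_c * m) + Cst * h\<^sup>2)
      = E_c * m * h + 2 * Cst * m * h + E_c * h\<^sup>2" by (simp add: algebra_simps power2_eq_square)
    moreover have "E_c * m * h + 2 * Cst * m * h + E_c * h\<^sup>2 \<ge> 0" using E_c0 Cst0 m0 h by simp
    ultimately show ?thesis by linarith
  qed
  finally show ?case by (simp add: m_def G_def algebra_simps)
qed simp

end

text \<open>Time is shifted here: \<open>X s\<close> is the position at time \<open>a + s\<close>.\<close>
definition approx_evi :: "real \<Rightarrow> (real \<Rightarrow> 'a) \<Rightarrow> bool" where
  "approx_evi \<eta> X \<longleftrightarrow> X 0 = p0 \<and> (\<forall>t\<in>{0..T}. dist p0 (X t) \<le> r / 4) \<and>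
     (\<forall>s t. 0 \<le> s \<and> s \<le> t \<and> t \<le> T \<longrightarrow> dist (X s) (X t) \<le> 8 * L * (t - s) + \<eta> \<and>
        (\<forall>p\<in>ball p0 r. \<phi> (dist (X t) p) \<le> \<phi> (dist (X s) p) + (t - s) * evi_rhs (a + s) (X s) p
           + 2 * (E_c + Cst) * (t - s)\<^sup>2 + \<eta>))"

lemma approx_evi_start: "approx_evi \<eta> X \<Longrightarrow> X 0 = p0"
  by (simp add: approx_evi_def)

lemma approx_evi_near:
  assumes "approx_evi \<eta> X" "0 \<le> t" "t \<le> T"
  shows "dist p0 (X t) \<le> r / 4" "X t \<in> ball p0 r"
proof -
  show "dist p0 (X t) \<le> r / 4" using assms by (simp add: approx_evi_def)
  then show "X t \<in> ball p0 r" using r0 by simp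
qed

lemma approx_evi_lip:
  assumes "approx_evi \<eta> X" "0 \<le> s" "s \<le> t" "t \<le> T"
  shows "dist (X s) (X t) \<le> 8 * L * (t - s) + \<eta>"
  using assms(1)[unfolded approx_evi_def, THEN conjunct2, THEN conjunct2, rule_format, of s t] assms(2-) by blast

lemma approx_evi_evi:
  assumes "approx_evi \<eta> X" "0 \<le> s" "s \<le> t" "t \<le> T" "p \<in> ball p0 r"
  shows "\<phi> (dist (X t) p) \<le> \<phi> (dist (X s) p) + (t - s) * evi_rhs (a + s) (X s) p
           + 2 * (E_c + Cst) * (t - s)\<^sup>2 + \<eta>"
  using assms(1)[unfolded approx_evi_def, THEN conjunct2, THEN conjunct2, rule_format, of s t] assms(2-) by blast

lemma approx_eviI:
  assumes "X 0 = p0" "\<And>t. 0 \<le> t \<Longrightarrow> t \<le> T \<Longrightarrow> dist p0 (X t) \<le> r / 4"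
    and "\<And>s t. 0 \<le> s \<Longrightarrow> s \<le> t \<Longrightarrow> t \<le> T \<Longrightarrow> dist (X s) (X t) \<le> 8 * L * (t - s) + \<eta>"
    and "\<And>s t p. 0 \<le> s \<Longrightarrow> s \<le> t \<Longrightarrow> t \<le> T \<Longrightarrow> p \<in> ball p0 r \<Longrightarrow>
      \<phi> (dist (X t) p) \<le> \<phi> (dist (X s) p) + (t - s) * evi_rhs (a + s) (X s) p + 2 * (E_c + Cst) * (t - s)\<^sup>2 + \<eta>"
  shows "approx_evi \<eta> X"
  unfolding approx_evi_def
proof (intro conjI ballI allI impI)
  show "X 0 = p0" by (rule assms(1))
  show "dist p0 (X t) \<le> r / 4" if "t \<in> {0..T}" for t using that assms(2) by auto
  show "dist (X s) (X t) \<le> 8 * L * (t - s) + \<eta>" if "0 \<le> s \<and> s \<le> t \<and> t \<le> T" for s t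
    using that assms(3) by blast
  show "\<phi> (dist (X t) p) \<le> \<phi> (dist (X s) p) + (t - s) * evi_rhs (a + s) (X s) p + 2 * (E_c + Cst) * (t - s)\<^sup>2 + \<eta>"
    if "0 \<le> s \<and> s \<le> t \<and> t \<le> T" "p \<in> ball p0 r" for s t p
    using that assms(4) by blast
qed

lemma approx_evi_mono:
  assumes X: "approx_evi \<eta> X" and le: "\<eta> \<le> \<eta>'" shows "approx_evi \<eta>' X"
proof (rule approx_eviI)
  show "X 0 = p0" by (rule approx_evi_start[OF X])
  show "dist p0 (X t) \<le> r / 4" if "0 \<le> t" "t \<le> T" for t by (rule approx_evi_near[OF X that])
  show "dist (X s) (X t) \<le> 8 * L * (t - s) + \<eta>'" if "0 \<le> s" "s \<le> t" "t \<le> T" for s t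
    using approx_evi_lip[OF X that] le by linarith
  show "\<phi> (dist (X t) p) \<le> \<phi> (dist (X s) p) + (t - s) * evi_rhs (a + s) (X s) p + 2 * (E_c + Cst) * (t - s)\<^sup>2 + \<eta>'"
    if "0 \<le> s" "s \<le> t" "t \<le> T" "p \<in> ball p0 r" for s t p
    using approx_evi_evi[OF X that] le by linarith
qed

text \<open>The rounding error of the step function per unit of \<open>h\<close>:
  \<open>10 * L\<close> covers both the distance bound and the shift of the time argument,
  \<open>M_c\<close> the change in elapsed time, the last term its square.\<close>

definition A_h :: real where "A_h = 10 * L + M_c + 2 * (E_c + Cst)"

lemma approx_evi_grid:
  assumes h: "0 < h" "40 * L * h \<le> r" "8 * c * h \<le> 1"
  shows "approx_evi (A_h * h) (\<lambda>t. grid h (nat \<lfloor>t / h\<rfloor>))"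
proof -
  have h1: "h \<le> 1"
  proof -
    have "1 * h \<le> 40 * L * h" using h L1 by (intro mult_right_mono) auto
    then show ?thesis using h rR R1 r0 by linarith
  qed
  have fl: "real (nat \<lfloor>t / h\<rfloor>) * h \<le> t" "t < real (nat \<lfloor>t / h\<rfloor>) * h + h" if "0 \<le> t" for t
  proof -
    have e: "real (nat \<lfloor>t / h\<rfloor>) = of_int \<lfloor>t / h\<rfloor>" using that h by simp
    show "real (nat \<lfloor>t / h\<rfloor>) * h \<le> t" unfolding e by (rule floor_divide_lower[OF h(1)])
    show "t < real (nat \<lfloor>t / h\<rfloor>) * h + h" unfolding e using floor_divide_upper[OF h(1), of t] by (simp add: distrib_right)
  qed
  have main: "dist (grid h (nat \<lfloor>s / h\<rfloor>)) (grid h (nat \<lfloor>t / h\<rfloor>)) \<le> 8 * L * (t - s) + A_h * h \<and>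
     (\<forall>p\<in>ball p0 r. \<phi> (dist (grid h (nat \<lfloor>t / h\<rfloor>)) p) \<le> \<phi> (dist (grid h (nat \<lfloor>s / h\<rfloor>)) p)
       + (t - s) * evi_rhs (a + s) (grid h (nat \<lfloor>s / h\<rfloor>)) p + 2 * (E_c + Cst) * (t - s)\<^sup>2 + A_h * h)"
    if st: "0 \<le> s" "s \<le> t" "t \<le> T" for s t
  proof -
    define j k where "j = nat \<lfloor>s / h\<rfloor>" and "k = nat \<lfloor>t / h\<rfloor>"
    have "s / h \<le> t / h" using st h by (simp add: divide_right_mono)
    then have jk: "j \<le> k" unfolding j_def k_def by (intro nat_mono floor_mono)
    define n where "n = k - j"
    have k: "k = j + n" using jk by (simp add: n_def)
    define m where "m = real n * h"
    have sj: "real j * h \<le> s" "s < real j * h + h" by (rule fl[OF st(1), folded j_def])+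
    have tk: "real j * h + m \<le> t" "t < real j * h + m + h"
      using fl[of t, folded k_def] st unfolding k m_def by (simp_all add: algebra_simps)
    have kT: "real (j + n) * h \<le> T" using tk st by (simp add: m_def algebra_simps)
    have m0: "0 \<le> m" using h by (simp add: m_def)
    have jT: "real j * h \<le> T" using sj st by simp
    \<comment> \<open>Rounding both times down to the grid changes the elapsed time by at most
      \<open>h\<close>, in either direction.\<close>
    have mts: "m \<le> (t - s) + h" "t - s \<le> m + h" using sj tk by linarith+
    have "8 * L * m \<le> 8 * L * ((t - s) + h)" using mts L1 by (intro mult_left_mono) auto
    then have "dist (grid h j) (grid h k) \<le> 8 * L * (t - s) + 8 * L * h"
      using grid_lip[OF h kT] unfolding k m_def by (simp add: algebra_simps)
    moreover have "8 * L * h \<le> A_h * h"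
      using h L1 M_c0 E_c0 Cst0 by (intro mult_right_mono) (auto simp: A_h_def)
    moreover have "\<phi> (dist (grid h k) p) \<le> \<phi> (dist (grid h j) p)
       + (t - s) * evi_rhs (a + s) (grid h j) p + 2 * (E_c + Cst) * (t - s)\<^sup>2 + A_h * h" if p: "p \<in> ball p0 r" for p
    proof -
      let ?x = "grid h j"
      define G where "G = evi_rhs (a + real j * h) ?x p"
      define G' where "G' = evi_rhs (a + s) ?x p"
      have xb: "?x \<in> ball p0 r" by (rule grid_in_ball(3)[OF h jT])
      have t1: "a + real j * h \<in> {a..<a+\<tau>}" by (rule grid_time[OF h jT])
      have t2: "a + s \<in> {a..<a+\<tau>}" using st Ttau by simp
      have "G - G' \<le> (L + 2 * Lam) * dist ?x ?x + 2 * L * \<bar>a + real j * h - (a + s)\<bar>"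
        unfolding G_def G'_def by (rule evi_rhs_diff[OF xb xb p t2 t1])
      also have "\<dots> \<le> 2 * L * h" using sj L1 by auto
      finally have GG: "G - G' \<le> 2 * L * h" .
      have "(t - s) * (G - G') \<le> (t - s) * (2 * L * h)" using GG st by (intro mult_left_mono) auto
      also have "\<dots> \<le> 1 * (2 * L * h)" using st T1 h L1 by (intro mult_right_mono) auto
      finally have tsG: "(t - s) * G \<le> (t - s) * G' + 2 * L * h" by (simp add: algebra_simps)
      have "(m - (t - s)) * G \<le> \<bar>m - (t - s)\<bar> * \<bar>G\<bar>" by (metis abs_ge_self abs_mult)
      also have "\<dots> \<le> h * M_c"
        using mts abs_evi_rhs_le[OF xb p t1] h by (intro mult_mono) (auto simp: G_def abs_le_iff)
      finally have mG: "m * G \<le> (t - s) * G + M_c * h" by (simp add: algebra_simps)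
      \<comment> \<open>The factor 2 in \<open>approx_evi\<close> is spent here: the square of the
        rounded time is at most twice the true square plus \<open>2 * h\<^sup>2\<close>, and
        \<open>h \<le> 1\<close> makes the remainder linear in \<open>h\<close>.\<close>
      have "m\<^sup>2 \<le> ((t - s) + h)\<^sup>2" using mts m0 by (intro power_mono)
      also have "\<dots> \<le> 2 * (t - s)\<^sup>2 + 2 * h\<^sup>2"
        using zero_le_power2[of "(t - s) - h"] by (simp add: power2_eq_square algebra_simps)
      also have "h\<^sup>2 \<le> h" using h h1 mult_left_mono[of h 1 h] by (simp add: power2_eq_square)
      finally have "m\<^sup>2 \<le> 2 * (t - s)\<^sup>2 + 2 * h" by simp
      then have "(E_c + Cst) * m\<^sup>2 \<le> (E_c + Cst) * (2 * (t - s)\<^sup>2 + 2 * h)"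
        using E_c0 Cst0 by (intro mult_left_mono) auto
      then have m2: "(E_c + Cst) * m\<^sup>2 \<le> 2 * (E_c + Cst) * (t - s)\<^sup>2 + 2 * (E_c + Cst) * h" by (simp add: algebra_simps)
      have "\<phi> (dist (grid h k) p) \<le> \<phi> (dist ?x p) + m * G + (E_c + Cst) * m\<^sup>2"
        using grid_evi[OF h p kT] by (simp add: m_def G_def k)
      moreover have "A_h * h = 10 * L * h + M_c * h + 2 * (E_c + Cst) * h" by (simp add: A_h_def algebra_simps)
      moreover have "2 * L * h \<le> 10 * L * h" using h L1 by simp
      ultimately show ?thesis using tsG mG m2 unfolding G'_def by linarith
    qed
    ultimately show ?thesis unfolding j_def[symmetric] k_def[symmetric] by auto
  qed
  show ?thesis
  proof (rule approx_eviI)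
    show "dist p0 (grid h (nat \<lfloor>t / h\<rfloor>)) \<le> r / 4" if "0 \<le> t" "t \<le> T" for t
      by (rule grid_in_ball(1)[OF h order_trans[OF fl(1)[OF that(1)] that(2)]])
    show "grid h (nat \<lfloor>0 / h\<rfloor>) = p0" by simp
  qed (simp_all only: main)
qed

lemma approx_evi_exists:
  assumes "\<eta> > 0" shows "\<exists>X. approx_evi \<eta> X"
proof -
  have A: "A_h > 0" using L1 M_c0 E_c0 Cst0 by (simp add: A_h_def)
  define h where "h = min (\<eta> / A_h) (min (r / (40 * L)) (1 / (8 * c + 1)))"
  have h0: "h > 0" using assms A r0 L1 c0 by (simp add: h_def)
  have "h \<le> r / (40 * L)" by (simp add: h_def)
  then have h1: "40 * L * h \<le> r" using L1 by (simp add: field_simps)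
  have "h \<le> 1 / (8 * c + 1)" by (simp add: h_def)
  then have "h * (8 * c + 1) \<le> 1" using c0 by (simp add: field_simps)
  then have h2: "8 * c * h \<le> 1" using h0 by (simp add: algebra_simps)
  have "h \<le> \<eta> / A_h" by (simp add: h_def)
  then have "A_h * h \<le> \<eta>" using A by (simp add: field_simps)
  then show ?thesis using approx_evi_mono[OF approx_evi_grid[OF h0 h1 h2]] by blast
qed

text \<open>Collected from one comparison step: displacement of the test point from
  \<open>X s\<close> to \<open>X (s + \<delta>)\<close>, two quadratic errors
  \<open>2 * (E_c + Cst)\<close>, and \<open>2 * \<eta> \<le> 2 * \<delta>\<^sup>2\<close>.\<close>

definition A_d :: real where "A_d = (L + 2 * Lam) * (8 * L + 1) + 4 * (E_c + Cst) + 2"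

lemma A_d0: "0 \<le> A_d" using L1 Lam0 E_c0 Cst0 by (simp add: A_d_def)

text \<open>Test the inequality for \<open>X\<close> with \<open>p = Y s\<close> and the one for \<open>Y\<close> with \<open>p = X (s + \<delta>)\<close>: the values of \<open>f\<close>
  cancel up to order \<open>\<delta>\<close>.\<close>
lemma approx_evi_compare_step:
  assumes X: "approx_evi \<eta> X" and Y: "approx_evi \<eta> Y"
    and s: "0 \<le> s" "s + \<delta> \<le> T" and \<delta>: "0 < \<delta>" and \<eta>: "\<eta> \<le> \<delta>\<^sup>2"
  shows "\<phi> (dist (X (s + \<delta>)) (Y (s + \<delta>))) \<le> (1 + 2 * Lam * \<delta>) * \<phi> (dist (X s) (Y s)) + A_d * \<delta>\<^sup>2"
proof -
  define x y x' y' where "x = X s" and "y = Y s" and "x' = X (s + \<delta>)" and "y' = Y (s + \<delta>)"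
  have b: "x \<in> ball p0 r" "y \<in> ball p0 r" "x' \<in> ball p0 r" "y' \<in> ball p0 r"
    using s \<delta> unfolding x_def y_def x'_def y'_def
    by (auto simp del: mem_ball intro!: approx_evi_near(2)[OF X] approx_evi_near(2)[OF Y])
  have t: "a + s \<in> {a..<a+\<tau>}" using s \<delta> Ttau by auto
  have \<delta>1: "\<delta> \<le> 1" using s T1 by linarith
  then have "\<delta>\<^sup>2 \<le> \<delta>" using \<delta> mult_left_mono[of \<delta> 1 \<delta>] by (simp add: power2_eq_square)
  then have \<eta>1: "\<eta> \<le> \<delta>" using \<eta> by linarith
  have 1: "\<phi> (dist x' y) \<le> \<phi> (dist x y) + \<delta> * evi_rhs (a + s) x y + 2 * (E_c + Cst) * \<delta>\<^sup>2 + \<eta>"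
    using approx_evi_evi[OF X, of s "s + \<delta>" y] s \<delta> b by (simp add: x_def x'_def)
  have 2: "\<phi> (dist y' x') \<le> \<phi> (dist y x') + \<delta> * evi_rhs (a + s) y x' + 2 * (E_c + Cst) * \<delta>\<^sup>2 + \<eta>"
    using approx_evi_evi[OF Y, of s "s + \<delta>" x'] s \<delta> b by (simp add: y_def y'_def)
  have "dist x x' \<le> 8 * L * \<delta> + \<eta>"
    using approx_evi_lip[OF X, of s "s + \<delta>"] s \<delta> by (simp add: x_def x'_def)
  then have dx: "dist x x' \<le> (8 * L + 1) * \<delta>" using \<eta>1 by (simp add: algebra_simps)
  have rhs: "evi_rhs (a + s) x y + evi_rhs (a + s) y x' \<le> 2 * Lam * \<phi> (dist x y) + (L + 2 * Lam) * ((8 * L + 1) * \<delta>)"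
  proof -
    have "f (a+s) x - f (a+s) x' \<le> L * dist x x'" using lip_space[OF b(1,3) t] by (simp add: abs_le_iff)
    moreover have "Lam * (\<phi> (dist y x') - \<phi> (dist x y)) \<le> Lam * (2 * dist x x')"
    proof (rule mult_left_mono[OF _ Lam0])
      have "\<phi> (dist y x') - \<phi> (dist x y) \<le> 2 * \<bar>dist y x' - dist x y\<bar>"
        using dist_in_ball_R b by (intro phi_diff_le) auto
      also have "\<dots> \<le> 2 * dist x x'" using abs_dist_diff_le[of x' y x] by (simp add: dist_commute)
      finally show "\<phi> (dist y x') - \<phi> (dist x y) \<le> 2 * dist x x'" .
    qed
    ultimately have "evi_rhs (a + s) x y + evi_rhs (a + s) y x' \<le> 2 * Lam * \<phi> (dist x y) + (L + 2 * Lam) * dist x x'"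
      by (simp add: evi_rhs_def algebra_simps)
    also have "(L + 2 * Lam) * dist x x' \<le> (L + 2 * Lam) * ((8 * L + 1) * \<delta>)"
      using dx L1 Lam0 by (intro mult_left_mono) auto
    finally show ?thesis by simp
  qed
  have "\<phi> (dist x' y') \<le> \<phi> (dist x y) + \<delta> * (evi_rhs (a + s) x y + evi_rhs (a + s) y x') + 4 * (E_c + Cst) * \<delta>\<^sup>2 + 2 * \<delta>\<^sup>2"
    using 1 2 \<eta> by (simp add: dist_commute algebra_simps)
  also have "\<delta> * (evi_rhs (a + s) x y + evi_rhs (a + s) y x')
      \<le> \<delta> * (2 * Lam * \<phi> (dist x y) + (L + 2 * Lam) * ((8 * L + 1) * \<delta>))"
    using rhs \<delta> by (intro mult_left_mono) auto
  finally show ?thesis unfolding x_def y_def x'_def y'_def A_d_def by (simp add: algebra_simps power2_eq_square)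
qed

text \<open>Discrete Gronwall argument: \<open>N\<close> steps with local error
  \<open>A_d * \<delta>\<^sup>2\<close> and \<open>\<delta> = t / real N\<close> leave an error of
  order 1/N. The step \<delta> belongs to the comparison alone and is unrelated to the step sizes
  \<open>h\<close> that produced the two curves.\<close>

lemma approx_evi_compare:
  assumes X: "approx_evi \<eta> X" and Y: "approx_evi \<eta> Y"
    and t: "0 < t" "t \<le> T" and N: "0 < N" and \<eta>: "\<eta> \<le> (t / real N)\<^sup>2"
  shows "(dist (X t) (Y t))\<^sup>2 \<le> 8 * A_d * exp (2 * Lam) / real N"
proof -
  define \<delta> where "\<delta> = t / real N"
  have \<delta>: "\<delta> > 0" "real N * \<delta> = t" using t N by (auto simp: \<delta>_def)
  have "i \<le> N \<Longrightarrow> \<phi> (dist (X (real i * \<delta>)) (Y (real i * \<delta>))) \<le> real i * A_d * \<delta>\<^sup>2 * exp (2 * Lam * (real i * \<delta>))" for i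
  proof (induction i)
    case 0
    then show ?case using approx_evi_start[OF X] approx_evi_start[OF Y] by (simp add: phi_0)
  next
    case (Suc i)
    define u where "u = \<phi> (dist (X (real i * \<delta>)) (Y (real i * \<delta>)))"
    define e where "e = exp (2 * Lam * (real i * \<delta>))"
    have e1: "e \<ge> 1" using Lam0 \<delta> by (simp add: e_def)
    have "real (Suc i) * \<delta> \<le> real N * \<delta>" using Suc.prems \<delta> by (intro mult_right_mono) auto
    then have T: "real i * \<delta> + \<delta> \<le> T" using \<delta> t by (simp add: algebra_simps)
    have "\<phi> (dist (X (real i * \<delta> + \<delta>)) (Y (real i * \<delta> + \<delta>))) \<le> (1 + 2 * Lam * \<delta>) * u + A_d * \<delta>\<^sup>2"
      unfolding u_def using \<delta>(1) T \<eta>[folded \<delta>_def] by (intro approx_evi_compare_step[OF X Y]) simp_all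
    also have "(1 + 2 * Lam * \<delta>) * u \<le> (1 + 2 * Lam * \<delta>) * (real i * A_d * \<delta>\<^sup>2 * e)"
      using Suc Lam0 \<delta> by (intro mult_left_mono) (auto simp: u_def e_def)
    also have "\<dots> \<le> exp (2 * Lam * \<delta>) * (real i * A_d * \<delta>\<^sup>2 * e)"
      using A_d0 e1 by (intro mult_right_mono) auto
    also have "A_d * \<delta>\<^sup>2 \<le> exp (2 * Lam * \<delta>) * (A_d * \<delta>\<^sup>2 * e)"
    proof -
      have "1 * (A_d * \<delta>\<^sup>2 * 1) \<le> exp (2 * Lam * \<delta>) * (A_d * \<delta>\<^sup>2 * e)"
        using A_d0 e1 Lam0 \<delta> by (intro mult_mono) auto
      then show ?thesis by simp
    qed
    finally have "\<phi> (dist (X (real i * \<delta> + \<delta>)) (Y (real i * \<delta> + \<delta>))) \<le> real (Suc i) * A_d * \<delta>\<^sup>2 * (exp (2 * Lam * \<delta>) * e)"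
      by (simp add: algebra_simps)
    moreover have "exp (2 * Lam * \<delta>) * e = exp (2 * Lam * (real (Suc i) * \<delta>))"
      by (simp add: e_def exp_add[symmetric] algebra_simps)
    moreover have "real i * \<delta> + \<delta> = real (Suc i) * \<delta>" by (simp add: algebra_simps)
    ultimately show ?case by (metis (no_types, lifting))
  qed
  from this[of N] have u: "\<phi> (dist (X t) (Y t)) \<le> real N * A_d * \<delta>\<^sup>2 * exp (2 * Lam * t)" using \<delta> by simp
  have "real N * A_d * \<delta>\<^sup>2 * exp (2 * Lam * t) = A_d * (t\<^sup>2 * exp (2 * Lam * t)) / real N"
    using N by (simp add: \<delta>_def power2_eq_square)
  also have "\<dots> \<le> A_d * (1 * exp (2 * Lam)) / real N"
    using A_d0 t T1 Lam0 by (intro divide_right_mono mult_left_mono mult_mono) (auto simp: power_le_one mult_left_le)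
  finally have "\<phi> (dist (X t) (Y t)) \<le> A_d * exp (2 * Lam) / real N" using u by simp
  moreover have "dist (X t) (Y t) \<le> R"
    using t by (intro dist_in_ball_R approx_evi_near(2)[OF X] approx_evi_near(2)[OF Y]) auto
  then have "(dist (X t) (Y t))\<^sup>2 / 8 \<le> \<phi> (dist (X t) (Y t))" by (intro phi_ge) auto
  ultimately show ?thesis by simp
qed

lemma evi_curve_exists: "\<exists>\<alpha>. approx_evi 0 \<alpha>"
proof -
  have "\<forall>n. \<exists>X. approx_evi (inverse (real (Suc n))) X" by (intro allI approx_evi_exists) simp
  then obtain X where X: "\<And>n. approx_evi (inverse (real (Suc n))) (X n)" by metis
  have cau: "Cauchy (\<lambda>n. X n t)" if t: "0 \<le> t" "t \<le> T" for t
  proof (cases "t = 0")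
    case True
    then have "(\<lambda>n. X n t) = (\<lambda>n. p0)" using approx_evi_start[OF X] by auto
    then show ?thesis by (metis convergent_Cauchy convergent_const)
  next
    case False
    then have t0: "0 < t" using t by simp
    show ?thesis
    proof (rule metric_CauchyI)
      fix e :: real assume "e > 0"
      \<comment> \<open>\<open>N\<close> is fixed first by the wanted accuracy; only then is the
        tolerance taken below \<open>(t / real N)\<^sup>2\<close>, which is positive because
        \<open>t > 0\<close>.\<close>
      obtain N0 where N0: "8 * A_d * exp (2 * Lam) / e\<^sup>2 < real N0" using reals_Archimedean2 by blast
      define N where "N = Suc N0"
      have N: "0 < N" "8 * A_d * exp (2 * Lam) / e\<^sup>2 < real N" using N0 by (auto simp: N_def)
      have Ne: "8 * A_d * exp (2 * Lam) / real N < e\<^sup>2"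
        using N \<open>e > 0\<close> by (simp add: field_simps)
      have "(t / real N)\<^sup>2 > 0" using t0 N by simp
      then obtain M where M: "inverse (real (Suc M)) < (t / real N)\<^sup>2" using reals_Archimedean by blast
      show "\<exists>M. \<forall>m\<ge>M. \<forall>n\<ge>M. dist (X m t) (X n t) < e"
      proof (intro exI allI impI)
        fix m n assume mn: "m \<ge> M" "n \<ge> M"
        have "approx_evi (inverse (real (Suc M))) (X m)" "approx_evi (inverse (real (Suc M))) (X n)"
          using mn by (auto intro!: approx_evi_mono[OF X] le_imp_inverse_le)
        then have "(dist (X m t) (X n t))\<^sup>2 \<le> 8 * A_d * exp (2 * Lam) / real N"
          using t0 t N M by (intro approx_evi_compare) auto
        then have "(dist (X m t) (X n t))\<^sup>2 < e\<^sup>2" using Ne by linarith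
        then show "dist (X m t) (X n t) < e" using \<open>e > 0\<close> by (simp add: power_less_imp_less_base)
      qed
    qed
  qed
  define \<alpha> where "\<alpha> t = lim (\<lambda>n. X n t)" for t
  have lim: "(\<lambda>n. X n t) \<longlonglongrightarrow> \<alpha> t" if "0 \<le> t" "t \<le> T" for t
    unfolding \<alpha>_def using Cauchy_convergent[OF cau[OF that]] by (simp add: convergent_LIMSEQ_iff)
  have inv: "(\<lambda>n. inverse (real (Suc n))) \<longlonglongrightarrow> 0" by (rule LIMSEQ_inverse_real_of_nat)
  have a0: "\<alpha> 0 = p0"
  proof -
    have "(\<lambda>n. X n 0) = (\<lambda>n. p0)" using approx_evi_start[OF X] by auto
    then show ?thesis using lim[of 0] T0 by (simp add: LIMSEQ_const_iff)
  qed
  have near: "dist p0 (\<alpha> t) \<le> r / 4" if t: "0 \<le> t" "t \<le> T" for t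
  proof (rule LIMSEQ_le_const2)
    show "(\<lambda>n. dist p0 (X n t)) \<longlonglongrightarrow> dist p0 (\<alpha> t)" by (intro tendsto_intros lim t)
    show "\<exists>N. \<forall>n\<ge>N. dist p0 (X n t) \<le> r / 4" using approx_evi_near(1)[OF X t] by blast
  qed
  have lips: "dist (\<alpha> s) (\<alpha> t) \<le> 8 * L * (t - s) + 0" if st: "0 \<le> s" "s \<le> t" "t \<le> T" for s t
  proof (rule LIMSEQ_le)
    show "(\<lambda>n. dist (X n s) (X n t)) \<longlonglongrightarrow> dist (\<alpha> s) (\<alpha> t)" using st by (intro tendsto_intros lim) auto
    show "(\<lambda>n. 8 * L * (t - s) + inverse (real (Suc n))) \<longlonglongrightarrow> 8 * L * (t - s) + 0"
      by (intro tendsto_intros inv)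
    show "\<exists>N. \<forall>n\<ge>N. dist (X n s) (X n t) \<le> 8 * L * (t - s) + inverse (real (Suc n))"
      using approx_evi_lip[OF X st] by blast
  qed
  have evi: "\<phi> (dist (\<alpha> t) p) \<le> \<phi> (dist (\<alpha> s) p) + (t - s) * evi_rhs (a + s) (\<alpha> s) p + 2 * (E_c + Cst) * (t - s)\<^sup>2 + 0"
    if st: "0 \<le> s" "s \<le> t" "t \<le> T" and p: "p \<in> ball p0 r" for s t p
  proof (rule LIMSEQ_le)
    have sT: "s \<le> T" "0 \<le> t" using st by auto
    have phil: "(\<lambda>n. \<phi> (dist (X n u) p)) \<longlonglongrightarrow> \<phi> (dist (\<alpha> u) p)" if "0 \<le> u" "u \<le> T" for u
      by (intro isCont_tendsto_compose[OF isCont_phi] tendsto_intros lim that)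
    have "(\<lambda>n. f (a + s) (X n s)) \<longlonglongrightarrow> f (a + s) (\<alpha> s)"
    proof (rule metric_tendsto_imp_tendsto)
      show "(\<lambda>n. L *\<^sub>R dist (X n s) (\<alpha> s)) \<longlonglongrightarrow> 0"
        using tendsto_scaleR[OF tendsto_const[of L] tendsto_dist[OF lim[OF st(1) sT(1)] tendsto_const[of "\<alpha> s"]]] by simp
      have "X n s \<in> ball p0 r" for n by (rule approx_evi_near(2)[OF X st(1) sT(1)])
      moreover have "\<alpha> s \<in> ball p0 r" using near[OF st(1) sT(1)] r0 by simp
      moreover have "a + s \<in> {a..<a+\<tau>}" using st Ttau by simp
      ultimately show "\<forall>\<^sub>F n in sequentially. dist (f (a + s) (X n s)) (f (a + s) (\<alpha> s)) \<le> dist (L *\<^sub>R dist (X n s) (\<alpha> s)) 0"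
        using lip_space L1 by (simp add: dist_real_def abs_mult)
    qed
    then show "(\<lambda>n. \<phi> (dist (X n s) p) + (t - s) * evi_rhs (a + s) (X n s) p + 2 * (E_c + Cst) * (t - s)\<^sup>2 + inverse (real (Suc n)))
        \<longlonglongrightarrow> \<phi> (dist (\<alpha> s) p) + (t - s) * evi_rhs (a + s) (\<alpha> s) p + 2 * (E_c + Cst) * (t - s)\<^sup>2 + 0"
      unfolding evi_rhs_def using st sT by (intro tendsto_intros phil inv) auto
    show "(\<lambda>n. \<phi> (dist (X n t) p)) \<longlonglongrightarrow> \<phi> (dist (\<alpha> t) p)" using st by (intro phil) auto
    show "\<exists>N. \<forall>n\<ge>N. \<phi> (dist (X n t) p) \<le> \<phi> (dist (X n s) p) + (t - s) * evi_rhs (a + s) (X n s) p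
        + 2 * (E_c + Cst) * (t - s)\<^sup>2 + inverse (real (Suc n))"
      using approx_evi_evi[OF X st p] by blast
  qed
  have "approx_evi 0 \<alpha>" by (rule approx_eviI[OF a0 near lips evi])
  then show ?thesis by blast
qed

end

section \<open>Gradient curves: characterisation and local uniqueness\<close>

lemma real_interval_induct:
  fixes u v :: real
  assumes uv: "u \<le> v" and cl: "closed {t\<in>{u..v}. P t}" and base: "P u"
    and step: "\<And>t. u \<le> t \<Longrightarrow> t < v \<Longrightarrow> P t \<Longrightarrow> \<exists>d>0. \<forall>s\<in>{t<..<t+d}. P s"
  shows "P v"
proof -
  \<comment> \<open>Induction over the reals: \<open>w\<close> is the supremum of the times up to
    which \<open>P\<close> holds. Closedness carries \<open>P\<close> to \<open>w\<close>, and the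
    hypothesis \<open>step\<close> would move beyond \<open>w\<close> unless
    \<open>w = v\<close>.\<close>
  define Z where "Z = {t\<in>{u..v}. \<forall>s\<in>{u..t}. P s}"
  have uZ: "u \<in> Z" using uv base by (auto simp: Z_def)
  have bd: "bdd_above Z" by (auto simp: Z_def intro!: bdd_aboveI[of _ v])
  define w where "w = Sup Z"
  have uw: "u \<le> w" unfolding w_def using uZ bd by (rule cSup_upper)
  have wv: "w \<le> v" unfolding w_def using uZ by (intro cSup_least) (auto simp: Z_def)
  have below: "P s" if sw: "u \<le> s" "s < w" for s
  proof -
    obtain t where "t \<in> Z" "s < t" using less_cSup_iff[of Z s] uZ bd sw(2) unfolding w_def by blast
    then show ?thesis using sw by (auto simp: Z_def)
  qed
  have "P w"
  proof (cases "w = u")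
    case False
    then have "u < w" using uw by simp
    define x where "x n = w - (w - u) * inverse (real (Suc n))" for n
    have "x \<longlonglongrightarrow> w - (w - u) * 0"
      unfolding x_def by (intro tendsto_intros LIMSEQ_inverse_real_of_nat)
    then have "x \<longlonglongrightarrow> w" by simp
    moreover have "x n \<in> {t\<in>{u..v}. P t}" for n
    proof -
      have "inverse (real (Suc n)) \<le> 1" "inverse (real (Suc n)) > 0" by (auto simp: field_simps)
      then have "(w - u) * inverse (real (Suc n)) \<le> (w - u) * 1" "(w - u) * inverse (real (Suc n)) > 0"
        using \<open>u < w\<close> by (auto intro!: mult_left_mono mult_pos_pos)
      then have "u \<le> x n" "x n < w" by (auto simp: x_def)
      then show ?thesis using below wv by auto
    qed
    ultimately have "w \<in> {t\<in>{u..v}. P t}" using closed_sequentially[OF cl] by blast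
    then show ?thesis by simp
  qed (use base in simp)
  show ?thesis
  proof (cases "w = v")
    case False
    then have "w < v" using wv by simp
    then obtain d where d: "d > 0" "\<forall>s\<in>{w<..<w+d}. P s" using step[OF uw _ \<open>P w\<close>] by blast
    define w' where "w' = min v (w + d / 2)"
    have w': "w < w'" "w' \<le> v" "w' < w + d" using d \<open>w < v\<close> by (auto simp: w'_def)
    have "P s" if "s \<in> {u..w'}" for s
      using that below[of s] \<open>P w\<close> d w' by (cases s w rule: linorder_cases) auto
    then have "w' \<in> Z" using w' uw by (auto simp: Z_def)
    then have "w' \<le> w" unfolding w_def using bd by (intro cSup_upper)
    then show ?thesis using w' by simp
  qed (use \<open>P w\<close> in simp)
qed

text \<open>Only the upper right derivative is controlled, so the mean value theorem is replaced by
  interval induction. With the enlarged slope \<open>k + e'\<close> the hypothesis becomes an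
  inequality on a whole right neighbourhood, which is the induction step.\<close>

lemma le_of_right_dini_le:
  fixes g :: "real \<Rightarrow> real"
  assumes uv: "u \<le> v" and cont: "continuous_on {u..v} g"
    and dini: "\<And>t e. u \<le> t \<Longrightarrow> t < v \<Longrightarrow> e > 0 \<Longrightarrow> eventually (\<lambda>\<epsilon>. g (t + \<epsilon>) \<le> g t + \<epsilon> * (k + e)) (at_right 0)"
  shows "g v \<le> g u + k * (v - u)"
proof (rule field_le_epsilon)
  fix e :: real assume "e > 0"
  define e' where "e' = e / (v - u + 1)"
  have e': "e' > 0" using \<open>e > 0\<close> uv by (simp add: e'_def)
  have "g v \<le> g u + (k + e') * (v - u)"
  proof (rule real_interval_induct[OF uv, where P = "\<lambda>t. g t \<le> g u + (k + e') * (t - u)"])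
    have "closed ({u..v} \<inter> (\<lambda>t. g t - (g u + (k + e') * (t - u))) -` {..0})"
      by (intro continuous_closed_preimage continuous_intros cont closed_atMost closed_atLeastAtMost)
    then show "closed {t \<in> {u..v}. g t \<le> g u + (k + e') * (t - u)}"
      by (rule back_subst[of closed]) auto
  next
    show "g u \<le> g u + (k + e') * (u - u)" by simp
  next
    fix t assume t: "u \<le> t" "t < v" and P: "g t \<le> g u + (k + e') * (t - u)"
    from dini[OF t e'] obtain d where d: "d > 0" "\<And>\<epsilon>. 0 < \<epsilon> \<Longrightarrow> \<epsilon> < d \<Longrightarrow> g (t + \<epsilon>) \<le> g t + \<epsilon> * (k + e')"
      unfolding eventually_at_right_field by auto
    have "g s \<le> g u + (k + e') * (s - u)" if "s \<in> {t<..<t+d}" for s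
      using d(2)[of "s - t"] that P by (simp add: algebra_simps)
    with d(1) show "\<exists>d>0. \<forall>s\<in>{t<..<t+d}. g s \<le> g u + (k + e') * (s - u)" by blast
  qed
  also have "\<dots> = g u + k * (v - u) + e' * (v - u)" by (simp add: algebra_simps)
  also have "e' * (v - u) \<le> e" using \<open>e > 0\<close> uv by (simp add: e'_def field_simps)
  finally show "g v \<le> g u + k * (v - u) + e" by simp
qed

text \<open>The mechanism behind right derivatives of concave functions: a bounded monotone quotient
  tends to its supremum.\<close>

lemma tendsto_at_right_of_antimono:
  fixes q :: "real \<Rightarrow> real"
  assumes "l > 0" and anti: "\<And>s s'. 0 < s \<Longrightarrow> s \<le> s' \<Longrightarrow> s' \<le> l \<Longrightarrow> q s' \<le> q s"
    and bd: "\<And>s. 0 < s \<Longrightarrow> s \<le> l \<Longrightarrow> q s \<le> M"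
  shows "\<exists>D. (q \<longlongrightarrow> D) (at_right 0) \<and> q l \<le> D"
proof -
  define D where "D = (SUP s\<in>{0<..l}. q s)"
  have bdd: "bdd_above (q ` {0<..l})" using bd by (auto intro!: bdd_aboveI)
  have up: "q s \<le> D" if "0 < s" "s \<le> l" for s
    unfolding D_def using that bdd by (intro cSUP_upper) auto
  have "(q \<longlongrightarrow> D) (at_right 0)"
  proof (rule order_tendstoI)
    fix y assume "y < D"
    then obtain s where s: "0 < s" "s \<le> l" "y < q s"
      using less_cSUP_iff[of "{0<..l}" q y] bdd \<open>l > 0\<close> by (auto simp: D_def)
    have "eventually (\<lambda>u. u \<in> {0<..<s}) (at_right 0)" using s by (intro eventually_at_right_real) auto
    then show "eventually (\<lambda>u. y < q u) (at_right 0)"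
    proof eventually_elim
      case (elim u)
      then have "q s \<le> q u" using s by (intro anti) auto
      then show ?case using s by linarith
    qed
  next
    fix y assume "D < y"
    have "eventually (\<lambda>u. u \<in> {0<..<l}) (at_right 0)" using \<open>l > 0\<close> by (intro eventually_at_right_real) auto
    then show "eventually (\<lambda>u. q u < y) (at_right 0)"
    proof eventually_elim
      case (elim u)
      then have "q u \<le> D" by (intro up) auto
      then show ?case using \<open>D < y\<close> by linarith
    qed
  qed
  then show ?thesis using up[of l] \<open>l > 0\<close> by auto
qed

section \<open>Local uniqueness of gradient curves\<close>

context local_flow
begin

text \<open>Semiconcavity makes \<open>(f t (\<gamma> s) - f t x) / s - c / 2 * s\<close>
  nonincreasing in \<open>s\<close>, and the Lipschitz bound caps it, so the limit at 0 exists and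
  is at least the value at the far end. Endpoints in the half ball keep the geodesic inside
  \<open>ball p0 r\<close>.\<close>

lemma dir_deriv_exists:
  assumes x: "x \<in> ball p0 (r/2)" and y: "y \<in> ball p0 (r/2)" and "x \<noteq> y" and t: "t \<in> {a..<a+\<tau>}"
    and \<gamma>: "geodesic_seg \<gamma> x y"
  shows "\<exists>D. ((\<lambda>s. (f t (\<gamma> s) - f t x) / s) \<longlongrightarrow> D) (at_right 0) \<and>
    D * dist x y \<ge> f t y - f t x - c / 2 * (dist x y)\<^sup>2"
proof -
  define l where "l = dist x y"
  have l0: "l > 0" using \<open>x \<noteq> y\<close> by (simp add: l_def)
  have xb: "x \<in> ball p0 r" using x r0 by auto
  have lr: "l < r" using x y dist_triangle3[of x y p0] by (auto simp: l_def)
  have \<gamma>b: "\<gamma> s \<in> ball p0 r" if s: "0 \<le> s" "s \<le> l" for s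
  proof -
    have "dist x (\<gamma> s) = s" "dist y (\<gamma> s) = l - s"
      using geodesic_seg_dist_start[OF \<gamma>, of s] geodesic_seg_dist_end[OF \<gamma>, of s] s by (auto simp: l_def)
    then have "dist p0 (\<gamma> s) \<le> dist p0 x + s" "dist p0 (\<gamma> s) \<le> dist p0 y + (l - s)"
      using dist_triangle[of p0 "\<gamma> s" x] dist_triangle[of p0 "\<gamma> s" y] by auto
    then show ?thesis using x y lr by auto
  qed
  define b where "b = c / 2"
  define F where "F s = f t (\<gamma> s) - f t x" for s
  define q where "q s = F s / s - b * s" for s
  have anti: "q s' \<le> q s" if s: "0 < s" "s \<le> s'" "s' \<le> l" for s s'
  proof -
    have g: "geodesic_seg \<gamma> x (\<gamma> s')" using geodesic_seg_initial[OF \<gamma>, of s'] s by (auto simp: l_def)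
    have d: "dist x (\<gamma> s') = s'" using geodesic_seg_dist_start[OF \<gamma>, of s'] s by (auto simp: l_def)
    \<comment> \<open>Concavity along the initial piece of length \<open>s'\<close>, to be divided
      by \<open>s * s'\<close>.\<close>
    have "(s' - s) * f t x + s * f t (\<gamma> s') - b * s * (s' - s) * s' \<le> s' * f t (\<gamma> s)"
      using conc[OF xb \<gamma>b t g, of s] s unfolding d b_def by simp
    then have "s * F s' - b * s * (s' - s) * s' \<le> s' * F s" by (simp add: F_def algebra_simps)
    then have "(s * F s' - b * s * (s' - s) * s') / (s * s') \<le> s' * F s / (s * s')"
      using s by (intro divide_right_mono) auto
    moreover have "(s * F s' - b * s * (s' - s) * s') / (s * s') = F s' / s' - b * (s' - s)"
      using s by (simp add: field_simps)
    moreover have "s' * F s / (s * s') = F s / s" using s by simp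
    ultimately show ?thesis by (simp add: q_def algebra_simps)
  qed
  have bd: "q s \<le> L" if s: "0 < s" "s \<le> l" for s
  proof -
    have "F s \<le> L * dist x (\<gamma> s)"
      using lip_space[OF xb \<gamma>b t, of s] s by (simp add: F_def abs_le_iff)
    then have "F s \<le> L * s" using geodesic_seg_dist_start[OF \<gamma>, of s] s by (simp add: l_def)
    then have "F s / s \<le> L" using s by (simp add: field_simps)
    moreover have "b * s \<ge> 0" using c0 s by (simp add: b_def)
    ultimately show ?thesis by (simp add: q_def)
  qed
  obtain D where D: "(q \<longlongrightarrow> D) (at_right 0)" "q l \<le> D"
    using tendsto_at_right_of_antimono[of l q L] l0 anti bd by blast
  have "((\<lambda>s. q s + b * s) \<longlongrightarrow> D + b * 0) (at_right 0)"
    by (intro tendsto_intros D)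
  then have "((\<lambda>s. F s / s) \<longlongrightarrow> D) (at_right 0)" by (simp add: q_def)
  moreover have "f t y - f t x - c / 2 * l\<^sup>2 \<le> D * l"
  proof -
    have "\<gamma> l = y" using \<gamma> by (simp add: geodesic_seg_def l_def)
    then have "q l * l = f t y - f t x - c / 2 * l\<^sup>2"
      using l0 by (simp add: q_def F_def b_def field_simps power2_eq_square)
    moreover have "q l * l \<le> D * l" using D l0 by (intro mult_right_mono) auto
    ultimately show ?thesis by simp
  qed
  ultimately show ?thesis unfolding F_def l_def by blast
qed

text \<open>The endpoint \<open>m\<close> affects \<open>has_dir_deriv\<close> only through the set
  of admissible \<open>s\<close>, so the same \<open>D\<close> serves for the geodesic cut off at
  the midpoint.\<close>

lemma has_dir_deriv_initial:
  assumes "((\<lambda>s. (f t (\<gamma> s) - f t x) / s) \<longlongrightarrow> D) (at_right 0)"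
  shows "has_dir_deriv (f t) \<gamma> x m D"
  unfolding has_dir_deriv_def by (rule tendsto_mono[OF at_le assms]) auto

text \<open>Both curves are compared with the midpoint of the geodesic joining them, so that no curvature bound is used.\<close>
lemma gradient_curves_dini:
  assumes \<alpha>: "gradient_curve f \<Omega> \<alpha> I" and \<beta>: "gradient_curve f \<Omega> \<beta> I" and tI: "t \<in> I"
    and t: "t \<in> {a..<a+\<tau>}" and b: "\<alpha> t \<in> ball p0 (r/2)" "\<beta> t \<in> ball p0 (r/2)" and ne: "\<alpha> t \<noteq> \<beta> t" and "e > 0"
  shows "eventually (\<lambda>\<epsilon>. dist (\<alpha> (t + \<epsilon>)) (\<beta> (t + \<epsilon>)) \<le>
    dist (\<alpha> t) (\<beta> t) + \<epsilon> * (c * dist (\<alpha> t) (\<beta> t) + e)) (at_right 0)"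
proof -
  define x y where "x = \<alpha> t" and "y = \<beta> t"
  define l where "l = dist x y"
  have l0: "l > 0" using ne by (simp add: l_def x_def y_def)
  have bb: "x \<in> ball p0 r" "y \<in> ball p0 r" using b r0 by (auto simp: x_def y_def)
  obtain \<gamma> where \<gamma>: "geodesic_seg \<gamma> x y" using geodesic_exists dist_in_ball_R[OF bb] by blast
  define \<gamma>' where "\<gamma>' = (\<lambda>s. \<gamma> (l - s))"
  have \<gamma>': "geodesic_seg \<gamma>' y x" using geodesic_seg_reverse[OF \<gamma>] by (simp add: \<gamma>'_def l_def)
  define m where "m = \<gamma> (l / 2)"
  have m': "\<gamma>' (l / 2) = m" by (simp add: m_def \<gamma>'_def)
  have yx: "dist y x = l" by (simp add: l_def dist_commute)
  have g1: "geodesic_seg \<gamma> x m" using geodesic_seg_initial[OF \<gamma>, of "l/2"] l0 by (simp add: m_def l_def)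
  have g2: "geodesic_seg \<gamma>' y m" using geodesic_seg_initial[OF \<gamma>', of "l/2"] l0 by (simp add: m' yx)
  have d1: "dist m x = l / 2" using geodesic_seg_dist_start[OF \<gamma>, of "l/2"] l0 by (simp add: m_def l_def dist_commute)
  have d2: "dist m y = l / 2" using geodesic_seg_dist_end[OF \<gamma>, of "l/2"] l0 by (simp add: m_def l_def dist_commute)
  obtain D1 where D1: "((\<lambda>s. (f t (\<gamma> s) - f t x) / s) \<longlongrightarrow> D1) (at_right 0)"
    "D1 * l \<ge> f t y - f t x - c / 2 * l\<^sup>2"
    using dir_deriv_exists[OF _ _ _ t \<gamma>] b ne by (auto simp: x_def y_def l_def)
  obtain D2 where D2: "((\<lambda>s. (f t (\<gamma>' s) - f t y) / s) \<longlongrightarrow> D2) (at_right 0)"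
    "D2 * l \<ge> f t x - f t y - c / 2 * l\<^sup>2"
    using dir_deriv_exists[OF _ _ _ t \<gamma>'] b ne yx by (auto simp: x_def y_def)
  \<comment> \<open>The values of \<open>f t\<close> cancel in the sum; this is where semiconcavity
    limits the growth of the distance.\<close>
  have "(D1 + D2) * l \<ge> (- c * l) * l" using D1(2) D2(2) by (simp add: algebra_simps power2_eq_square)
  then have D12: "D1 + D2 \<ge> - c * l" using mult_le_cancel_right_pos[OF l0] by blast
  have "m \<noteq> x" "m \<noteq> y" using d1 d2 l0 by auto
  then have "eventually (\<lambda>\<epsilon>. dist m (\<alpha> (t + \<epsilon>)) \<le> dist m x - \<epsilon> * D1 + e / 2 * \<epsilon>) (at_right 0)"
    "eventually (\<lambda>\<epsilon>. dist m (\<beta> (t + \<epsilon>)) \<le> dist m y - \<epsilon> * D2 + e / 2 * \<epsilon>) (at_right 0)"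
    using \<alpha> \<beta> tI g1 g2 has_dir_deriv_initial[OF D1(1)] has_dir_deriv_initial[OF D2(1)] \<open>e > 0\<close>
    unfolding gradient_curve_def x_def y_def by (meson half_gt_zero)+
  moreover have "eventually (\<lambda>\<epsilon>::real. 0 < \<epsilon>) (at_right 0)" by (rule eventually_at_right_less)
  ultimately show ?thesis
  proof eventually_elim
    case (elim \<epsilon>)
    have "dist (\<alpha> (t + \<epsilon>)) (\<beta> (t + \<epsilon>)) \<le> dist m (\<alpha> (t + \<epsilon>)) + dist m (\<beta> (t + \<epsilon>))"
      by (rule dist_triangle3)
    also have "\<dots> \<le> l - \<epsilon> * (D1 + D2) + e * \<epsilon>" using elim d1 d2 by (simp add: algebra_simps)
    also have "\<dots> \<le> l + \<epsilon> * (c * l + e)"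
      using mult_left_mono[OF D12, of \<epsilon>] elim by (simp add: algebra_simps)
    finally show ?case by (simp add: l_def x_def y_def)
  qed
qed

text \<open>The squared distance is used because its upper right derivative vanishes where the curves meet.\<close>
lemma gradient_curves_agree:
  assumes \<alpha>: "gradient_curve f \<Omega> \<alpha> I" and \<beta>: "gradient_curve f \<Omega> \<beta> I"
    and I: "{a..<a+T} \<subseteq> I" "0 < T" and start: "\<alpha> a = p0" "\<beta> a = p0"
  shows "\<exists>d>0. \<forall>t\<in>{a..<a+d}. \<alpha> t = \<beta> t"
proof -
  obtain K1 K2 where K12: "K1-lipschitz_on I \<alpha>" "K2-lipschitz_on I \<beta>"
    using \<alpha> \<beta> unfolding gradient_curve_def by blast
  define K where "K = max K1 K2"
  have K: "K-lipschitz_on {a..<a+T} \<alpha>" "K-lipschitz_on {a..<a+T} \<beta>"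
    using K12 I by (auto simp: K_def intro: lipschitz_on_mono)
  have K0: "K \<ge> 0" using K(1) by (rule lipschitz_on_nonneg)
  \<comment> \<open>The entries keep the times inside the common interval and below
    \<open>a + \<tau>\<close>, keep both curves in the half ball, and give
    \<open>4 * (c * d) \<le> 1\<close> for the absorption at the end.\<close>
  define d where "d = min (T / 2) (min (\<tau> / 2) (min (r / (4 * (K + 1))) (1 / (4 * (c + 1)))))"
  have d0: "d > 0" using I tau0 r0 K0 c0 by (simp add: d_def)
  have dT: "d < T" "d < \<tau>" using I tau0 by (auto simp: d_def)
  have "d \<le> r / (4 * (K + 1))" by (simp add: d_def)
  then have "d * (4 * (K + 1)) \<le> r" using K0 by (simp add: pos_le_divide_eq)
  then have "4 * (K * d) + 4 * d \<le> r" by (simp add: algebra_simps)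
  then have dK: "K * d < r / 2" using d0 K0 r0 by (smt (verit) field_sum_of_halves)
  have "d \<le> 1 / (4 * (c + 1))" by (simp add: d_def)
  then have "d * (4 * (c + 1)) \<le> 1" using c0 by (simp add: pos_le_divide_eq)
  then have dc: "4 * (c * d) \<le> 1" using d0 by (simp add: algebra_simps)
  have lipd: "dist (\<alpha> s) (\<alpha> t) \<le> K * \<bar>t - s\<bar>" "dist (\<beta> s) (\<beta> t) \<le> K * \<bar>t - s\<bar>"
    if "s \<in> {a..a+d}" "t \<in> {a..<a+T}" for s t
    using that dT lipschitz_onD[OF K(1), of s t] lipschitz_onD[OF K(2), of s t]
    by (auto simp: dist_real_def abs_minus_commute)
  have inb: "\<alpha> t \<in> ball p0 (r/2)" "\<beta> t \<in> ball p0 (r/2)" if t: "t \<in> {a..a+d}" for t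
  proof -
    have "K * \<bar>t - a\<bar> \<le> K * d" using t K0 by (intro mult_left_mono) auto
    then show "\<alpha> t \<in> ball p0 (r/2)" "\<beta> t \<in> ball p0 (r/2)"
      using lipd[of a t] t dT d0 dK start by auto
  qed
  define h where "h t = (dist (\<alpha> t) (\<beta> t))\<^sup>2" for t
  have cont: "continuous_on {a..a+d} h"
  proof -
    have "continuous_on {a..a+d} \<alpha>" "continuous_on {a..a+d} \<beta>"
      using K dT by (auto intro!: continuous_on_subset[OF lipschitz_on_continuous_on])
    then show ?thesis unfolding h_def by (intro continuous_intros)
  qed
  obtain t1 where t1: "t1 \<in> {a..a+d}" "\<And>t. t \<in> {a..a+d} \<Longrightarrow> h t \<le> h t1"
    using continuous_attains_sup[OF compact_Icc _ cont] d0 by auto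
  define M where "M = h t1"
  have M0: "M \<ge> 0" by (simp add: M_def h_def)
  have dini: "eventually (\<lambda>\<epsilon>. h (t + \<epsilon>) \<le> h t + \<epsilon> * (2 * c * M + e)) (at_right 0)"
    if t: "a \<le> t" "t < a + d" and "e > 0" for t e
  proof (cases "\<alpha> t = \<beta> t")
    case True
    \<comment> \<open>Where the curves meet, the Lipschitz bounds alone give
      \<open>h (t + \<epsilon>) \<le> (2 * K * \<epsilon>)\<^sup>2\<close>, which is
      o(\<epsilon>).\<close>
    define \<epsilon>0 where "\<epsilon>0 = min (a + T - t) (e / (4 * K\<^sup>2 + 1))"
    have "\<epsilon>0 > 0" using t dT \<open>e > 0\<close> by (simp add: \<epsilon>0_def add_nonneg_pos)
    then have "eventually (\<lambda>\<epsilon>. \<epsilon> \<in> {0<..<\<epsilon>0}) (at_right 0)" by (intro eventually_at_right_real)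
    then show ?thesis
    proof eventually_elim
      case (elim \<epsilon>)
      then have \<epsilon>: "0 < \<epsilon>" "\<epsilon> < a + T - t" "\<epsilon> * (4 * K\<^sup>2 + 1) \<le> e"
        by (auto simp: \<epsilon>0_def pos_less_divide_eq add_nonneg_pos less_imp_le)
      have "dist (\<alpha> (t + \<epsilon>)) (\<beta> (t + \<epsilon>)) \<le> dist (\<alpha> t) (\<alpha> (t + \<epsilon>)) + dist (\<beta> t) (\<beta> (t + \<epsilon>))"
        using dist_triangle3[of "\<alpha> (t + \<epsilon>)" "\<beta> (t + \<epsilon>)" "\<alpha> t"] True by simp
      also have "\<dots> \<le> 2 * K * \<epsilon>" using lipd[of t "t + \<epsilon>"] t \<epsilon> by auto
      finally have "h (t + \<epsilon>) \<le> (2 * K * \<epsilon>)\<^sup>2" unfolding h_def by (intro power_mono) auto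
      also have "\<dots> = \<epsilon> * (\<epsilon> * (4 * K\<^sup>2))" by (simp add: power2_eq_square)
      also have "\<dots> \<le> \<epsilon> * e" using \<epsilon> by (intro mult_left_mono) (auto simp: algebra_simps)
      also have "\<dots> \<le> \<epsilon> * (2 * c * M + e)" using \<epsilon> c0 M0 by (intro mult_left_mono) auto
      finally show ?case using True by (simp add: h_def)
    qed
  next
    case False
    define l where "l = dist (\<alpha> t) (\<beta> t)"
    have l0: "l > 0" using False by (simp add: l_def)
    have lM: "l\<^sup>2 \<le> M" using t1(2)[of t] t by (simp add: M_def h_def l_def)
    \<comment> \<open>Squaring \<open>l + \<epsilon> * W\<close> produces the error terms
      \<open>2 * l * e'\<close> and \<open>\<epsilon> * W\<^sup>2\<close>; each is arranged to be at
      most \<open>e / 2\<close>.\<close>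
    define e' where "e' = e / (4 * l)"
    have e': "e' > 0" "4 * l * e' = e" using \<open>e > 0\<close> l0 by (auto simp: e'_def)
    define W where "W = c * l + e'"
    define \<epsilon>0 where "\<epsilon>0 = e / (2 * (W\<^sup>2 + 1))"
    have W1: "W\<^sup>2 + 1 > 0" by (simp add: add_nonneg_pos)
    have "\<epsilon>0 > 0" using \<open>e > 0\<close> W1 by (simp add: \<epsilon>0_def)
    then have "eventually (\<lambda>\<epsilon>. \<epsilon> \<in> {0<..<\<epsilon>0}) (at_right 0)" by (intro eventually_at_right_real)
    moreover have "eventually (\<lambda>\<epsilon>. dist (\<alpha> (t + \<epsilon>)) (\<beta> (t + \<epsilon>)) \<le> l + \<epsilon> * W) (at_right 0)"
      unfolding l_def W_def using t dT I inb False e'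
      by (intro gradient_curves_dini[OF \<alpha> \<beta>]) auto
    ultimately show ?thesis
    proof eventually_elim
      case (elim \<epsilon>)
      then have "\<epsilon> * (2 * (W\<^sup>2 + 1)) \<le> e" using W1 by (simp add: \<epsilon>0_def pos_less_divide_eq less_imp_le)
      then have eW: "2 * (\<epsilon> * W\<^sup>2) \<le> e" using elim by (simp add: algebra_simps)
      have "h (t + \<epsilon>) \<le> (l + \<epsilon> * W)\<^sup>2" unfolding h_def using elim by (intro power_mono) auto
      also have "\<dots> = l\<^sup>2 + \<epsilon> * (2 * c * l\<^sup>2 + 2 * l * e' + \<epsilon> * W\<^sup>2)"
        by (simp add: W_def power2_eq_square algebra_simps)
      also have "\<dots> \<le> l\<^sup>2 + \<epsilon> * (2 * c * M + e)"
      proof -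
        have "2 * c * l\<^sup>2 \<le> 2 * c * M" using lM c0 by (intro mult_left_mono) auto
        then have "2 * c * l\<^sup>2 + 2 * l * e' + \<epsilon> * W\<^sup>2 \<le> 2 * c * M + e" using eW e' by linarith
        then show ?thesis using elim by (intro add_left_mono mult_left_mono) auto
      qed
      finally show ?case by (simp add: h_def l_def)
    qed
  qed
  \<comment> \<open>In place of an exponential bound the maximum \<open>M\<close> is estimated by
    itself: the growth over a time of at most \<open>d\<close> is at most \<open>M / 2\<close>, so
    \<open>M\<close> vanishes.\<close>
  have "M \<le> h a + 2 * c * M * (t1 - a)" unfolding M_def
    using t1 cont by (intro le_of_right_dini_le) (auto intro: continuous_on_subset dini[unfolded M_def])
  also have "h a = 0" using start by (simp add: h_def)
  also have "2 * c * M * (t1 - a) \<le> 2 * c * M * d" using t1 c0 M0 by (intro mult_left_mono) auto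
  also have "2 * c * M * d \<le> M / 2" using mult_right_mono[OF dc M0] by (simp add: algebra_simps)
  finally have "M \<le> 0" by simp
  then have "h t \<le> 0" if "t \<in> {a..a+d}" for t using t1(2)[OF that] by (simp add: M_def)
  then have "\<alpha> t = \<beta> t" if "t \<in> {a..<a+d}" for t using that by (simp add: h_def)
  then show ?thesis using d0 by blast
qed

end

section \<open>From the variational inequality to gradient curves\<close>

context local_flow_time
begin

text \<open>The inequality is applied to a point \<open>\<gamma> s\<close> close to \<open>\<alpha> t\<close>, where dividing by \<open>\<sigma> s\<close> turns it into the
  directional derivative; the triangle inequality then passes from \<open>\<gamma> s\<close> to \<open>p\<close>.\<close>
lemma evi_imp_gradient:
  assumes \<alpha>: "approx_evi 0 \<alpha>" and t: "0 \<le> t" "t < T"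
    and p: "p \<noteq> \<alpha> t" and \<gamma>: "geodesic_seg \<gamma> (\<alpha> t) p" and D: "has_dir_deriv (f (a + t)) \<gamma> (\<alpha> t) p D" and "e > 0"
  shows "eventually (\<lambda>\<epsilon>. dist p (\<alpha> (t + \<epsilon>)) \<le> dist p (\<alpha> t) - \<epsilon> * D + e * \<epsilon>) (at_right 0)"
proof -
  define x where "x = \<alpha> t"
  define l where "l = dist x p"
  have l0: "l > 0" using p by (simp add: l_def x_def)
  have xb: "dist p0 x \<le> r / 4" "x \<in> ball p0 r" using approx_evi_near[OF \<alpha>, of t] t by (auto simp: x_def)
  have "eventually (\<lambda>s. (f (a + t) (\<gamma> s) - f (a + t) x) / s > D - e / 4) (at 0 within {0<..l})"
    using D \<open>e > 0\<close> unfolding has_dir_deriv_def x_def[symmetric] l_def[symmetric]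
    by (intro order_tendstoD(1)) auto
  then obtain d where d: "d > 0" "\<And>s. s \<in> {0<..l} \<Longrightarrow> s < d \<Longrightarrow> (f (a + t) (\<gamma> s) - f (a + t) x) / s > D - e / 4"
    unfolding eventually_at by (auto simp: dist_real_def)
  \<comment> \<open>Error terms of size s^2, divided by \<open>s\<close>, leave a multiple of
    \<open>s\<close>; \<open>W\<close> collects the coefficients so that
    \<open>s \<le> e / (4 * W)\<close> brings them below the slack. The choice of \<open>s\<close>
    depends on \<open>e\<close> but not on \<epsilon>.\<close>
  define W where "W = 2 * Lam + B * \<bar>D\<bar> + B * e / 2 + 1"
  have W0: "W > 0" using Lam0 B0 \<open>e > 0\<close> by (simp add: W_def add_nonneg_pos)
  define s where "s = min (min l (d / 2)) (min (r / 4) (e / (4 * W)))"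
  have s: "0 < s" "s \<le> l" "s < d" "s \<le> r / 4" "s \<le> e / (4 * W)"
    using l0 d r0 W0 \<open>e > 0\<close> by (auto simp: s_def)
  have sR: "s \<in> {0..R}" using s rR r0 by auto
  define q where "q = \<gamma> s"
  have xq: "dist x q = s" using geodesic_seg_dist_start[OF \<gamma>, of s] s by (simp add: q_def x_def l_def)
  have pq: "dist p q = l - s" using geodesic_seg_dist_end[OF \<gamma>, of s] s by (simp add: q_def x_def l_def)
  have qb: "q \<in> ball p0 r" using dist_triangle[of p0 q x] xb xq s r0 by auto
  have fq: "f (a + t) x - f (a + t) q \<le> - s * (D - e / 4)"
  proof -
    have "D - e / 4 < (f (a + t) q - f (a + t) x) / s" using d(2)[of s] s by (simp add: q_def)
    then have "(D - e / 4) * s < f (a + t) q - f (a + t) x" using s(1) by (simp only: pos_less_divide_eq)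
    then have "f (a + t) x - f (a + t) q < - ((D - e / 4) * s)" by linarith
    also have "\<dots> = - s * (D - e / 4)" by (simp add: mult.commute)
    finally show ?thesis by simp
  qed
  have \<sigma>s: "\<sigma> s > 0" using sigma_bounds(1)[OF sR] s by linarith
  have phis: "\<phi> s \<le> 2 * s\<^sup>2"
  proof -
    have "\<phi> s \<le> \<sigma> s * s" using phi_tangent[OF sR, of 0] R0 phi_0 by simp
    also have "\<dots> \<le> 3 / 2 * s * s" using sigma_bounds(2)[OF sR] s by (intro mult_right_mono) auto
    also have "\<dots> \<le> 2 * s\<^sup>2" using s by (simp add: power2_eq_square)
    finally show ?thesis .
  qed
  have Y: "- s * (D - e / 4) + Lam * \<phi> s \<le> \<sigma> s * (- D + e / 2)"
  proof -
    have "s * (4 * W) \<le> e" using s(5) W0 by (simp add: pos_le_divide_eq)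
    then have "s * (s * (4 * W)) \<le> s * e" using s by (intro mult_left_mono) auto
    moreover have "s * (s * (4 * W)) = 8 * (Lam * s\<^sup>2) + 4 * (B * s\<^sup>2 * \<bar>D\<bar>) + 2 * (B * s\<^sup>2 * e) + 4 * s\<^sup>2"
      by (simp add: W_def power2_eq_square algebra_simps)
    moreover have "s\<^sup>2 \<ge> 0" by simp
    ultimately have small: "8 * (Lam * s\<^sup>2) + 4 * (B * s\<^sup>2 * \<bar>D\<bar>) + 2 * (B * s\<^sup>2 * e) \<le> s * e" by linarith
    have "Lam * \<phi> s \<le> Lam * (2 * s\<^sup>2)" using phis Lam0 by (intro mult_left_mono)
    then have 1: "Lam * \<phi> s \<le> 2 * (Lam * s\<^sup>2)" by simp
    have ss: "\<bar>\<sigma> s - s\<bar> \<le> B * s\<^sup>2" by (rule sigma_diff[OF sR])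
    have "(\<sigma> s - s) * D \<le> \<bar>\<sigma> s - s\<bar> * \<bar>D\<bar>" by (metis abs_ge_self abs_mult)
    also have "\<dots> \<le> B * s\<^sup>2 * \<bar>D\<bar>" using ss by (intro mult_right_mono) auto
    finally have 2: "\<sigma> s * D \<le> s * D + B * s\<^sup>2 * \<bar>D\<bar>" by (simp add: algebra_simps)
    have "(s - B * s\<^sup>2) * e \<le> \<sigma> s * e" using ss \<open>e > 0\<close> by (intro mult_right_mono) auto
    then have 3: "s * e - B * s\<^sup>2 * e \<le> \<sigma> s * e" by (simp add: algebra_simps)
    define Y1 Y2 where "Y1 = - s * (D - e / 4) + Lam * \<phi> s" and "Y2 = \<sigma> s * (- D + e / 2)"
    have "4 * Y1 = - 4 * (s * D) + s * e + 4 * (Lam * \<phi> s)" by (simp add: Y1_def algebra_simps)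
    moreover have "4 * Y2 = - 4 * (\<sigma> s * D) + 2 * (\<sigma> s * e)" by (simp add: Y2_def algebra_simps)
    ultimately have "Y1 \<le> Y2" using 1 2 3 small by linarith
    then show ?thesis by (simp add: Y1_def Y2_def)
  qed
  define C where "C = 2 * (E_c + Cst) + 1"
  have C0: "C > 0" using E_c0 Cst0 by (simp add: C_def)
  \<comment> \<open>With \<open>s\<close> fixed, the error quadratic in \<epsilon> fits into the
    remaining half of the slack, scaled by \<open>\<sigma> s\<close>.\<close>
  define \<epsilon>0 where "\<epsilon>0 = min (T - t) (e * \<sigma> s / (2 * C))"
  have "\<epsilon>0 > 0" using t \<open>e > 0\<close> \<sigma>s C0 by (simp add: \<epsilon>0_def)
  then have "eventually (\<lambda>\<epsilon>. \<epsilon> \<in> {0<..<\<epsilon>0}) (at_right 0)" by (intro eventually_at_right_real)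
  then show ?thesis
  proof eventually_elim
    case (elim \<epsilon>)
    then have \<epsilon>: "0 < \<epsilon>" "t + \<epsilon> \<le> T" "\<epsilon> * (2 * C) \<le> e * \<sigma> s"
      using C0 by (auto simp: \<epsilon>0_def pos_less_divide_eq less_imp_le)
    define d' where "d' = dist (\<alpha> (t + \<epsilon>)) q"
    have d'R: "d' \<in> {0..R}"
      using approx_evi_near(2)[OF \<alpha>, of "t + \<epsilon>"] t \<epsilon> qb dist_in_ball_R by (auto simp: d'_def)
    have "\<phi> d' \<le> \<phi> s + \<epsilon> * (f (a + t) x - f (a + t) q + Lam * \<phi> s) + 2 * (E_c + Cst) * \<epsilon>\<^sup>2"
      using approx_evi_evi[OF \<alpha>, of t "t + \<epsilon>" q] t \<epsilon> qb xq by (simp add: d'_def evi_rhs_def x_def)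
    also have "\<epsilon> * (f (a + t) x - f (a + t) q + Lam * \<phi> s) \<le> \<epsilon> * (\<sigma> s * (- D + e / 2))"
      using fq Y \<epsilon> by (intro mult_left_mono) auto
    also have "2 * (E_c + Cst) * \<epsilon>\<^sup>2 \<le> \<epsilon> * (\<sigma> s * (e / 2))"
    proof -
      have "2 * (E_c + Cst) * \<epsilon>\<^sup>2 \<le> C * \<epsilon>\<^sup>2" by (intro mult_right_mono) (auto simp: C_def)
      also have "\<dots> = \<epsilon> * (\<epsilon> * C)" by (simp add: power2_eq_square)
      also have "\<dots> \<le> \<epsilon> * (\<sigma> s * (e / 2))" using \<epsilon> by (intro mult_left_mono) (auto simp: algebra_simps)
      finally show ?thesis .
    qed
    finally have "\<phi> d' \<le> \<phi> s + \<sigma> s * (\<epsilon> * (- D + e))" by (simp add: algebra_simps)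
    \<comment> \<open>The tangent at \<open>s\<close> converts the bound on \<open>\<phi> d'\<close>
      into one on \<open>d' - s\<close> without inverting \<open>\<phi>\<close>.\<close>
    moreover have "\<phi> s + \<sigma> s * (d' - s) \<le> \<phi> d'" by (rule phi_tangent[OF sR d'R])
    ultimately have "\<sigma> s * (d' - s) \<le> \<sigma> s * (\<epsilon> * (- D + e))" by linarith
    then have "d' - s \<le> \<epsilon> * (- D + e)" using mult_le_cancel_left_pos[OF \<sigma>s] by blast
    moreover have "dist p (\<alpha> (t + \<epsilon>)) \<le> dist p q + d'" unfolding d'_def using dist_triangle2[of p "\<alpha> (t + \<epsilon>)" q] by simp
    ultimately have "dist p (\<alpha> (t + \<epsilon>)) \<le> l + \<epsilon> * (- D + e)" using pq by linarith
    then show ?case by (simp add: l_def x_def dist_commute algebra_simps)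
  qed
qed

lemma gradient_curve_of_evi:
  assumes \<alpha>: "approx_evi 0 \<alpha>" and \<Omega>: "ball p0 r \<times> {a..<a+\<tau>} \<subseteq> \<Omega>"
  shows "gradient_curve f \<Omega> (\<lambda>t. \<alpha> (t - a)) {a..<a+T}" "(8 * L)-lipschitz_on {a..<a+T} (\<lambda>t. \<alpha> (t - a))"
proof -
  show lip: "(8 * L)-lipschitz_on {a..<a+T} (\<lambda>t. \<alpha> (t - a))"
  proof (rule lipschitz_onI)
    fix s t assume "s \<in> {a..<a+T}" "t \<in> {a..<a+T}"
    then show "dist (\<alpha> (s - a)) (\<alpha> (t - a)) \<le> 8 * L * dist s t"
      using approx_evi_lip[OF \<alpha>, of "s - a" "t - a"] approx_evi_lip[OF \<alpha>, of "t - a" "s - a"]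
      by (cases "s \<le> t") (auto simp: dist_real_def dist_commute)
  qed (use L1 in simp)
  show "gradient_curve f \<Omega> (\<lambda>t. \<alpha> (t - a)) {a..<a+T}"
    unfolding gradient_curve_def
  proof (intro conjI ballI allI impI)
    show "\<exists>L. L-lipschitz_on {a..<a+T} (\<lambda>t. \<alpha> (t - a))" using lip by blast
    fix t assume t: "t \<in> {a..<a+T}"
    show "(\<alpha> (t - a), t) \<in> \<Omega>"
      using approx_evi_near(2)[OF \<alpha>, of "t - a"] t Ttau \<Omega> by auto
    fix p \<gamma> D e
    assume h: "p \<noteq> \<alpha> (t - a) \<and> geodesic_seg \<gamma> (\<alpha> (t - a)) p \<and> has_dir_deriv (f t) \<gamma> (\<alpha> (t - a)) p D" and "(0::real) < e"
    then show "\<forall>\<^sub>F \<epsilon> in at_right 0. dist p (\<alpha> (t + \<epsilon> - a)) \<le> dist p (\<alpha> (t - a)) - \<epsilon> * D + e * \<epsilon>"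
      using evi_imp_gradient[OF \<alpha>, of "t - a" p \<gamma> D e] t by (simp add: algebra_simps)
  qed
qed

end

section \<open>Maximal gradient curves\<close>

text \<open>The quadratic \<open>s\<^sup>2\<close> lies below its chord by
  \<open>s * (dist x y - s)\<close>, hence the symmetric error term. Raising the constant from
  \<open>c0\<close> to \<open>c\<close> allows it to be taken nonnegative later.\<close>

lemma lambda_concave_imp_ineq:
  assumes conc: "lambda_concave_on c0 A g" and \<gamma>: "geodesic_seg \<gamma> x y" and A: "\<gamma> ` {0..dist x y} \<subseteq> A"
    and s: "s \<in> {0..dist x y}" and c: "c0 \<le> c"
  shows "(dist x y - s) * g x + s * g y - c / 2 * s * (dist x y - s) * dist x y \<le> dist x y * g (\<gamma> s)"
proof (cases "x = y")
  case True
  then show ?thesis using s by simp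
next
  case False
  define l where "l = dist x y"
  have l0: "l > 0" using False by (simp add: l_def)
  define u where "u = s / l"
  have u: "0 \<le> u" "u \<le> 1" "u * l = s" using s l0 by (auto simp: u_def l_def)
  have ends: "\<gamma> 0 = x" "\<gamma> l = y" using \<gamma> by (simp_all add: geodesic_seg_def l_def)
  define k where "k = c0 / 2"
  have "concave_on {0..l} (\<lambda>s. g (\<gamma> s) - k * s\<^sup>2)"
    using conc \<gamma> A unfolding lambda_concave_on_def l_def k_def by blast
  then have "(1 - u) * (g (\<gamma> 0) - k * 0\<^sup>2) + u * (g (\<gamma> l) - k * l\<^sup>2) \<le>
      g (\<gamma> ((1 - u) *\<^sub>R 0 + u *\<^sub>R l)) - k * ((1 - u) *\<^sub>R 0 + u *\<^sub>R l)\<^sup>2"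
    using u l0 by (intro concave_onD) auto
  then have "(1 - u) * g x + u * (g y - k * l\<^sup>2) \<le> g (\<gamma> s) - k * s\<^sup>2"
    by (simp add: ends u(3))
  then have "l * ((1 - u) * g x + u * (g y - k * l\<^sup>2)) \<le> l * (g (\<gamma> s) - k * s\<^sup>2)"
    using l0 by (intro mult_left_mono) auto
  moreover have "l * ((1 - u) * g x + u * (g y - k * l\<^sup>2)) = (l - u * l) * g x + (u * l) * (g y - k * l\<^sup>2)"
    by (simp add: algebra_simps)
  ultimately have "(l - s) * g x + s * (g y - k * l\<^sup>2) \<le> l * (g (\<gamma> s) - k * s\<^sup>2)" by (simp only: u(3))
  then have "(l - s) * g x + s * g y - k * (s * (l - s) * l) \<le> l * g (\<gamma> s)"
    by (simp add: algebra_simps power2_eq_square)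
  moreover have "k * (s * (l - s) * l) \<le> c / 2 * (s * (l - s) * l)"
    using c s l0 by (intro mult_right_mono) (auto simp: k_def l_def)
  ultimately show ?thesis unfolding l_def by (simp add: mult.assoc)
qed

text \<open>The neighbourhood of semiconcavity is shrunk to a product. The ball gets at most half
  the available radius, because a geodesic between two points of \<open>ball p r\<close> is only
  known to stay within distance \<open>2 * r\<close> of \<open>p\<close>.\<close>

lemma local_flow_exists:
  fixes f :: "real \<Rightarrow> 'a::complete_space \<Rightarrow> real"
  assumes cat: "CAT \<kappa> (UNIV :: 'a set)"
    and lip: "L-lipschitz_on \<Omega> (\<lambda>(x, t). f t x)" and L1: "1 \<le> L"
    and sc: "locally_semiconcave_family f \<Omega>" and z: "(p, a) \<in> \<Omega>"
  shows "\<exists>\<phi> \<sigma> R B r \<tau> c. local_flow \<phi> \<sigma> R B f p a r \<tau> L c \<and> ball p r \<times> {a..<a+\<tau>} \<subseteq> \<Omega>"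
proof -
  obtain \<phi> \<sigma> R B where cf: "comparison_function TYPE('a) \<phi> \<sigma> R B"
    using CAT_imp_comparison_function[OF cat] by blast
  have R0: "R > 0" using cf by (simp add: comparison_function_def)
  obtain W c0 where W: "open W" "(p, a) \<in> W" "W \<subseteq> \<Omega>"
    and conc: "\<And>t. lambda_concave_on c0 {x. (x, t) \<in> W} (f t)"
    using sc z unfolding locally_semiconcave_family_def by blast
  obtain U V where UV: "open U" "open V" "p \<in> U" "a \<in> V" "U \<times> V \<subseteq> W"
    using open_prod_elim[OF W(1,2)] by (metis mem_Sigma_iff)
  obtain r1 where r1: "r1 > 0" "ball p r1 \<subseteq> U" using UV open_contains_ball by blast
  obtain \<tau> where \<tau>: "\<tau> > 0" "ball a \<tau> \<subseteq> V" using UV open_contains_ball by blast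
  define r where "r = min (r1 / 2) (R / 2)"
  have r: "0 < r" "2 * r \<le> R" "2 * r \<le> r1" using r1 R0 by (auto simp: r_def)
  have inW: "(x, t) \<in> W" if "dist p x < 2 * r" "t \<in> {a..<a+\<tau>}" for x t
  proof -
    have "x \<in> U" "t \<in> V" using that r r1 \<tau> by (auto simp: dist_real_def subset_iff)
    then show ?thesis using UV by blast
  qed
  have inW': "(x, t) \<in> W" if "x \<in> ball p r" "t \<in> {a..<a+\<tau>}" for x t
    using inW[of x t] that r by auto
  have "local_flow \<phi> \<sigma> R B f p a r \<tau> L (max c0 0)"
  proof (unfold_locales)
    show "comparison_function TYPE('a) \<phi> \<sigma> R B" by (rule cf)
    show "0 < r" "2 * r \<le> R" "0 < \<tau>" "1 \<le> L" "0 \<le> max c0 0" using r \<tau> L1 by auto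
  next
    fix x y s t assume h: "x \<in> ball p r" "y \<in> ball p r" "s \<in> {a..<a+\<tau>}" "t \<in> {a..<a+\<tau>}"
    have "dist (f s x) (f t y) \<le> L * dist (x, s) (y, t)"
      using lipschitz_onD[OF lip, of "(x, s)" "(y, t)"] inW'[OF h(1,3)] inW'[OF h(2,4)] W by auto
    also have "dist (x, s) (y, t) \<le> dist x y + dist s t"
      unfolding dist_prod_def by (simp add: sqrt_sum_squares_le_sum)
    finally show "\<bar>f s x - f t y\<bar> \<le> L * (dist x y + \<bar>s - t\<bar>)"
      using L1 by (simp add: dist_real_def mult_left_mono)
  next
    fix x y t \<gamma> s
    assume h: "x \<in> ball p r" "y \<in> ball p r" "t \<in> {a..<a+\<tau>}" "geodesic_seg \<gamma> x y" "s \<in> {0..dist x y}"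
    have "\<gamma> ` {0..dist x y} \<subseteq> {x. (x, t) \<in> W}"
    proof (intro image_subsetI CollectI inW[OF _ h(3)])
      fix u assume u: "u \<in> {0..dist x y}"
      have "dist p (\<gamma> u) \<le> dist p x + u" "dist p (\<gamma> u) \<le> dist p y + (dist x y - u)"
        using dist_triangle[of p "\<gamma> u" x] dist_triangle[of p "\<gamma> u" y]
          geodesic_seg_dist_start[OF h(4), of u] geodesic_seg_dist_end[OF h(4), of u] u by auto
      moreover have "dist x y \<le> dist p x + dist p y" by (rule dist_triangle3)
      ultimately show "dist p (\<gamma> u) < 2 * r" using h(1,2) by auto
    qed
    then show "(dist x y - s) * f t x + s * f t y - max c0 0 / 2 * s * (dist x y - s) * dist x y \<le> dist x y * f t (\<gamma> s)"
      by (intro lambda_concave_imp_ineq[OF conc h(4) _ h(5)]) auto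
  qed
  moreover have "ball p r \<times> {a..<a+\<tau>} \<subseteq> \<Omega>" using inW' W by auto
  ultimately show ?thesis by blast
qed

lemma local_gradient_curve_exists:
  assumes lf: "local_flow \<phi> \<sigma> R B f p a r \<tau> L c" and sub: "ball p r \<times> {a..<a+\<tau>} \<subseteq> \<Omega>"
  shows "\<exists>T>0. \<exists>\<alpha>. \<alpha> a = p \<and> gradient_curve f \<Omega> \<alpha> {a..<a+T} \<and> (8 * L)-lipschitz_on {a..<a+T} \<alpha>"
proof -
  interpret local_flow \<phi> \<sigma> R B f p a r \<tau> L c by (rule lf)
  define T where "T = min 1 (min (\<tau> / 2) (r / (32 * L)))"
  have T0: "T > 0" using tau0 r0 L1 by (simp add: T_def)
  have "T \<le> r / (32 * L)" by (simp add: T_def)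
  then have "T * (32 * L) \<le> r" using L1 by (simp add: pos_le_divide_eq)
  then have "32 * L * T \<le> r" by (simp add: mult_ac)
  moreover have "T \<le> 1" "T < \<tau>" using tau0 by (auto simp: T_def)
  ultimately interpret local_flow_time \<phi> \<sigma> R B f p a r \<tau> L c T
    using T0 by unfold_locales auto
  obtain \<alpha> where \<alpha>: "approx_evi 0 \<alpha>" using evi_curve_exists by blast
  show ?thesis
    using gradient_curve_of_evi[OF \<alpha> sub] T0 approx_evi_start[OF \<alpha>]
    by (intro exI[of _ T] conjI exI[of _ "\<lambda>t. \<alpha> (t - a)"]) auto
qed

section \<open>Restricting and gluing gradient curves\<close>

lemma gradient_curve_subset: "gradient_curve f \<Omega> \<alpha> I \<Longrightarrow> J \<subseteq> I \<Longrightarrow> gradient_curve f \<Omega> \<alpha> J"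
  unfolding gradient_curve_def by (meson lipschitz_on_subset subsetD)

lemma gradient_curve_continuous: "gradient_curve f \<Omega> \<alpha> I \<Longrightarrow> continuous_on I \<alpha>"
  unfolding gradient_curve_def using lipschitz_on_continuous_on by blast

text \<open>The differential condition at \<open>t\<close> sees only a right neighbourhood of
  \<open>t\<close>, so it may be borrowed from different gradient curves at different times. The
  Lipschitz bound is global on \<open>I\<close> and has to be supplied separately.\<close>

lemma gradient_curve_local_cong:
  assumes lip: "K-lipschitz_on I \<alpha>"
    and loc: "\<And>t. t \<in> I \<Longrightarrow> \<exists>\<beta> J d. gradient_curve f \<Omega> \<beta> J \<and> t \<in> J \<and> d > 0 \<and> (\<forall>s\<in>{t..<t+d}. \<alpha> s = \<beta> s)"
  shows "gradient_curve f \<Omega> \<alpha> I"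
  unfolding gradient_curve_def
proof (intro conjI ballI allI impI)
  show "\<exists>L. L-lipschitz_on I \<alpha>" using lip by blast
  fix t assume t: "t \<in> I"
  then obtain \<beta> J d where \<beta>: "gradient_curve f \<Omega> \<beta> J" "t \<in> J" and d: "d > 0" "\<And>s. s \<in> {t..<t+d} \<Longrightarrow> \<alpha> s = \<beta> s"
    using loc by meson
  have eq: "\<alpha> t = \<beta> t" using d by simp
  show "(\<alpha> t, t) \<in> \<Omega>" using \<beta> unfolding eq gradient_curve_def by blast
  fix p \<gamma> D e
  assume h: "p \<noteq> \<alpha> t \<and> geodesic_seg \<gamma> (\<alpha> t) p \<and> has_dir_deriv (f t) \<gamma> (\<alpha> t) p D" and e: "(0::real) < e"
  have "\<forall>\<^sub>F \<epsilon> in at_right 0. dist p (\<beta> (t + \<epsilon>)) \<le> dist p (\<beta> t) - \<epsilon> * D + e * \<epsilon>"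
    using \<beta> h e unfolding eq gradient_curve_def by blast
  moreover have "eventually (\<lambda>\<epsilon>. \<epsilon> \<in> {0<..<d}) (at_right 0)" using d by (intro eventually_at_right_real) auto
  ultimately show "\<forall>\<^sub>F \<epsilon> in at_right 0. dist p (\<alpha> (t + \<epsilon>)) \<le> dist p (\<alpha> t) - \<epsilon> * D + e * \<epsilon>"
    by eventually_elim (use d eq in auto)
qed

text \<open>The passage from local to maximal curves needs only these two facts and completeness.
  \<open>K\<close> is independent of the starting point, so speeds cannot blow up near the end of
  the interval of existence.\<close>

locale gradient_flow_local =
  fixes f :: "real \<Rightarrow> 'a::complete_space \<Rightarrow> real" and \<Omega> :: "('a \<times> real) set" and K :: real
  assumes local_ex: "(p, t) \<in> \<Omega> \<Longrightarrow>
      \<exists>T>0. \<exists>\<alpha>. \<alpha> t = p \<and> gradient_curve f \<Omega> \<alpha> {t..<t+T} \<and> K-lipschitz_on {t..<t+T} \<alpha>"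
    and local_unique: "gradient_curve f \<Omega> \<alpha> {t..<t+T} \<Longrightarrow> gradient_curve f \<Omega> \<beta> {t..<t+T} \<Longrightarrow> 0 < T \<Longrightarrow>
      \<alpha> t = \<beta> t \<Longrightarrow> \<exists>d>0. \<forall>s\<in>{t..<t+d}. \<alpha> s = \<beta> s"
begin

abbreviation Iv :: "real \<Rightarrow> ereal \<Rightarrow> real set" where
  "Iv a b \<equiv> {t. a \<le> t \<and> ereal t < b}"

text \<open>The set of agreement in {a..t} is closed, and local uniqueness restarted at any of its
  points extends it to the right.\<close>

lemma agree:
  assumes \<alpha>: "gradient_curve f \<Omega> \<alpha> (Iv a b)" and \<beta>: "gradient_curve f \<Omega> \<beta> (Iv a b')" and start: "\<alpha> a = \<beta> a"
    and t: "a \<le> t" "ereal t < b" "ereal t < b'"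
  shows "\<alpha> t = \<beta> t"
proof (rule real_interval_induct[OF t(1), where P = "\<lambda>t. \<alpha> t = \<beta> t"])
  have sub: "{a..t} \<subseteq> Iv a b" "{a..t} \<subseteq> Iv a b'"
    using t by (auto intro: le_less_trans[of "ereal _" "ereal t"])
  have "continuous_on {a..t} \<alpha>" "continuous_on {a..t} \<beta>"
    using gradient_curve_continuous[OF gradient_curve_subset[OF \<alpha> sub(1)]]
      gradient_curve_continuous[OF gradient_curve_subset[OF \<beta> sub(2)]] by auto
  then have "closed ({a..t} \<inter> (\<lambda>s. dist (\<alpha> s) (\<beta> s)) -` {0})"
    by (intro continuous_closed_preimage continuous_intros) auto
  then show "closed {s \<in> {a..t}. \<alpha> s = \<beta> s}" by (rule back_subst[of closed]) auto
  show "\<alpha> a = \<beta> a" by (rule start)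
  fix s assume s: "a \<le> s" "s < t" "\<alpha> s = \<beta> s"
  have "{s..<s+(t-s)} \<subseteq> {a..t}" using s by auto
  then have "\<exists>d>0. \<forall>u\<in>{s..<s+d}. \<alpha> u = \<beta> u"
    using s sub gradient_curve_subset[OF \<alpha>] gradient_curve_subset[OF \<beta>]
    by (intro local_unique[of \<alpha> s "t - s" \<beta>]) auto
  then show "\<exists>d>0. \<forall>u\<in>{s<..<s+d}. \<alpha> u = \<beta> u" by force
qed

lemma K0: assumes "(p, t) \<in> \<Omega>" shows "K \<ge> 0"
  using local_ex[OF assms] lipschitz_on_nonneg by blast

text \<open>The Lipschitz constant in the definition of a gradient curve depends on the curve; by local uniqueness every
  gradient curve inherits the constant \<open>K\<close> of the constructed ones.\<close>
lemma gradient_curve_dist_le: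
  assumes \<alpha>: "gradient_curve f \<Omega> \<alpha> (Iv a b)" and st: "a \<le> s" "s \<le> t" "ereal t < b"
  shows "dist (\<alpha> s) (\<alpha> t) \<le> K * (t - s)"
proof (rule real_interval_induct[OF st(2), where P = "\<lambda>t. dist (\<alpha> s) (\<alpha> t) \<le> K * (t - s)"])
  have sub: "{s..t} \<subseteq> Iv a b" using st by (auto intro: le_less_trans[of "ereal _" "ereal t"])
  have "continuous_on {s..t} \<alpha>"
    using gradient_curve_continuous[OF gradient_curve_subset[OF \<alpha> sub]] .
  then have "closed ({s..t} \<inter> (\<lambda>u. dist (\<alpha> s) (\<alpha> u) - K * (u - s)) -` {..0})"
    by (intro continuous_closed_preimage continuous_intros) auto
  then show "closed {u \<in> {s..t}. dist (\<alpha> s) (\<alpha> u) \<le> K * (u - s)}" by (rule back_subst[of closed]) auto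
  show "dist (\<alpha> s) (\<alpha> s) \<le> K * (s - s)" by simp
  fix u assume u: "s \<le> u" "u < t" and IH: "dist (\<alpha> s) (\<alpha> u) \<le> K * (u - s)"
  have "u \<in> Iv a b" using u by (intro subsetD[OF sub]) auto
  then have "(\<alpha> u, u) \<in> \<Omega>" using \<alpha> unfolding gradient_curve_def by blast
  then obtain T \<beta> where \<beta>: "T > 0" "\<beta> u = \<alpha> u" "gradient_curve f \<Omega> \<beta> {u..<u+T}" "K-lipschitz_on {u..<u+T} \<beta>"
    using local_ex by blast
  define T' where "T' = min T (t - u)"
  have T': "T' > 0" using \<beta> u by (simp add: T'_def)
  have "{u..<u+T'} \<subseteq> {s..t}" "{u..<u+T'} \<subseteq> {u..<u+T}" using u by (auto simp: T'_def)
  then obtain d where d: "d > 0" "\<And>v. v \<in> {u..<u+d} \<Longrightarrow> \<alpha> v = \<beta> v"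
    using local_unique[of \<alpha> u T' \<beta>] gradient_curve_subset[OF \<alpha> order_trans[OF _ sub]]
      gradient_curve_subset[OF \<beta>(3)] T' \<beta>(2) by metis
  have "dist (\<alpha> s) (\<alpha> v) \<le> K * (v - s)" if v: "v \<in> {u<..<u + min d T}" for v
  proof -
    have "dist (\<beta> u) (\<beta> v) \<le> K * (v - u)"
      using lipschitz_onD[OF \<beta>(4), of u v] v \<beta>(1) by (auto simp: dist_real_def)
    moreover have "\<alpha> v = \<beta> v" using d v by auto
    ultimately show ?thesis using IH dist_triangle[of "\<alpha> s" "\<alpha> v" "\<alpha> u"] \<beta>(2) by (simp add: algebra_simps)
  qed
  then show "\<exists>d>0. \<forall>v\<in>{u<..<u+d}. dist (\<alpha> s) (\<alpha> v) \<le> K * (v - s)"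
    using d(1) \<beta>(1) by (intro exI[of _ "min d T"]) auto
qed

text \<open>Failure to escape gives times tending to \<open>b\<close> with positions in the closed
  set \<open>C\<close>. The limit point therefore lies in \<Omega> rather than on its boundary, and
  the flow can be restarted there.\<close>

lemma gradient_curve_extend:
  assumes \<alpha>: "gradient_curve f \<Omega> \<alpha> (Iv a (ereal b))" and ab: "a < b"
    and C: "closed C" "C \<subseteq> \<Omega>" and acc: "\<And>t0. t0 < b \<Longrightarrow> \<exists>t. t0 < t \<and> t < b \<and> (\<alpha> t, t) \<in> C"
  shows "\<exists>T>0. \<exists>\<beta>. \<beta> a = \<alpha> a \<and> gradient_curve f \<Omega> \<beta> (Iv a (ereal (b + T)))"
proof -
  have "\<forall>n. \<exists>t. max a (b - inverse (real (Suc n))) < t \<and> t < b \<and> (\<alpha> t, t) \<in> C"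
    using ab by (intro allI acc) simp
  then obtain x where x: "\<And>n. a < x n" "\<And>n. b - inverse (real (Suc n)) < x n" "\<And>n. x n < b" "\<And>n. (\<alpha> (x n), x n) \<in> C"
    by (metis max_less_iff_conj)
  have xb: "x \<longlonglongrightarrow> b"
  proof (rule tendsto_sandwich)
    show "(\<lambda>n. b - inverse (real (Suc n))) \<longlonglongrightarrow> b"
      using tendsto_diff[OF tendsto_const LIMSEQ_inverse_real_of_nat, of b] by simp
    show "\<forall>\<^sub>F n in sequentially. b - inverse (real (Suc n)) \<le> x n" by (intro always_eventually allI less_imp_le x)
    show "\<forall>\<^sub>F n in sequentially. x n \<le> b" by (intro always_eventually allI less_imp_le x)
  qed simp
  have K: "K \<ge> 0" using x(4)[of 0] C K0 by blast
  have dl: "dist (\<alpha> s) (\<alpha> t) \<le> K * \<bar>t - s\<bar>" if "a \<le> s" "s < b" "a \<le> t" "t < b" for s t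
    using gradient_curve_dist_le[OF \<alpha>, of s t] gradient_curve_dist_le[OF \<alpha>, of t s] that
    by (cases "s \<le> t") (auto simp: dist_commute)
  have "Cauchy (\<lambda>n. \<alpha> (x n))"
  proof (rule metric_CauchyI)
    fix e :: real assume "e > 0"
    then have "e / (K + 1) > 0" using K by simp
    then obtain M where M: "\<And>m n. m \<ge> M \<Longrightarrow> n \<ge> M \<Longrightarrow> dist (x m) (x n) < e / (K + 1)"
      using metric_CauchyD[OF LIMSEQ_imp_Cauchy[OF xb]] by blast
    have "dist (\<alpha> (x m)) (\<alpha> (x n)) < e" if "m \<ge> M" "n \<ge> M" for m n
    proof -
      have "dist (\<alpha> (x m)) (\<alpha> (x n)) \<le> K * \<bar>x n - x m\<bar>" using x by (intro dl) (auto intro: less_imp_le)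
      also have "\<dots> \<le> (K + 1) * dist (x m) (x n)" using K by (simp add: dist_real_def abs_minus_commute mult_right_mono)
      also have "\<dots> < e" using M[OF that] K by (simp add: pos_less_divide_eq mult.commute)
      finally show ?thesis .
    qed
    then show "\<exists>M. \<forall>m\<ge>M. \<forall>n\<ge>M. dist (\<alpha> (x m)) (\<alpha> (x n)) < e" by blast
  qed
  then obtain q where q: "(\<lambda>n. \<alpha> (x n)) \<longlonglongrightarrow> q" using Cauchy_convergent convergent_def by blast
  have "(\<lambda>n. (\<alpha> (x n), x n)) \<longlonglongrightarrow> (q, b)" by (intro tendsto_Pair q xb)
  from closed_sequentially[OF C(1) x(4) this] have "(q, b) \<in> C" .
  then have "(q, b) \<in> \<Omega>" using C by blast
  then obtain T \<beta> where \<beta>: "T > 0" "\<beta> b = q" "gradient_curve f \<Omega> \<beta> {b..<b+T}" "K-lipschitz_on {b..<b+T} \<beta>"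
    using local_ex by blast
  \<comment> \<open>The accumulation point is the limit of the whole curve, not only along the
    sequence; this makes the glued curve Lipschitz across \<open>b\<close>.\<close>
  have sq: "dist (\<alpha> s) q \<le> K * (b - s)" if s: "a \<le> s" "s < b" for s
  proof (rule LIMSEQ_le)
    show "(\<lambda>n. dist (\<alpha> s) (\<alpha> (x n))) \<longlonglongrightarrow> dist (\<alpha> s) q" by (intro tendsto_intros q)
    have "(\<lambda>n. K * \<bar>x n - s\<bar>) \<longlonglongrightarrow> K * \<bar>b - s\<bar>" by (intro tendsto_intros xb)
    then show "(\<lambda>n. K * \<bar>x n - s\<bar>) \<longlonglongrightarrow> K * (b - s)" using s by simp
    show "\<exists>N. \<forall>n\<ge>N. dist (\<alpha> s) (\<alpha> (x n)) \<le> K * \<bar>x n - s\<bar>"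
      using dl[OF s less_imp_le[OF x(1)] x(3)] by blast
  qed
  define \<alpha>' where "\<alpha>' t = (if t < b then \<alpha> t else \<beta> t)" for t
  have mixed: "dist (\<alpha>' s) (\<alpha>' t) \<le> K * (t - s)" if st: "a \<le> s" "s \<le> t" "t < b + T" for s t
  proof -
    consider "t < b" | "s < b" "b \<le> t" | "b \<le> s" using st by linarith
    then show ?thesis
    proof cases
      case 1
      then show ?thesis using dl[of s t] st by (simp add: \<alpha>'_def)
    next
      case 2
      have "dist q (\<beta> t) \<le> K * (t - b)"
        using lipschitz_onD[OF \<beta>(4), of b t] 2 st \<beta>(1,2) by (simp add: dist_real_def)
      then have "dist (\<alpha> s) (\<beta> t) \<le> K * (b - s) + K * (t - b)"
        using sq[OF st(1) 2(1)] dist_triangle[of "\<alpha> s" "\<beta> t" q] by linarith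
      then show ?thesis using 2 by (simp add: \<alpha>'_def algebra_simps)
    next
      case 3
      then show ?thesis using lipschitz_onD[OF \<beta>(4), of s t] st by (simp add: dist_real_def \<alpha>'_def)
    qed
  qed
  have "gradient_curve f \<Omega> \<alpha>' (Iv a (ereal (b + T)))"
  proof (rule gradient_curve_local_cong)
    show "K-lipschitz_on (Iv a (ereal (b + T))) \<alpha>'"
    proof (rule lipschitz_onI)
      fix s t assume "s \<in> Iv a (ereal (b + T))" "t \<in> Iv a (ereal (b + T))"
      then show "dist (\<alpha>' s) (\<alpha>' t) \<le> K * dist s t"
        using mixed[of s t] mixed[of t s] by (cases "s \<le> t") (auto simp: dist_commute dist_real_def)
    qed (rule K)
    fix t assume t: "t \<in> Iv a (ereal (b + T))"
    show "\<exists>\<beta> J d. gradient_curve f \<Omega> \<beta> J \<and> t \<in> J \<and> d > 0 \<and> (\<forall>s\<in>{t..<t+d}. \<alpha>' s = \<beta> s)"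
    proof (cases "t < b")
      case True
      then show ?thesis using \<alpha> t
        by (intro exI[of _ \<alpha>] exI[of _ "Iv a (ereal b)"] exI[of _ "b - t"]) (auto simp: \<alpha>'_def)
    next
      case False
      then show ?thesis using \<beta>(3) t
        by (intro exI[of _ \<beta>] exI[of _ "{b..<b+T}"] exI[of _ 1]) (auto simp: \<alpha>'_def)
    qed
  qed
  moreover have "\<alpha>' a = \<alpha> a" using ab by (simp add: \<alpha>'_def)
  ultimately show ?thesis using \<beta>(1) by blast
qed

text \<open>In \<open>ereal\<close> the supremum of all existence times always exists, and infinity
  needs no separate treatment. By \<open>agree\<close>, competing curves coincide where both are
  defined, so the value at \<open>t\<close> may be read off from any curve that lives past
  \<open>t\<close>.\<close>

theorem maximal_gradient_curve:
  assumes pa: "(p, a) \<in> \<Omega>"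
  shows "\<exists>b \<alpha>. b > ereal a \<and> \<alpha> a = p \<and> gradient_curve f \<Omega> \<alpha> (Iv a b) \<and>
     (\<forall>b' \<beta>. b' > ereal a \<and> \<beta> a = p \<and> gradient_curve f \<Omega> \<beta> (Iv a b') \<longrightarrow>
        b' \<le> b \<and> (\<forall>t. a \<le> t \<and> ereal t < b' \<longrightarrow> \<beta> t = \<alpha> t)) \<and>
     (b < \<infinity> \<longrightarrow> (\<forall>C. closed C \<and> C \<subseteq> \<Omega> \<longrightarrow>
        (\<exists>t0. ereal t0 < b \<and> (\<forall>t. t0 < t \<and> ereal t < b \<longrightarrow> (\<alpha> t, t) \<notin> C))))"
proof -
  define G where "G = {(b', \<beta>). b' > ereal a \<and> \<beta> a = p \<and> gradient_curve f \<Omega> \<beta> (Iv a b')}"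
  obtain T \<alpha>0 where \<alpha>0: "T > 0" "\<alpha>0 a = p" "gradient_curve f \<Omega> \<alpha>0 {a..<a+T}" using local_ex[OF pa] by blast
  have "Iv a (ereal (a + T)) = {a..<a+T}" by auto
  then have G0: "(ereal (a + T), \<alpha>0) \<in> G" using \<alpha>0 by (simp add: G_def)
  have GD: "\<beta> a = p" "gradient_curve f \<Omega> \<beta> (Iv a b')" if "(b', \<beta>) \<in> G" for b' \<beta>
    using that unfolding G_def by blast+
  define b where "b = Sup (fst ` G)"
  have up: "b' \<le> b" if "(b', \<beta>) \<in> G" for b' \<beta>
    unfolding b_def using that by (intro Sup_upper) force
  have ab: "ereal a < b" using up[OF G0] \<alpha>0(1) by (auto intro: less_le_trans[of _ "ereal (a + T)"])
  have ex: "\<exists>g. g \<in> G \<and> ereal t < fst g" if "ereal t < b" for t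
    using that unfolding b_def less_Sup_iff by auto
  define g where "g t = (SOME g. g \<in> G \<and> ereal t < fst g)" for t
  have g: "g t \<in> G" "ereal t < fst (g t)" if "ereal t < b" for t
    using someI_ex[OF ex[OF that]] unfolding g_def by auto
  define \<alpha> where "\<alpha> t = snd (g t) t" for t
  have eq: "\<alpha> t = \<beta> t" if \<beta>: "(b', \<beta>) \<in> G" and t: "a \<le> t" "ereal t < b'" for b' \<beta> t
  proof -
    have tb: "ereal t < b" using t(2) up[OF \<beta>] by (rule less_le_trans)
    obtain b1 \<beta>1 where g1: "g t = (b1, \<beta>1)" by (cases "g t")
    have G1: "(b1, \<beta>1) \<in> G" "ereal t < b1" using g[OF tb] g1 by auto
    have "\<beta>1 a = \<beta> a" using GD(1)[OF \<beta>] GD(1)[OF G1(1)] by simp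
    from agree[OF GD(2)[OF G1(1)] GD(2)[OF \<beta>] this t(1) G1(2) t(2)] have "\<beta>1 t = \<beta> t" .
    then show ?thesis by (simp add: \<alpha>_def g1)
  qed
  have aa: "\<alpha> a = p" using eq[OF G0] \<alpha>0 by simp
  have K: "K \<ge> 0" using K0[OF pa] .
  have dl: "dist (\<alpha> s) (\<alpha> t) \<le> K * (t - s)" if st: "a \<le> s" "s \<le> t" "ereal t < b" for s t
  proof -
    obtain b1 \<beta>1 where g1: "g t = (b1, \<beta>1)" by (cases "g t")
    have G1: "(b1, \<beta>1) \<in> G" "ereal t < b1" using g[OF st(3)] g1 by auto
    have s1: "ereal s < b1" using st G1(2) by (auto intro: le_less_trans[of _ "ereal t"])
    have "dist (\<beta>1 s) (\<beta>1 t) \<le> K * (t - s)"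
      by (rule gradient_curve_dist_le[OF GD(2)[OF G1(1)] st(1,2) G1(2)])
    then show ?thesis using eq[OF G1(1), of s] eq[OF G1(1), of t] st G1 s1 by simp
  qed
  have grad: "gradient_curve f \<Omega> \<alpha> (Iv a b)"
  proof (rule gradient_curve_local_cong)
    show "K-lipschitz_on (Iv a b) \<alpha>"
    proof (rule lipschitz_onI)
      fix s t assume "s \<in> Iv a b" "t \<in> Iv a b"
      then show "dist (\<alpha> s) (\<alpha> t) \<le> K * dist s t"
        using dl[of s t] dl[of t s] by (cases "s \<le> t") (auto simp: dist_commute dist_real_def)
    qed (rule K)
    fix t assume t: "t \<in> Iv a b"
    obtain b1 \<beta>1 where g1: "g t = (b1, \<beta>1)" by (cases "g t")
    have G1: "(b1, \<beta>1) \<in> G" "ereal t < b1" using g[of t] t g1 by auto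
    \<comment> \<open>\<open>b1\<close> may be infinite; a real \<open>t'\<close> below it provides
      the finite length of neighbourhood required for gluing.\<close>
    obtain t' where t': "ereal t < ereal t'" "ereal t' < b1" using ereal_dense2[OF G1(2)] by blast
    have "\<alpha> s = \<beta>1 s" if "s \<in> {t..<t+(t'-t)}" for s
      using that t t' by (intro eq[OF G1(1)]) (auto intro: less_trans[of _ "ereal t'"])
    then show "\<exists>\<beta> J d. gradient_curve f \<Omega> \<beta> J \<and> t \<in> J \<and> d > 0 \<and> (\<forall>s\<in>{t..<t+d}. \<alpha> s = \<beta> s)"
      using GD(2)[OF G1(1)] G1(2) t t'
      by (intro exI[of _ \<beta>1] exI[of _ "Iv a b1"] exI[of _ "t' - t"] conjI) simp_all
  qed
  have esc: "\<exists>t0. ereal t0 < b \<and> (\<forall>t. t0 < t \<and> ereal t < b \<longrightarrow> (\<alpha> t, t) \<notin> C)"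
    if "b < \<infinity>" and C: "closed C" "C \<subseteq> \<Omega>" for C
  proof (rule ccontr)
    assume no: "\<not> ?thesis"
    obtain b0 where b0: "b = ereal b0" using ab \<open>b < \<infinity>\<close> by (cases b) auto
    have "\<exists>T>0. \<exists>\<beta>. \<beta> a = \<alpha> a \<and> gradient_curve f \<Omega> \<beta> (Iv a (ereal (b0 + T)))"
    proof (rule gradient_curve_extend[OF _ _ C])
      show "gradient_curve f \<Omega> \<alpha> (Iv a (ereal b0))" using grad b0 by simp
      show "a < b0" using ab b0 by simp
      show "\<exists>t>t0. t < b0 \<and> (\<alpha> t, t) \<in> C" if "t0 < b0" for t0 using no that unfolding b0 by auto
    qed
    then obtain T \<beta> where T: "T > 0" and \<beta>: "\<beta> a = \<alpha> a" "gradient_curve f \<Omega> \<beta> (Iv a (ereal (b0 + T)))" by blast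
    have "(ereal (b0 + T), \<beta>) \<in> G" using \<beta> aa ab b0 T unfolding G_def by auto
    from up[OF this] show False using b0 T by simp
  qed
  have max: "b' \<le> b \<and> (\<forall>t. a \<le> t \<and> ereal t < b' \<longrightarrow> \<beta> t = \<alpha> t)"
    if "b' > ereal a \<and> \<beta> a = p \<and> gradient_curve f \<Omega> \<beta> (Iv a b')" for b' \<beta>
  proof -
    have "(b', \<beta>) \<in> G" using that by (simp add: G_def)
    then show ?thesis using up eq by metis
  qed
  show ?thesis
    using ab aa grad max esc by (intro exI[of _ b] exI[of _ \<alpha>]) blast
qed

end

theorem theoremA4:
  fixes \<kappa> :: real
    and \<Omega> :: "('a::complete_space \<times> real) set"
    and f :: "real \<Rightarrow> 'a \<Rightarrow> real"
  assumes "length_space (UNIV :: 'a set)"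
    and "CAT \<kappa> (UNIV :: 'a set)"
    and "open \<Omega>"
    and "lipschitz_family f \<Omega>"
    and "locally_semiconcave_family f \<Omega>"
    and "(p, a) \<in> \<Omega>"
  shows "\<exists>b \<alpha>. b > ereal a \<and> \<alpha> a = p \<and> gradient_curve f \<Omega> \<alpha> {t. a \<le> t \<and> ereal t < b} \<and>
     (\<forall>b' \<beta>. b' > ereal a \<and> \<beta> a = p \<and> gradient_curve f \<Omega> \<beta> {t. a \<le> t \<and> ereal t < b'} \<longrightarrow>
        b' \<le> b \<and> (\<forall>t. a \<le> t \<and> ereal t < b' \<longrightarrow> \<beta> t = \<alpha> t)) \<and>
     (b < \<infinity> \<longrightarrow> (\<forall>K. closed K \<and> K \<subseteq> \<Omega> \<longrightarrow>
        (\<exists>t0. ereal t0 < b \<and> (\<forall>t. t0 < t \<and> ereal t < b \<longrightarrow> (\<alpha> t, t) \<notin> K))))"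
proof -
  obtain L0 where L0: "L0-lipschitz_on \<Omega> (\<lambda>(x, t). f t x)"
    using assms(4) unfolding lipschitz_family_def by blast
  \<comment> \<open>Enlarging the constant to at least 1 meets the normalisation in
    \<open>local_flow\<close>.\<close>
  define L where "L = max 1 L0"
  have L: "L-lipschitz_on \<Omega> (\<lambda>(x, t). f t x)" "1 \<le> L"
    using L0 by (auto simp: L_def intro: lipschitz_on_le)
  note flow = local_flow_exists[OF assms(2) L assms(5)]
  interpret gradient_flow_local f \<Omega> "8 * L"
  proof
    fix p t assume "(p, t) \<in> \<Omega>"
    from flow[OF this] show "\<exists>T>0. \<exists>\<alpha>. \<alpha> t = p \<and> gradient_curve f \<Omega> \<alpha> {t..<t+T} \<and> (8 * L)-lipschitz_on {t..<t+T} \<alpha>"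
      using local_gradient_curve_exists by blast
  next
    fix \<alpha> \<beta> t T
    assume \<alpha>: "gradient_curve f \<Omega> \<alpha> {t..<t+T}" and \<beta>: "gradient_curve f \<Omega> \<beta> {t..<t+T}" and T: "0 < T" and eq: "\<alpha> t = \<beta> t"
    \<comment> \<open>A gradient curve stays in \<Omega>, so the local set-up can be centred at the
      common point of the two curves.\<close>
    have "(\<alpha> t, t) \<in> \<Omega>" using \<alpha> T unfolding gradient_curve_def by auto
    from flow[OF this] obtain \<phi> \<sigma> R B r \<tau> c where "local_flow \<phi> \<sigma> R B f (\<alpha> t) t r \<tau> L c" by blast
    from local_flow.gradient_curves_agree[OF this \<alpha> \<beta> order_refl T refl] eq
    show "\<exists>d>0. \<forall>s\<in>{t..<t+d}. \<alpha> s = \<beta> s" by simp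
  qed
  show ?thesis by (rule maximal_gradient_curve[OF assms(6)])
qed

end
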